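(* Let $p$ be a prime, $h_1,h_2$ relatively prime positive integers, $h=h_1+h_2$, and $F$ the 2-dimensional Lubin–Tate formal group over $\mathbb{Z}_p$ associated with $(h_1,h_2)$. Let $U_h$ be the unramified extension of degree $h$ of $\mathbb{Q}_p$ in $\overline{\mathbb{Q}}_p$, and let $U_h(\mathrm{Tors}(F))$ be the field generated over $U_h$ by the coordinates of all points of $\mathrm{Tors}(F)=\bigcup_{n\ge1}F[p^n]$. Then the extension $U_h(\mathrm{Tors}(F))/U_h$ is abelian.
   Context: $L=(L_1,L_2)$ with $L_1=x_1+\sum_{k\ge1}p^{-2k}x_1^{p^{kh}}+\sum_{k\ge0}p^{-(2k+1)}x_2^{p^{h_1+kh}}$, $L_2=x_2+\sum_{k\ge1}p^{-2k}x_2^{p^{kh}}+\sum_{k\ge0}p^{-(2k+1)}x_1^{p^{h_2+kh}}$, and $F(X,Y)=L^{-1}(L(X)+L(Y))$, a 2-dimensional formal group with coefficients in $\mathbb{Z}_p$. For $a\in\mathbb{Z}_p$, $[a]_F(X)=L^{-1}(aL(X))$, and $F[p^n]=\{X\in\overline{\mathbb{Q}}_p^{\,2}:[p^n]_F(X)=\vec0\}$. *)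

theory Defs
  imports Complex_Main "HOL-Computational_Algebra.Polynomial"
    "HOL-Computational_Algebra.Primes"
begin

text \<open>A power series in x1, x2 is its coefficient function: (i,j) gives the
coefficient of x1^i x2^j.\<close>

type_synonym ser2 = "nat \<times> nat \<Rightarrow> rat"

definition ser_one :: ser2 where
  "ser_one = (\<lambda>(i,j). if i = 0 \<and> j = 0 then 1 else 0)"

definition ser_X1 :: ser2 where
  "ser_X1 = (\<lambda>(i,j). if i = 1 \<and> j = 0 then 1 else 0)"

definition ser_X2 :: ser2 where
  "ser_X2 = (\<lambda>(i,j). if i = 0 \<and> j = 1 then 1 else 0)"

definition ser_mult :: "ser2 \<Rightarrow> ser2 \<Rightarrow> ser2" where
  "ser_mult f g = (\<lambda>(i,j). \<Sum>a\<le>i. \<Sum>b\<le>j. f (a,b) * g (i - a, j - b))"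

fun ser_pow :: "ser2 \<Rightarrow> nat \<Rightarrow> ser2" where
  "ser_pow f 0 = ser_one"
| "ser_pow f (Suc n) = ser_mult f (ser_pow f n)"

definition ser_smult :: "rat \<Rightarrow> ser2 \<Rightarrow> ser2" where
  "ser_smult c f = (\<lambda>ij. c * f ij)"

text \<open>Substitution f(g1,g2); meaningful when g1, g2 have zero constant term,
in which case only monomials of total degree at most i+j contribute to the
coefficient of x1^i x2^j.\<close>
definition ser_comp :: "ser2 \<Rightarrow> ser2 \<times> ser2 \<Rightarrow> ser2" where
  "ser_comp f g = (\<lambda>(i,j). \<Sum>a\<le>i+j. \<Sum>b\<le>i+j-a.
      f (a,b) * ser_mult (ser_pow (fst g) a) (ser_pow (snd g) b) (i,j))"

definition ser2_comp :: "ser2 \<times> ser2 \<Rightarrow> ser2 \<times> ser2 \<Rightarrow> ser2 \<times> ser2" where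
  "ser2_comp F G = (ser_comp (fst F) G, ser_comp (snd F) G)"

definition no_const :: "ser2 \<times> ser2 \<Rightarrow> bool" where
  "no_const G \<longleftrightarrow> fst G (0,0) = 0 \<and> snd G (0,0) = 0"

definition ser2_inv :: "ser2 \<times> ser2 \<Rightarrow> ser2 \<times> ser2" where
  "ser2_inv L = (THE M. no_const M \<and> ser2_comp L M = (ser_X1, ser_X2))"

definition LT_L1 :: "nat \<Rightarrow> nat \<Rightarrow> nat \<Rightarrow> ser2" where
  "LT_L1 p h1 h2 = (\<lambda>(i,j).
     (if j = 0 then (\<Sum>k\<le>i. if i = p ^ (k * (h1 + h2)) then 1 / of_nat p ^ (2 * k) else 0) else 0)
   + (if i = 0 then (\<Sum>k\<le>j. if j = p ^ (h1 + k * (h1 + h2)) then 1 / of_nat p ^ (2 * k + 1) else 0) else 0))"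

definition LT_L2 :: "nat \<Rightarrow> nat \<Rightarrow> nat \<Rightarrow> ser2" where
  "LT_L2 p h1 h2 = (\<lambda>(i,j).
     (if i = 0 then (\<Sum>k\<le>j. if j = p ^ (k * (h1 + h2)) then 1 / of_nat p ^ (2 * k) else 0) else 0)
   + (if j = 0 then (\<Sum>k\<le>i. if i = p ^ (h2 + k * (h1 + h2)) then 1 / of_nat p ^ (2 * k + 1) else 0) else 0))"

definition LT_L :: "nat \<Rightarrow> nat \<Rightarrow> nat \<Rightarrow> ser2 \<times> ser2" where
  "LT_L p h1 h2 = (LT_L1 p h1 h2, LT_L2 p h1 h2)"

definition LT_mult :: "nat \<Rightarrow> nat \<Rightarrow> nat \<Rightarrow> rat \<Rightarrow> ser2 \<times> ser2" where
  "LT_mult p h1 h2 a = ser2_comp (ser2_inv (LT_L p h1 h2))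
      (ser_smult a (LT_L1 p h1 h2), ser_smult a (LT_L2 p h1 h2))"

definition padic_abs :: "nat \<Rightarrow> rat \<Rightarrow> real" where
  "padic_abs p q = (let (a, b) = quotient_of q in
     if a = 0 then 0
     else real p powr (real (multiplicity (int p) b) - real (multiplicity (int p) a)))"

definition nonarch_abs :: "('a::field \<Rightarrow> real) \<Rightarrow> bool" where
  "nonarch_abs v \<longleftrightarrow> (\<forall>x. v x \<ge> 0) \<and> (\<forall>x. v x = 0 \<longleftrightarrow> x = 0)
     \<and> (\<forall>x y. v (x * y) = v x * v y) \<and> (\<forall>x y. v (x + y) \<le> max (v x) (v y))"

definition conv_to :: "('a::field \<Rightarrow> real) \<Rightarrow> (nat \<Rightarrow> 'a) \<Rightarrow> 'a \<Rightarrow> bool" where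
  "conv_to v X l \<longleftrightarrow> (\<forall>e>0. \<exists>N. \<forall>n\<ge>N. v (X n - l) < e)"

definition cauchy_v :: "('a::field \<Rightarrow> real) \<Rightarrow> (nat \<Rightarrow> 'a) \<Rightarrow> bool" where
  "cauchy_v v X \<longleftrightarrow> (\<forall>e>0. \<exists>N. \<forall>m\<ge>N. \<forall>n\<ge>N. v (X m - X n) < e)"

definition Qp_in :: "('a::field_char_0 \<Rightarrow> real) \<Rightarrow> 'a set" where
  "Qp_in v = {x. \<forall>e>0. \<exists>q. v (x - of_rat q) < e}"

definition is_subfield :: "'a::field set \<Rightarrow> bool" where
  "is_subfield S \<longleftrightarrow> 0 \<in> S \<and> 1 \<in> S \<and> (\<forall>x\<in>S. \<forall>y\<in>S. x + y \<in> S \<and> x - y \<in> S \<and> x * y \<in> S)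
     \<and> (\<forall>x\<in>S. inverse x \<in> S)"

definition alg_closed_field :: "'a::field itself \<Rightarrow> bool" where
  "alg_closed_field _ \<longleftrightarrow> (\<forall>P :: 'a poly. degree P \<ge> 1 \<longrightarrow> (\<exists>x. poly P x = 0))"

definition algebraic_over :: "'a::field set \<Rightarrow> 'a \<Rightarrow> bool" where
  "algebraic_over F x \<longleftrightarrow> (\<exists>P :: 'a poly. P \<noteq> 0 \<and> (\<forall>i. coeff P i \<in> F) \<and> poly P x = 0)"

definition is_alg_closure_Qp :: "nat \<Rightarrow> ('a::field_char_0 \<Rightarrow> real) \<Rightarrow> bool" where
  "is_alg_closure_Qp p v \<longleftrightarrow> nonarch_abs v
     \<and> (\<forall>q. v (of_rat q) = padic_abs p q)
     \<and> (\<forall>X. (\<forall>n. X n \<in> Qp_in v) \<and> cauchy_v v X \<longrightarrow> (\<exists>l. conv_to v X l))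
     \<and> alg_closed_field TYPE('a)
     \<and> (\<forall>x. algebraic_over (Qp_in v) x)"

definition lin_comb :: "'a::field list \<Rightarrow> 'a list \<Rightarrow> 'a" where
  "lin_comb cs bs = sum_list (map2 (*) cs bs)"

definition has_degree :: "'a::field set \<Rightarrow> 'a set \<Rightarrow> nat \<Rightarrow> bool" where
  "has_degree F E n \<longleftrightarrow> (\<exists>bs. length bs = n
     \<and> (\<forall>cs. length cs = n \<and> set cs \<subseteq> F \<and> lin_comb cs bs = 0 \<longrightarrow> (\<forall>c\<in>set cs. c = 0))
     \<and> E = {lin_comb cs bs | cs. length cs = n \<and> set cs \<subseteq> F})"

text \<open>Unramified over Q_p (ramification index 1): same value group.\<close>
definition unramified_over :: "('a::field \<Rightarrow> real) \<Rightarrow> 'a set \<Rightarrow> 'a set \<Rightarrow> bool" where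
  "unramified_over v F E \<longleftrightarrow> v ` (E - {0}) = v ` (F - {0})"

definition gen_field :: "'a::field set \<Rightarrow> 'a set \<Rightarrow> 'a set" where
  "gen_field E T = \<Inter>{S. is_subfield S \<and> E \<subseteq> S \<and> T \<subseteq> S}"

definition emb_over :: "'a::field set \<Rightarrow> 'a set \<Rightarrow> ('a \<Rightarrow> 'a) \<Rightarrow> bool" where
  "emb_over E M \<sigma> \<longleftrightarrow> (\<forall>x\<in>M. \<forall>y\<in>M. \<sigma> (x + y) = \<sigma> x + \<sigma> y \<and> \<sigma> (x * y) = \<sigma> x * \<sigma> y)
     \<and> \<sigma> 1 = 1 \<and> (\<forall>x\<in>E. \<sigma> x = x)"

text \<open>In characteristic 0 (separability automatic) M/E is Galois iff it is
normal: every E-embedding of M into the algebraically closed ambient field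
maps M onto M.  It is abelian if moreover its Galois group is commutative.\<close>
definition abelian_ext :: "'a::field set \<Rightarrow> 'a set \<Rightarrow> bool" where
  "abelian_ext E M \<longleftrightarrow> (\<forall>\<sigma>. emb_over E M \<sigma> \<longrightarrow> \<sigma> ` M = M)
     \<and> (\<forall>\<sigma> \<tau>. emb_over E M \<sigma> \<and> emb_over E M \<tau> \<longrightarrow> (\<forall>x\<in>M. \<sigma> (\<tau> x) = \<tau> (\<sigma> x)))"

definition ser_eval_to :: "('a::field_char_0 \<Rightarrow> real) \<Rightarrow> ser2 \<Rightarrow> 'a \<Rightarrow> 'a \<Rightarrow> 'a \<Rightarrow> bool" where
  "ser_eval_to v f x y s \<longleftrightarrow>
     conv_to v (\<lambda>N. \<Sum>i<N. \<Sum>j<N - i. of_rat (f (i,j)) * x ^ i * y ^ j) s"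

definition LT_torsion :: "nat \<Rightarrow> nat \<Rightarrow> nat \<Rightarrow> ('a::field_char_0 \<Rightarrow> real) \<Rightarrow> nat \<Rightarrow> ('a \<times> 'a) set" where
  "LT_torsion p h1 h2 v n = {(x,y). v x < 1 \<and> v y < 1
     \<and> ser_eval_to v (fst (LT_mult p h1 h2 (of_nat (p ^ n)))) x y 0
     \<and> ser_eval_to v (snd (LT_mult p h1 h2 (of_nat (p ^ n)))) x y 0}"

definition LT_Tors :: "nat \<Rightarrow> nat \<Rightarrow> nat \<Rightarrow> ('a::field_char_0 \<Rightarrow> real) \<Rightarrow> ('a \<times> 'a) set" where
  "LT_Tors p h1 h2 v = (\<Union>n\<in>{1..}. LT_torsion p h1 h2 v n)"

definition coords :: "('a \<times> 'a) set \<Rightarrow> 'a set" where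
  "coords S = fst ` S \<union> snd ` S"

end

theory Submission
  imports Defs "HOL-Computational_Algebra.Formal_Power_Series" "HOL-Number_Theory.Cong"
begin

text \<open>
  Write \<open>q = p ^ h\<close>, \<open>q1 = p ^ h1\<close>, \<open>q2 = p ^ h2\<close> and \<open>\<psi>(X) = (x2 ^ q1, x1 ^ q2)\<close>. The logarithm satisfies
  \<open>L(X) = X + L(\<psi>(X)) / p\<close>, so Hazewinkel's functional equation argument shows that formal subtraction
  \<open>L\<inverse>(L(X) - L(Y))\<close> is integral. Torsion points are handled through formal points: pairs of one-variable
  power series without constant term whose coefficients decay geometrically, specialised at \<open>t = 1\<close>. Taking
  logarithms turns them into an additive group, and the points of the formal group become its quotient by the
  logarithms of formal points specialising to the origin.

  A root of unity \<open>\<zeta>\<close> with \<open>\<zeta> ^ q = \<zeta>\<close> acts by \<open>(x1, x2) \<mapsto> (\<zeta> x1, \<zeta> ^ q2 x2)\<close>. From \<open>[p](X) = L\<inverse>(p X) + \<psi>(X)\<close>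
  one reads off that the nonzero points killed by \<open>p\<close> satisfy \<open>x1 ^ (q - 1) = (-p) ^ (q1 + 1) u\<close> with \<open>u\<close> a
  principal unit, and that any two of them differ by such a \<open>\<zeta>\<close>. Hence every torsion point of exact order
  \<open>p ^ n\<close> generates all points killed by \<open>p ^ n\<close> under finite sums \<open>\<Sum> \<zeta>\<^sub>i p ^ i\<close>. These endomorphisms are defined
  over \<open>U\<close>, because \<open>U\<close> contains all \<open>\<zeta>\<close>; so every embedding over \<open>U\<close> commutes with them and acts on a given
  torsion point as one of them, whence any two embeddings commute.
\<close>

text \<open>\<open>L\<close> has unbounded denominators and torsion points are zeros of it, so
  neither \<open>L\<close> nor \<open>L^-1\<close> can be used freely on values. Identities between
  them are therefore proved for series in one variable \<open>t\<close> and specialised at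
  \<open>t = 1\<close> only afterwards; integrality of formal subtraction is what makes the result
  depend on the specialised values alone. Since the algebraic closure is not complete, limits are
  taken in finite-dimensional algebras over the p-adic numbers that contain all coefficients. A
  point has many lifts, and this freedom is used: \<open>x t\<close> records only
  \<open>v x < 1\<close>, whereas \<open>x t ^ (q1 + 1)\<close>, with radius \<open>\<rho>\<close>
  and \<open>\<rho> ^ (q - 1) = 1 / p\<close>, records the exact absolute value of a nonzero point
  killed by \<open>p\<close>. Orders of vanishing then show that if \<open>\<zeta>\<close> matches
  the leading terms of two such points, their formal difference is too small to be a nonzero point
  killed by \<open>p\<close>. Embeddings are given as abstract field maps; they pass through limits
  because linear maps on finite-dimensional spaces are bounded.\<close>

unbundle fps_syntax

section \<open>Non-archimedean absolute values\<close>

locale nonarch =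
  fixes v :: "'a::field_char_0 \<Rightarrow> real"
  assumes nonarch: "nonarch_abs v"
begin

lemma v_nonneg [simp]: "v x \<ge> 0"
  using nonarch by (auto simp: nonarch_abs_def)

lemma v_eq_0 [simp]: "v x = 0 \<longleftrightarrow> x = 0"
  using nonarch by (auto simp: nonarch_abs_def)

lemma v_mult: "v (x * y) = v x * v y"
  using nonarch by (auto simp: nonarch_abs_def)

lemma v_add: "v (x + y) \<le> max (v x) (v y)"
  using nonarch by (auto simp: nonarch_abs_def)

lemma v_0 [simp]: "v 0 = 0"
  by simp

lemma v_pos: "x \<noteq> 0 \<Longrightarrow> v x > 0"
  using v_nonneg[of x] v_eq_0[of x] by linarith

lemma v_1 [simp]: "v 1 = 1"
proof -
  have "v 1 * v 1 = v 1 * 1" using v_mult[of 1 1] by simp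
  then show ?thesis using v_eq_0[of 1] by simp
qed

lemma v_minus [simp]: "v (- x) = v x"
proof -
  have "v (-1) * v (-1) = 1" using v_mult[of "-1" "-1"] by simp
  then have "v (-1) = 1" by (metis abs_of_nonneg abs_square_eq_1 power2_eq_square v_nonneg)
  then show ?thesis using v_mult[of "-1" x] by simp
qed

lemma v_diff: "v (x - y) \<le> max (v x) (v y)"
  using v_add[of x "-y"] by simp

lemma v_diff_commute: "v (x - y) = v (y - x)"
  using v_minus[of "x - y"] by simp

lemma v_power: "v (x ^ n) = v x ^ n"
  by (induction n) (auto simp: v_mult)

lemma v_inverse: "v (inverse x) = inverse (v x)"
proof (cases "x = 0")
  case False
  then have "v x * v (inverse x) = 1" using v_mult[of x "inverse x"] by simp
  then show ?thesis using False by (simp add: field_simps)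
qed auto

lemma v_divide: "v (x / y) = v x / v y"
  by (simp add: divide_inverse v_mult v_inverse)

lemma v_add_le: "v x \<le> c \<Longrightarrow> v y \<le> c \<Longrightarrow> v (x + y) \<le> c"
  using v_add[of x y] by auto

lemma v_add_less: "v x < c \<Longrightarrow> v y < c \<Longrightarrow> v (x + y) < c"
  using v_add[of x y] by auto

lemma v_diff_le: "v x \<le> c \<Longrightarrow> v y \<le> c \<Longrightarrow> v (x - y) \<le> c"
  using v_diff[of x y] by auto

lemma v_diff_less: "v x < c \<Longrightarrow> v y < c \<Longrightarrow> v (x - y) < c"
  using v_diff[of x y] by auto

lemma v_sum_le: "(\<And>i. i \<in> A \<Longrightarrow> v (f i) \<le> c) \<Longrightarrow> c \<ge> 0 \<Longrightarrow> v (sum f A) \<le> c"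
  by (induction A rule: infinite_finite_induct) (auto intro: v_add_le)

lemma v_sum_less: "(\<And>i. i \<in> A \<Longrightarrow> v (f i) < c) \<Longrightarrow> c > 0 \<Longrightarrow> v (sum f A) < c"
  by (induction A rule: infinite_finite_induct) (auto intro: v_add_less)

lemma v_add_eq: assumes "v x < v y" shows "v (x + y) = v y"
proof -
  have "v y \<le> max (v (x + y)) (v x)" using v_diff[of "x + y" x] by simp
  moreover have "v (x + y) \<le> v y" using v_add[of x y] assms by simp
  ultimately show ?thesis using assms by linarith
qed

lemma v_eq_of_close: assumes "v (x - y) < v y" shows "v x = v y"
  using v_add_eq[OF assms] by simp

lemma v_of_nat_le: "v (of_nat n) \<le> 1"
  by (induction n) (auto intro: v_add_le)

lemma v_of_int_le: "v (of_int n) \<le> 1"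
  by (cases n) (use v_of_nat_le in \<open>auto simp del: of_nat_Suc\<close>)

lemma conv_to_unique:
  assumes "conv_to v X a" "conv_to v X b" shows "a = b"
proof (rule ccontr)
  assume "a \<noteq> b"
  then have e: "v (a - b) > 0" using v_pos by simp
  obtain N where N: "\<forall>n\<ge>N. v (X n - a) < v (a - b)" using assms(1) e unfolding conv_to_def by blast
  obtain M where M: "\<forall>n\<ge>M. v (X n - b) < v (a - b)" using assms(2) e unfolding conv_to_def by blast
  let ?n = "max N M"
  have "v ((X ?n - b) - (X ?n - a)) < v (a - b)" using N M by (intro v_diff_less[of "X ?n - b"]) auto
  then show False by simp
qed

lemma conv_to_imp_cauchy:
  assumes "conv_to v X a" shows "cauchy_v v X"
  unfolding cauchy_v_def
proof (intro allI impI)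
  fix e :: real assume "e > 0"
  then obtain N where N: "\<forall>n\<ge>N. v (X n - a) < e" using assms unfolding conv_to_def by blast
  have "v ((X m - a) - (X n - a)) < e" if "m \<ge> N" "n \<ge> N" for m n
    using N that by (intro v_diff_less[of "X m - a"]) auto
  then show "\<exists>N. \<forall>m\<ge>N. \<forall>n\<ge>N. v (X m - X n) < e" by (intro exI[of _ N]) auto
qed

lemma conv_to_iff_LIMSEQ: "conv_to v X a \<longleftrightarrow> (\<lambda>n. v (X n - a)) \<longlonglongrightarrow> 0"
  unfolding conv_to_def LIMSEQ_def by (simp add: dist_real_def)

lemma conv_to_bound: "c \<longlonglongrightarrow> 0 \<Longrightarrow> (\<And>n. v (X n - a) \<le> c n) \<Longrightarrow> conv_to v X a"
  unfolding conv_to_iff_LIMSEQ by (rule tendsto_sandwich[of "\<lambda>_. 0" _ _ c]) auto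

lemma conv_to_add:
  assumes "conv_to v X a" "conv_to v Y b" shows "conv_to v (\<lambda>n. X n + Y n) (a + b)"
proof -
  have "v (X n + Y n - (a + b)) \<le> v (X n - a) + v (Y n - b)" for n
    using v_add[of "X n - a" "Y n - b"] v_nonneg[of "X n - a"] v_nonneg[of "Y n - b"]
    by (simp add: algebra_simps del: v_nonneg)
  moreover have "(\<lambda>n. v (X n - a) + v (Y n - b)) \<longlonglongrightarrow> 0"
    using assms tendsto_add[of "\<lambda>n. v (X n - a)" 0 _ "\<lambda>n. v (Y n - b)" 0]
    by (simp add: conv_to_iff_LIMSEQ)
  ultimately show ?thesis by (rule conv_to_bound[rotated])
qed

lemma conv_to_cmult:
  assumes "conv_to v X a" shows "conv_to v (\<lambda>n. c * X n) (c * a)"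
proof -
  have "v (c * X n - c * a) = v c * v (X n - a)" for n
    by (metis right_diff_distrib v_mult)
  then show ?thesis using assms tendsto_mult_left[of "\<lambda>n. v (X n - a)" 0 _ "v c"]
    by (simp add: conv_to_iff_LIMSEQ)
qed

lemma conv_to_mult:
  assumes "conv_to v X a" "conv_to v Y b" shows "conv_to v (\<lambda>n. X n * Y n) (a * b)"
proof -
  have *: "v (X n * Y n - a * b) \<le> v (X n - a) * v (Y n - b) + v b * v (X n - a) + v a * v (Y n - b)" for n
  proof -
    have eq: "X n * Y n - a * b = ((X n - a) * (Y n - b) + b * (X n - a)) + a * (Y n - b)"
      by (simp add: algebra_simps)
    have "v (X n * Y n - a * b) \<le> max (max (v ((X n - a) * (Y n - b))) (v (b * (X n - a)))) (v (a * (Y n - b)))"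
      unfolding eq using v_add[of "(X n - a) * (Y n - b) + b * (X n - a)" "a * (Y n - b)"]
        v_add[of "(X n - a) * (Y n - b)" "b * (X n - a)"] by linarith
    also have "\<dots> \<le> v (X n - a) * v (Y n - b) + v b * v (X n - a) + v a * v (Y n - b)"
      by (simp add: v_mult add_increasing add_increasing2)
    finally show ?thesis .
  qed
  have "(\<lambda>n. v (X n - a) * v (Y n - b) + v b * v (X n - a) + v a * v (Y n - b)) \<longlonglongrightarrow> 0 * 0 + v b * 0 + v a * 0"
    using assms unfolding conv_to_iff_LIMSEQ by (intro tendsto_intros)
  then show ?thesis using * by (intro conv_to_bound) auto
qed

lemma conv_to_const [simp]: "conv_to v (\<lambda>n. a) a"
  by (simp add: conv_to_def)

lemma conv_to_diff:
  assumes "conv_to v X a" "conv_to v Y b" shows "conv_to v (\<lambda>n. X n - Y n) (a - b)"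
  using conv_to_add[OF assms(1) conv_to_cmult[OF assms(2), of "-1"]] by simp

lemma conv_to_le:
  assumes "conv_to v X a" "\<And>n. n \<ge> N \<Longrightarrow> v (X n) \<le> c" shows "v a \<le> c"
proof (rule ccontr)
  assume "\<not> v a \<le> c"
  moreover have "c \<ge> 0" using assms(2)[of N] v_nonneg[of "X N"] by linarith
  ultimately have "v a > 0" by simp
  then obtain M where M: "\<forall>n\<ge>M. v (X n - a) < v a" using assms(1) unfolding conv_to_def by blast
  then have "v (X (max M N)) = v a" by (intro v_eq_of_close) auto
  then show False using assms(2)[of "max M N"] \<open>\<not> v a \<le> c\<close> by simp
qed

text \<open>Relative to a subset, because the ambient algebraic closure is not complete; the limit
  is required to lie in the subset again.\<close>

definition v_complete :: "'a set \<Rightarrow> bool" where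
  "v_complete V \<longleftrightarrow> (\<forall>X. (\<forall>n. X n \<in> V) \<and> cauchy_v v X \<longrightarrow> (\<exists>l\<in>V. conv_to v X l))"

lemma v_completeD:
  assumes "v_complete V" "\<And>n. X n \<in> V" "conv_to v X a" shows "a \<in> V"
proof -
  obtain l where "l \<in> V" "conv_to v X l"
    using assms(1,2) conv_to_imp_cauchy[OF assms(3)] unfolding v_complete_def by blast
  then show ?thesis using conv_to_unique assms(3) by blast
qed

text \<open>By the ultrametric inequality the distance of two far terms is at most the largest
  single step between them.\<close>

lemma cauchy_v_of_consecutive:
  assumes "\<And>n. v (X (Suc n) - X n) \<le> c n" "c \<longlonglongrightarrow> 0"
  shows "cauchy_v v X"
  unfolding cauchy_v_def
proof (intro allI impI)
  fix e :: real assume e: "e > 0"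
  then obtain N where N: "\<forall>n\<ge>N. c n < e"
    using assms(2) unfolding LIMSEQ_def dist_real_def by (metis abs_ge_self le_less_trans diff_zero)
  have *: "v (X n - X N) < e" if "n \<ge> N" for n
    using that
  proof (induction n rule: dec_induct)
    case (step n)
    have "v ((X (Suc n) - X n) + (X n - X N)) < e"
      using N assms(1)[of n] step by (intro v_add_less) (auto intro: le_less_trans)
    then show ?case by simp
  qed (use e in simp)
  have "v ((X m - X N) - (X n - X N)) < e" if "m \<ge> N" "n \<ge> N" for m n
    using * that by (intro v_diff_less[of "X m - X N"]) auto
  then show "\<exists>N. \<forall>m\<ge>N. \<forall>n\<ge>N. v (X m - X n) < e" by (intro exI[of _ N]) auto
qed

end

section \<open>The field of p-adic numbers inside the ambient field\<close>

lemma (in nonarch) conv_to_inverse: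
  assumes X: "conv_to v X a" and a: "a \<noteq> 0"
  shows "conv_to v (\<lambda>n. inverse (X n)) (inverse a)"
  unfolding conv_to_def
proof (intro allI impI)
  fix e :: real assume e: "e > 0"
  have va: "v a > 0" using a v_pos by simp
  \<comment> \<open>Closeness below \<open>v a\<close> forces \<open>v (X n) = v a\<close>; the
    second bound pays for the denominator \<open>v a * v a\<close> of the difference of
    inverses.\<close>
  define d where "d = min (v a) (e * v a * v a)"
  have "d > 0" using va e by (simp add: d_def)
  then obtain N where N: "\<forall>n\<ge>N. v (X n - a) < d" using X unfolding conv_to_def by blast
  have "v (inverse (X n) - inverse a) < e" if "n \<ge> N" for n
  proof -
    have *: "v (X n - a) < v a" "v (X n - a) < e * v a * v a" using N that by (auto simp: d_def)
    have vX: "v (X n) = v a" by (rule v_eq_of_close) (rule *)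
    then have Xn: "X n \<noteq> 0" using va by auto
    have "inverse (X n) - inverse a = (a - X n) * (inverse (X n) * inverse a)"
      using Xn a by (simp add: field_simps)
    then have "v (inverse (X n) - inverse a) = v (X n - a) / (v a * v a)"
      using vX by (simp add: v_mult v_inverse v_diff_commute[of a] divide_inverse)
    also have "\<dots> < e" using * va by (simp add: field_simps)
    finally show ?thesis .
  qed
  then show "\<exists>N. \<forall>n\<ge>N. v (inverse (X n) - inverse a) < e" by blast
qed

locale padic = nonarch v for v :: "'a::field_char_0 \<Rightarrow> real" +
  fixes p :: nat
  assumes prime_p: "prime p"
    and v_rat: "\<And>q. v (of_rat q) = padic_abs p q"
    and Qp_cauchy: "\<And>X. (\<And>n. X n \<in> Qp_in v) \<Longrightarrow> cauchy_v v X \<Longrightarrow> \<exists>l. conv_to v X l"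
begin

abbreviation Qp :: "'a set" where "Qp \<equiv> Qp_in v"

lemma p_ge_2: "p \<ge> 2" using prime_p prime_ge_2_nat by blast

lemma p_pos [simp]: "p > 0" "real p > 0" "real p > 1"
  using p_ge_2 by auto

lemma p_gt_1 [simp]: "Suc 0 < p" "Suc 0 \<le> p" "p \<noteq> 0" "p \<noteq> Suc 0" using p_ge_2 by linarith+

lemma p_nonzero [simp]: "(of_nat p :: 'a) \<noteq> 0"
  using p_ge_2 by simp

lemma v_of_int_powr: "n \<noteq> 0 \<Longrightarrow> v (of_int n) = real p powr (- real (multiplicity (int p) n))"
  using v_rat[of "of_int n"] by (simp add: padic_abs_def)

lemma v_p: "v (of_nat p) = 1 / real p"
proof -
  have "multiplicity (int p) (int p) = 1"
    using prime_p by (intro multiplicity_self) (auto simp: prime_nat_iff)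
  then show ?thesis using v_of_int_powr[of "int p"] p_ge_2 by (simp add: powr_minus_divide)
qed

lemma v_of_int_less_1_iff: "v (of_int n) < 1 \<longleftrightarrow> int p dvd n"
proof
  assume "int p dvd n"
  then obtain m where "n = int p * m" by blast
  then have "v (of_int n) = v (of_int m) / real p" by (simp add: v_mult v_p)
  also have "\<dots> \<le> 1 / real p" by (intro divide_right_mono v_of_int_le) auto
  also have "\<dots> < 1" by simp
  finally show "v (of_int n) < 1" .
next
  assume *: "v (of_int n) < 1"
  show "int p dvd n"
  proof (rule ccontr)
    assume "\<not> int p dvd n"
    then have "multiplicity (int p) n = 0" "n \<noteq> 0" by (auto simp: not_dvd_imp_multiplicity_0)
    then show False using v_of_int_powr[of n] * by simp
  qed
qed

lemma v_of_rat_powr: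
  assumes "q \<noteq> 0" shows "\<exists>z::int. v (of_rat q) = real p powr real_of_int z"
proof -
  obtain a b where ab: "quotient_of q = (a, b)" by (cases "quotient_of q")
  then have "a \<noteq> 0" using assms quotient_of_div by fastforce
  then show ?thesis
    by (intro exI[of _ "int (multiplicity (int p) b) - int (multiplicity (int p) a)"])
      (simp add: v_rat padic_abs_def ab)
qed

lemma Qp_of_rat [simp]: "of_rat q \<in> Qp"
  unfolding Qp_in_def by (auto intro!: exI[of _ q])

lemma Qp_seq:
  assumes "x \<in> Qp" obtains q where "conv_to v (\<lambda>n. of_rat (q n)) x"
proof -
  have "\<forall>n. \<exists>r. v (x - of_rat r) < inverse (real (Suc n))"
    using assms unfolding Qp_in_def by simp
  then obtain q where q: "\<And>n. v (x - of_rat (q n)) < inverse (real (Suc n))" by metis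
  have "conv_to v (\<lambda>n. of_rat (q n)) x"
    by (rule conv_to_bound[OF LIMSEQ_inverse_real_of_nat])
      (use q in \<open>auto simp: v_diff_commute[of _ x] intro: less_imp_le\<close>)
  then show thesis by (rule that)
qed

lemma Qp_limit:
  assumes "conv_to v X a" "\<And>n. X n \<in> Qp" shows "a \<in> Qp"
  unfolding Qp_in_def
proof (clarify)
  fix e :: real assume e: "e > 0"
  then obtain n where n: "v (X n - a) < e" using assms(1) unfolding conv_to_def by blast
  obtain q where q: "v (X n - of_rat q) < e" using assms(2)[of n] e unfolding Qp_in_def by blast
  have "v ((X n - of_rat q) - (X n - a)) < e" using n q by (intro v_diff_less[of "X n - of_rat q"])
  then show "\<exists>q. v (a - of_rat q) < e" by (intro exI[of _ q]) simp
qed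

lemma Qp_complete: "v_complete Qp"
  unfolding v_complete_def using Qp_cauchy Qp_limit by blast

lemma Qp_add [intro]: assumes "x \<in> Qp" "y \<in> Qp" shows "x + y \<in> Qp"
proof -
  obtain q where q: "conv_to v (\<lambda>n. of_rat (q n)) x" using Qp_seq assms by blast
  obtain r where r: "conv_to v (\<lambda>n. of_rat (r n)) y" using Qp_seq assms by blast
  show ?thesis by (rule Qp_limit[OF conv_to_add[OF q r]]) (simp flip: of_rat_add)
qed

lemma Qp_mult [intro]: assumes "x \<in> Qp" "y \<in> Qp" shows "x * y \<in> Qp"
proof -
  obtain q where q: "conv_to v (\<lambda>n. of_rat (q n)) x" using Qp_seq assms by blast
  obtain r where r: "conv_to v (\<lambda>n. of_rat (r n)) y" using Qp_seq assms by blast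
  show ?thesis by (rule Qp_limit[OF conv_to_mult[OF q r]]) (simp flip: of_rat_mult)
qed

lemma Qp_inverse [intro]: assumes "x \<in> Qp" shows "inverse x \<in> Qp"
proof (cases "x = 0")
  case True then show ?thesis using Qp_of_rat[of 0] by simp
next
  case False
  obtain q where q: "conv_to v (\<lambda>n. of_rat (q n)) x" using Qp_seq assms by blast
  show ?thesis by (rule Qp_limit[OF conv_to_inverse[OF q False]]) (simp flip: of_rat_inverse)
qed

lemma Qp_0 [simp]: "0 \<in> Qp" and Qp_1 [simp]: "1 \<in> Qp" and Qp_of_int [simp]: "of_int n \<in> Qp"
  and Qp_of_nat [simp]: "of_nat m \<in> Qp"
  using Qp_of_rat[of 0] Qp_of_rat[of 1] Qp_of_rat[of "of_int n"] Qp_of_rat[of "of_nat m"] by simp_all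

lemma Qp_minus [intro]: "x \<in> Qp \<Longrightarrow> - x \<in> Qp"
  using Qp_mult[OF Qp_of_int[of "-1"], of x] by simp

lemma Qp_diff [intro]: "x \<in> Qp \<Longrightarrow> y \<in> Qp \<Longrightarrow> x - y \<in> Qp"
  using Qp_add[of x "-y"] by auto

lemma Qp_divide [intro]: "x \<in> Qp \<Longrightarrow> y \<in> Qp \<Longrightarrow> x / y \<in> Qp"
  by (auto simp: divide_inverse)

text \<open>A rational number closer to \<open>x\<close> than \<open>v x\<close> has the same
  absolute value, so completion does not enlarge the value group.\<close>

lemma v_Qp_powr:
  assumes "x \<in> Qp" "x \<noteq> 0" shows "\<exists>z::int. v x = real p powr real_of_int z"
proof -
  obtain q where q: "v (x - of_rat q) < v x" using assms v_pos[of x] unfolding Qp_in_def by blast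
  then have *: "v (of_rat q) = v x" using v_eq_of_close[of "of_rat q" x] by (simp add: v_diff_commute)
  then have "q \<noteq> 0" using assms(2) by auto
  then show ?thesis using * v_of_rat_powr by metis
qed

text \<open>The residue field is the prime field: a close rational \<open>a / b\<close> has absolute
  value at most 1, so \<open>p\<close> does not divide \<open>b\<close>, and \<open>b\<close> can be
  inverted modulo \<open>p\<close>.\<close>

lemma Qp_int_approx:
  assumes "x \<in> Qp" "v x \<le> 1" shows "\<exists>n::int. v (x - of_int n) < 1"
proof -
  obtain q where q: "v (x - of_rat q) < 1" using assms unfolding Qp_in_def by (auto dest: spec[of _ 1])
  have "v (x - (x - of_rat q)) \<le> 1" using q assms by (rule_tac v_diff_le[of x]) auto
  then have vq: "v (of_rat q) \<le> 1" by simp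
  obtain a b where ab: "quotient_of q = (a, b)" by (cases "quotient_of q")
  have cop: "coprime a b" and b: "b > 0"
    using ab quotient_of_coprime quotient_of_denom_pos by blast+
  have qab: "(of_rat q :: 'a) = of_int a / of_int b"
    using quotient_of_div[OF ab] by (simp add: of_rat_divide)
  have "\<not> int p dvd b"
  proof
    assume pb: "int p dvd b"
    then have "v (of_int b) < 1" using v_of_int_less_1_iff by simp
    moreover have "\<not> int p dvd a" using cop pb prime_p
      by (metis coprime_common_divisor not_prime_unit prime_nat_int_transfer)
    then have "v (of_int a) = 1" using v_of_int_less_1_iff[of a] v_of_int_le[of a] by linarith
    moreover have "v (of_int b) > 0" using b by (intro v_pos) simp
    ultimately show False using vq by (simp add: qab v_divide field_simps)
  qed
  then have "coprime b (int p)" using prime_p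
    by (metis coprime_commute prime_imp_coprime prime_nat_int_transfer)
  then obtain c where c: "[b * c = 1] (mod int p)" using cong_solve_coprime_int by blast
  then have "int p dvd (b * c - 1)" by (simp add: cong_iff_dvd_diff)
  then have "v (of_int (b * c - 1)) < 1" using v_of_int_less_1_iff by blast
  moreover have vb: "v (of_int b) = 1" using \<open>\<not> int p dvd b\<close> v_of_int_less_1_iff[of b] v_of_int_le[of b] by linarith
  moreover have "of_rat q - of_int (a * c) = - of_rat q * (of_int (b * c - 1) :: 'a)"
    using b by (simp add: qab field_simps)
  then have "v (of_rat q - of_int (a * c)) = v (of_rat q) * v (of_int (b * c - 1))"
    by (simp only: v_mult v_minus)
  ultimately have "v (of_rat q - of_int (a * c)) < 1" using vq
    by (metis mult_left_le_one_le order.strict_trans1 v_nonneg)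
  then have "v ((x - of_rat q) + (of_rat q - of_int (a * c))) < 1" using q by (intro v_add_less)
  then show ?thesis by (intro exI[of _ "a * c"]) simp
qed

section \<open>Finite-dimensional subspaces\<close>

text \<open>The list is a generating list and may be redundant; the recursion supports induction on
  one generator at a time.\<close>

fun Qp_span :: "'a list \<Rightarrow> 'a set" where
  "Qp_span [] = {0}"
| "Qp_span (b # bs) = {c * b + w | c w. c \<in> Qp \<and> w \<in> Qp_span bs}"

lemma Qp_span_0 [simp]: "0 \<in> Qp_span bs"
proof (induction bs)
  case (Cons b bs)
  then show ?case by (auto intro!: exI[of _ 0])
qed simp

lemma Qp_span_add: "x \<in> Qp_span bs \<Longrightarrow> y \<in> Qp_span bs \<Longrightarrow> x + y \<in> Qp_span bs"
proof (induction bs arbitrary: x y)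
  case (Cons b bs)
  then obtain c w c' w' where "x = c * b + w" "y = c' * b + w'" "c \<in> Qp" "c' \<in> Qp"
    "w \<in> Qp_span bs" "w' \<in> Qp_span bs" by auto
  moreover from this have "w + w' \<in> Qp_span bs" "c + c' \<in> Qp" using Cons.IH by auto
  ultimately have "x + y = (c + c') * b + (w + w')" "c + c' \<in> Qp" "w + w' \<in> Qp_span bs"
    by (simp_all add: algebra_simps)
  then show ?case by auto
qed simp

lemma Qp_span_scale: "a \<in> Qp \<Longrightarrow> x \<in> Qp_span bs \<Longrightarrow> a * x \<in> Qp_span bs"
proof (induction bs arbitrary: x)
  case (Cons b bs)
  then obtain c w where "x = c * b + w" "c \<in> Qp" "w \<in> Qp_span bs" by auto
  moreover from this have "a * w \<in> Qp_span bs" "a * c \<in> Qp" using Cons by auto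
  ultimately have "a * x = (a * c) * b + a * w" "a * c \<in> Qp" "a * w \<in> Qp_span bs"
    by (simp_all add: distrib_left mult.assoc)
  then show ?case by auto
qed simp

lemma Qp_span_diff: "x \<in> Qp_span bs \<Longrightarrow> y \<in> Qp_span bs \<Longrightarrow> x - y \<in> Qp_span bs"
  using Qp_span_add[of x bs "-1 * y"] Qp_span_scale[of "-1" y bs] by (simp add: Qp_minus)

lemma Qp_span_append: "Qp_span (bs @ cs) = {x + y | x y. x \<in> Qp_span bs \<and> y \<in> Qp_span cs}"
proof (induction bs)
  case (Cons b bs)
  show ?case
  proof (intro equalityI subsetI)
    fix z assume "z \<in> Qp_span ((b # bs) @ cs)"
    then obtain c x y where "z = c * b + (x + y)" "c \<in> Qp" "x \<in> Qp_span bs" "y \<in> Qp_span cs"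
      using Cons by auto
    then have "z = (c * b + x) + y" "c * b + x \<in> Qp_span (b # bs)" "y \<in> Qp_span cs" by auto
    then show "z \<in> {x + y | x y. x \<in> Qp_span (b # bs) \<and> y \<in> Qp_span cs}" by blast
  next
    fix z assume "z \<in> {x + y | x y. x \<in> Qp_span (b # bs) \<and> y \<in> Qp_span cs}"
    then obtain c x y where "z = (c * b + x) + y" "c \<in> Qp" "x \<in> Qp_span bs" "y \<in> Qp_span cs" by auto
    then have "z = c * b + (x + y)" "c \<in> Qp" "x + y \<in> Qp_span (bs @ cs)" using Cons by auto
    then show "z \<in> Qp_span ((b # bs) @ cs)" by auto
  qed
qed simp

lemma Qp_span_times: "Qp_span (map (\<lambda>b. b * y) bs) = {x * y | x. x \<in> Qp_span bs}"
proof (induction bs)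
  case (Cons b bs)
  show ?case
  proof (intro equalityI subsetI)
    fix z assume "z \<in> Qp_span (map (\<lambda>b. b * y) (b # bs))"
    then obtain c w where cw: "z = c * (b * y) + w * y" "c \<in> Qp" "w \<in> Qp_span bs" using Cons by auto
    then have "z = (c * b + w) * y" by (simp add: algebra_simps)
    then show "z \<in> {x * y | x. x \<in> Qp_span (b # bs)}" using cw by auto
  next
    fix z assume "z \<in> {x * y | x. x \<in> Qp_span (b # bs)}"
    then obtain c w where cw: "z = (c * b + w) * y" "c \<in> Qp" "w \<in> Qp_span bs" by auto
    then have "z = c * (b * y) + w * y" by (simp add: algebra_simps)
    moreover have "w * y \<in> Qp_span (map (\<lambda>b. b * y) bs)" using cw Cons by auto
    ultimately show "z \<in> Qp_span (map (\<lambda>b. b * y) (b # bs))" using cw(2) by auto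
  qed
qed simp

text \<open>The constant is the distance from \<^term>\<open>b\<close> to the subspace, which is closed.\<close>
lemma dist_to_complete_span:
  assumes "v_complete (Qp_span bs)" "b \<notin> Qp_span bs"
  obtains d where "d > 0" "\<And>c w. c \<in> Qp \<Longrightarrow> w \<in> Qp_span bs \<Longrightarrow> d * v c \<le> v (c * b + w)"
proof -
  have "\<exists>d>0. \<forall>w\<in>Qp_span bs. d \<le> v (b - w)"
  proof (rule ccontr)
    assume "\<not> ?thesis"
    then have "\<forall>n. \<exists>w\<in>Qp_span bs. v (b - w) < inverse (real (Suc n))"
      by (metis inverse_positive_iff_positive not_less of_nat_0_less_iff zero_less_Suc)
    then obtain W where W: "\<And>n. W n \<in> Qp_span bs" "\<And>n. v (b - W n) < inverse (real (Suc n))" by metis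
    have "conv_to v W b"
      by (rule conv_to_bound[OF LIMSEQ_inverse_real_of_nat])
        (use W in \<open>auto simp: v_diff_commute[of _ b] intro: less_imp_le\<close>)
    then show False using v_completeD[OF assms(1)] W assms(2) by blast
  qed
  then obtain d where d: "d > 0" "\<And>w. w \<in> Qp_span bs \<Longrightarrow> d \<le> v (b - w)" by blast
  show thesis
  proof (rule that[OF d(1)])
    fix c w assume c: "c \<in> Qp" and w: "w \<in> Qp_span bs"
    show "d * v c \<le> v (c * b + w)"
    proof (cases "c = 0")
      case False
      have "(- inverse c) * w \<in> Qp_span bs" using c w by (intro Qp_span_scale) auto
      then have "d \<le> v (b + inverse c * w)" using d(2) by fastforce
      moreover have "v (c * b + w) = v c * v (b + inverse c * w)"
        using False by (simp add: distrib_left flip: v_mult mult.assoc)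
      ultimately show ?thesis by (simp add: mult.commute[of d] mult_left_mono)
    qed simp
  qed
qed

lemma Qp_span_redundant: "b \<in> Qp_span bs \<Longrightarrow> Qp_span (b # bs) = Qp_span bs"
proof (intro equalityI subsetI)
  fix x assume "x \<in> Qp_span bs"
  then have "x = 0 * b + x" "(0::'a) \<in> Qp" "x \<in> Qp_span bs" by auto
  then show "x \<in> Qp_span (b # bs)" unfolding Qp_span.simps by blast
qed (auto intro: Qp_span_add Qp_span_scale)

text \<open>A generator outside the span of the others has positive distance from it, as that span
  is complete by induction. This distance controls the coefficient, so coefficients and remainders
  of a Cauchy sequence are Cauchy separately.\<close>

lemma Qp_span_complete: "v_complete (Qp_span bs)"
proof (induction bs)
  case Nil
  then show ?case by (auto simp: v_complete_def conv_to_def)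
next
  case (Cons b bs)
  show ?case
  proof (cases "b \<in> Qp_span bs")
    case True
    then show ?thesis using Cons Qp_span_redundant by simp
  next
    case False
    then obtain d where d: "d > 0" "\<And>c w. c \<in> Qp \<Longrightarrow> w \<in> Qp_span bs \<Longrightarrow> d * v c \<le> v (c * b + w)"
      using dist_to_complete_span Cons by blast
    show ?thesis unfolding v_complete_def
    proof (intro allI impI, elim conjE)
      fix X assume X: "\<forall>n. X n \<in> Qp_span (b # bs)" and cau: "cauchy_v v X"
      from X have "\<forall>n. \<exists>c w. X n = c * b + w \<and> c \<in> Qp \<and> w \<in> Qp_span bs" by auto
      then obtain C W where CW: "\<And>n. X n = C n * b + W n" "\<And>n. C n \<in> Qp" "\<And>n. W n \<in> Qp_span bs" by metis
      have Cd: "d * v (C m - C n) \<le> v (X m - X n)" for m n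
      proof -
        have "X m - X n = (C m - C n) * b + (W m - W n)" by (simp add: CW algebra_simps)
        moreover have "C m - C n \<in> Qp" "W m - W n \<in> Qp_span bs" using CW Qp_span_diff by auto
        ultimately show ?thesis using d(2) by metis
      qed
      have "cauchy_v v C" unfolding cauchy_v_def
      proof (intro allI impI)
        fix e :: real assume "e > 0"
        then have "d * e > 0" using d by simp
        then obtain N where "\<forall>m\<ge>N. \<forall>n\<ge>N. v (X m - X n) < d * e" using cau unfolding cauchy_v_def by blast
        then have "\<forall>m\<ge>N. \<forall>n\<ge>N. d * v (C m - C n) < d * e" using Cd le_less_trans by blast
        then show "\<exists>N. \<forall>m\<ge>N. \<forall>n\<ge>N. v (C m - C n) < e" using d by auto
      qed
      then obtain c where c: "c \<in> Qp" "conv_to v C c" using Qp_complete CW unfolding v_complete_def by blast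
      have cb: "conv_to v (\<lambda>n. b * C n) (b * c)" using c by (intro conv_to_cmult)
      have "cauchy_v v W" unfolding cauchy_v_def
      proof (intro allI impI)
        fix e :: real assume e: "e > 0"
        obtain N where N: "\<forall>m\<ge>N. \<forall>n\<ge>N. v (X m - X n) < e" using cau e unfolding cauchy_v_def by blast
        obtain M where M: "\<forall>m\<ge>M. \<forall>n\<ge>M. v (b * C m - b * C n) < e"
          using conv_to_imp_cauchy[OF cb] e unfolding cauchy_v_def by blast
        have "v ((X m - X n) - (b * C m - b * C n)) < e" if "m \<ge> max M N" "n \<ge> max M N" for m n
          using M N that by (intro v_diff_less[of "X m - X n"]) auto
        then show "\<exists>N. \<forall>m\<ge>N. \<forall>n\<ge>N. v (W m - W n) < e"
          by (intro exI[of _ "max M N"]) (auto simp: CW algebra_simps)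
      qed
      then obtain w where w: "w \<in> Qp_span bs" "conv_to v W w" using Cons CW unfolding v_complete_def by blast
      have "conv_to v (\<lambda>n. X n) (b * c + w)"
        using conv_to_add[OF cb w(2)] by (simp add: CW mult.commute)
      then show "\<exists>l\<in>Qp_span (b # bs). conv_to v X l"
        using c w by (intro bexI[of _ "b * c + w"]) (auto simp: mult.commute[of b])
    qed
  qed
qed

text \<open>The distance estimate for a new generator bounds its coefficient, and hence the
  remainder, by a multiple of \<open>v x\<close>. This is the source of the continuity of field
  embeddings.\<close>

lemma Qp_linear_bounded:
  assumes lin: "\<And>x y. x \<in> Qp_span bs \<Longrightarrow> y \<in> Qp_span bs \<Longrightarrow> f (x + y) = f x + f y"
    "\<And>c x. c \<in> Qp \<Longrightarrow> x \<in> Qp_span bs \<Longrightarrow> f (c * x) = c * f x"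
  shows "\<exists>C. \<forall>x\<in>Qp_span bs. v (f x) \<le> C * v x"
  using assms
proof (induction bs)
  case Nil
  then have "f 0 = 0" using Nil(2)[of 0 0] by simp
  then show ?case by auto
next
  case (Cons b bs)
  show ?case
  proof (cases "b \<in> Qp_span bs")
    case True
    then show ?thesis using Cons.IH Cons.prems unfolding Qp_span_redundant[OF True] by blast
  next
    case False
    then obtain d where d: "d > 0" "\<And>c w. c \<in> Qp \<Longrightarrow> w \<in> Qp_span bs \<Longrightarrow> d * v c \<le> v (c * b + w)"
      using dist_to_complete_span Qp_span_complete by blast
    have sub: "Qp_span bs \<subseteq> Qp_span (b # bs)" by (force intro: exI[of _ 0])
    have b: "b \<in> Qp_span (b # bs)" by (force intro: exI[of _ 1])
    obtain C0 where C0: "\<forall>x\<in>Qp_span bs. v (f x) \<le> C0 * v x" using Cons sub by blast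
    define C where "C = max C0 0"
    have C: "v (f x) \<le> C * v x" if "x \<in> Qp_span bs" for x
    proof -
      have "C0 * v x \<le> C * v x" by (intro mult_right_mono) (auto simp: C_def)
      then show ?thesis using C0 that by fastforce
    qed
    have Cpos: "C \<ge> 0" by (simp add: C_def)
    \<comment> \<open>The first entry covers \<open>c * f b\<close>, the second \<open>f w\<close>,
      where \<open>v w\<close> is at most \<open>max 1 (v b / d) * v x\<close>.\<close>
    define D where "D = max (v (f b) / d) (C * max 1 (v b / d))"
    have "v (f x) \<le> D * v x" if "x \<in> Qp_span (b # bs)" for x
    proof -
      from that obtain c w where cw: "x = c * b + w" "c \<in> Qp" "w \<in> Qp_span bs" by auto
      have vc: "v c \<le> v x / d" using d(1) d(2)[OF cw(2,3)] cw(1) by (simp add: pos_le_divide_eq mult.commute[of d])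
      have vcb: "v (c * b) \<le> v b / d * v x" using mult_right_mono[OF vc, of "v b"] by (simp add: v_mult mult.commute)
      have le: "v x \<le> max 1 (v b / d) * v x" "v b / d * v x \<le> max 1 (v b / d) * v x"
        using mult_right_mono[of 1 "max 1 (v b / d)" "v x"] mult_right_mono[of "v b / d" "max 1 (v b / d)" "v x"] by auto
      have "v (x - c * b) \<le> max 1 (v b / d) * v x" using vcb le by (intro v_diff_le) linarith+
      then have vw: "v w \<le> max 1 (v b / d) * v x" by (simp add: cw)
      have "f x = c * f b + f w"
      proof -
        have "c * b \<in> Qp_span (b # bs)" using b cw Qp_span_scale by blast
        then show ?thesis using Cons.prems(1)[of "c * b" w] Cons.prems(2)[of c b] b sub cw by auto
      qed
      moreover have "v (c * f b) \<le> v (f b) / d * v x"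
        using mult_right_mono[OF vc, of "v (f b)"] by (simp add: v_mult mult.commute)
      moreover have "v (f b) / d * v x \<le> D * v x" by (intro mult_right_mono) (auto simp: D_def)
      moreover have "v (f w) \<le> C * (max 1 (v b / d) * v x)"
        using C[OF cw(3)] mult_left_mono[OF vw Cpos] by linarith
      moreover have "C * max 1 (v b / d) * v x \<le> D * v x" by (intro mult_right_mono) (auto simp: D_def)
      ultimately show ?thesis by (simp only:) (intro v_add_le; simp add: mult.assoc)
    qed
    then show ?thesis by blast
  qed
qed

text \<open>Plays the part of a finite extension of the p-adic numbers: the finite span gives
  completeness, the ring structure keeps power series arithmetic inside.\<close>

definition fin_alg :: "'a set \<Rightarrow> bool" where
  "fin_alg A \<longleftrightarrow> (\<exists>bs. A = Qp_span bs) \<and> 1 \<in> A \<and> (\<forall>x\<in>A. \<forall>y\<in>A. x * y \<in> A)"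

lemma fin_alg_complete: "fin_alg A \<Longrightarrow> v_complete A"
  using Qp_span_complete by (auto simp: fin_alg_def)

lemma fin_algD:
  assumes "fin_alg A"
  shows "0 \<in> A" "1 \<in> A" "x \<in> A \<Longrightarrow> y \<in> A \<Longrightarrow> x + y \<in> A" "x \<in> A \<Longrightarrow> y \<in> A \<Longrightarrow> x - y \<in> A"
    "x \<in> A \<Longrightarrow> y \<in> A \<Longrightarrow> x * y \<in> A" "c \<in> Qp \<Longrightarrow> c \<in> A"
proof -
  show "c \<in> A" if "c \<in> Qp"
    using assms Qp_span_scale[OF that, of 1] by (auto simp: fin_alg_def)
qed (use assms Qp_span_add Qp_span_diff in \<open>auto simp: fin_alg_def\<close>)

lemma fin_alg_Qp: "fin_alg Qp"
  unfolding fin_alg_def by (auto intro!: exI[of _ "[1]"])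

text \<open>A polynomial of degree \<open>d\<close> for \<open>x\<close> rewrites
  \<open>x ^ d\<close>, so the powers below \<open>d\<close> generate over \<open>A\<close>. The
  last clause keeps the new algebra inside a prescribed field, later the one generated by the
  torsion.\<close>

lemma fin_alg_adjoin:
  assumes A: "fin_alg A" and x: "algebraic_over Qp x"
  obtains A' where "fin_alg A'" "A \<subseteq> A'" "x \<in> A'"
    "\<And>M. is_subfield M \<Longrightarrow> A \<subseteq> M \<Longrightarrow> x \<in> M \<Longrightarrow> A' \<subseteq> M"
proof -
  note AD = fin_algD[OF A]
  obtain P where P: "P \<noteq> 0" "\<And>i. coeff P i \<in> Qp" "poly P x = 0" using x unfolding algebraic_over_def by blast
  define d where "d = degree P"
  have d0: "d > 0"
  proof (rule ccontr)
    assume "\<not> d > 0"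
    then obtain c where "P = [:c:]" using degree_eq_zeroE[of P] by (auto simp: d_def)
    then show False using P by simp
  qed
  define B where "B = (\<lambda>m. {(\<Sum>i<m. a i * x ^ i) | a. \<forall>i. a i \<in> A})"
  define A' where "A' = B d"
  have Bspan: "\<exists>bs. B m = Qp_span bs" for m
  proof (induction m)
    case 0
    have "B 0 = {0}" using AD(1) by (auto simp: B_def intro!: exI[of _ "\<lambda>_. 0"])
    then show ?case by (intro exI[of _ "[]"]) simp
  next
    case (Suc m)
    then obtain bs where bs: "B m = Qp_span bs" by blast
    obtain as where as: "A = Qp_span as" using A fin_alg_def by blast
    have "B (Suc m) = {y + a * x ^ m | y a. y \<in> B m \<and> a \<in> A}"
    proof (intro equalityI subsetI)
      fix z assume "z \<in> {y + a * x ^ m | y a. y \<in> B m \<and> a \<in> A}"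
      then obtain a f where z: "z = (\<Sum>i<m. f i * x ^ i) + a * x ^ m" "\<forall>i. f i \<in> A" "a \<in> A" by (auto simp: B_def)
      then have "z = (\<Sum>i<Suc m. (f(m := a)) i * x ^ i)" by simp
      moreover have "\<forall>i. (f(m := a)) i \<in> A" using z by simp
      ultimately show "z \<in> B (Suc m)" unfolding B_def by blast
    qed (auto simp: B_def)
    also have "\<dots> = Qp_span (bs @ map (\<lambda>b. b * x ^ m) as)"
      unfolding Qp_span_append Qp_span_times bs as by blast
    finally show ?case by blast
  qed
  then obtain bs where bs: "A' = Qp_span bs" unfolding A'_def by blast
  have A'_add: "y + z \<in> A'" if "y \<in> A'" "z \<in> A'" for y z using that bs Qp_span_add by simp
  have A'_scale: "a * z \<in> A'" if "a \<in> A" "z \<in> A'" for a z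
  proof -
    from that obtain f where f: "z = (\<Sum>i<d. f i * x ^ i)" "\<forall>i. f i \<in> A" by (auto simp: A'_def B_def)
    then have "a * z = (\<Sum>i<d. (a * f i) * x ^ i)" by (simp add: sum_distrib_left mult.assoc)
    moreover have "\<forall>i. a * f i \<in> A" using f that AD by blast
    ultimately show ?thesis unfolding A'_def B_def by (intro CollectI exI[of _ "\<lambda>i. a * f i"]) auto
  qed
  have A'_sum: "(\<Sum>i\<in>I. f i) \<in> A'" if "\<And>i. i \<in> I \<Longrightarrow> f i \<in> A'" for I and f :: "nat \<Rightarrow> 'a"
    using that by (induction I rule: infinite_finite_induct) (auto simp: bs intro: Qp_span_add)
  have mono: "x ^ i \<in> A'" if "i < d" for i
  proof -
    have "x ^ i = (\<Sum>j<d. (if j = i then 1 else 0) * x ^ j)" using that by (simp add: if_distrib[of "\<lambda>c. c * _"] cong: if_cong)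
    then show ?thesis unfolding A'_def B_def
      using AD by (intro CollectI exI[of _ "\<lambda>j. if j = i then 1 else 0"]) auto
  qed
  have xd: "x ^ d \<in> A'"
  proof -
    have lc: "coeff P d \<noteq> 0" using P by (simp add: d_def)
    have "0 = (\<Sum>i<d. coeff P i * x ^ i) + coeff P d * x ^ d"
      using P(3) by (simp add: poly_altdef d_def flip: lessThan_Suc_atMost)
    then have "coeff P d * x ^ d = - (\<Sum>i<d. coeff P i * x ^ i)"
      by (simp add: eq_neg_iff_add_eq_0 add.commute)
    then have "x ^ d = (- inverse (coeff P d)) * (\<Sum>i<d. coeff P i * x ^ i)"
      using lc by (simp add: field_simps)
    then have "x ^ d = (\<Sum>i<d. (- inverse (coeff P d) * coeff P i) * x ^ i)"
      by (simp only: sum_distrib_left mult.assoc)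
    moreover have "(- inverse (coeff P d) * coeff P i) * x ^ i \<in> A'" if "i < d" for i
      using mono that P by (intro A'_scale AD(6) Qp_mult Qp_minus Qp_inverse) auto
    ultimately show ?thesis using A'_sum[of "{..<d}"] by simp
  qed
  have xA': "x * z \<in> A'" if "z \<in> A'" for z
  proof -
    from that obtain f where f: "z = (\<Sum>i<d. f i * x ^ i)" "\<forall>i. f i \<in> A" by (auto simp: A'_def B_def)
    have "x * z = (\<Sum>i<d. f i * x ^ Suc i)" by (simp add: f sum_distrib_left algebra_simps)
    moreover have "f i * x ^ Suc i \<in> A'" if "i < d" for i
    proof (cases "Suc i < d")
      case True
      then show ?thesis using f mono A'_scale by blast
    next
      case False
      then have "Suc i = d" using that by simp
      then show ?thesis using f xd A'_scale by metis
    qed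
    ultimately show ?thesis using A'_sum[of "{..<d}"] by simp
  qed
  have xnA': "x ^ n * z \<in> A'" if "z \<in> A'" for n z
    using that by (induction n) (auto simp: mult.assoc intro: xA')
  have one: "1 \<in> A'" using mono[of 0] d0 by simp
  have "y * z \<in> A'" if "y \<in> A'" "z \<in> A'" for y z
  proof -
    from that obtain f where f: "y = (\<Sum>i<d. f i * x ^ i)" "\<forall>i. f i \<in> A" by (auto simp: A'_def B_def)
    have "y * z = (\<Sum>i<d. f i * (x ^ i * z))" by (simp add: f sum_distrib_right mult.assoc)
    then show ?thesis using A'_sum[of "{..<d}"] xnA' A'_scale f that by simp
  qed
  then have "fin_alg A'" using bs one by (auto simp: fin_alg_def)
  moreover have "A \<subseteq> A'" using A'_scale[OF _ one] by auto
  moreover have "x \<in> A'" using xA'[OF one] by simp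
  moreover have "A' \<subseteq> M" if M: "is_subfield M" "A \<subseteq> M" "x \<in> M" for M
  proof -
    have pw: "x ^ i \<in> M" for i using M by (induction i) (auto simp: is_subfield_def)
    have "(\<Sum>i<m. f i * x ^ i) \<in> M" if "\<forall>i. f i \<in> A" for f m
      using that M pw by (induction m) (auto simp: is_subfield_def subset_iff)
    then show ?thesis by (auto simp: A'_def B_def)
  qed
  ultimately show thesis by (rule that)
qed

end

section \<open>Order of vanishing of formal power series\<close>

text \<open>A lower bound instead of an order function, so that the zero series needs no separate
  treatment.\<close>

definition ordge :: "nat \<Rightarrow> 'a::comm_ring_1 fps \<Rightarrow> bool" where
  "ordge n P \<longleftrightarrow> (\<forall>i<n. P $ i = 0)"

lemma ordge_0 [simp]: "ordge n 0" and ordge_zero [simp]: "ordge 0 P"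
  by (auto simp: ordge_def)

lemma ordge_1_iff: "ordge (Suc 0) P \<longleftrightarrow> P $ 0 = 0"
  by (auto simp: ordge_def)

lemma ordge_nthD: "ordge n P \<Longrightarrow> i < n \<Longrightarrow> P $ i = 0"
  by (auto simp: ordge_def)

lemma ordge_mono: "ordge n P \<Longrightarrow> m \<le> n \<Longrightarrow> ordge m P"
  by (auto simp: ordge_def)

lemma ordge_add: "ordge n P \<Longrightarrow> ordge n Q \<Longrightarrow> ordge n (P + Q)"
  and ordge_diff: "ordge n P \<Longrightarrow> ordge n Q \<Longrightarrow> ordge n (P - Q)"
  and ordge_minus: "ordge n P \<Longrightarrow> ordge n (- P)"
  by (auto simp: ordge_def)

lemma ordge_sum: "(\<And>i. i \<in> A \<Longrightarrow> ordge n (f i)) \<Longrightarrow> ordge n (sum f A)"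
  by (induction A rule: infinite_finite_induct) (auto intro: ordge_add)

lemma ordge_mult: "ordge m P \<Longrightarrow> ordge n Q \<Longrightarrow> ordge (m + n) (P * Q)"
  unfolding ordge_def fps_mult_nth
proof (intro allI impI sum.neutral ballI)
  fix i j assume *: "\<forall>i<m. P $ i = 0" "\<forall>i<n. Q $ i = 0" "i < m + n" "j \<in> {0..i}"
  then have "j < m \<or> i - j < n" by auto
  then show "P $ j * Q $ (i - j) = 0" using * by auto
qed

lemma ordge_mult2: "ordge m P \<Longrightarrow> ordge m (Q * P)"
  using ordge_mult[of 0 Q m P] by auto

lemma ordge_power: "ordge m P \<Longrightarrow> ordge (m * n) (P ^ n)"
  by (induction n) (use ordge_mult in auto)

lemma ordge_power': "ordge m P \<Longrightarrow> k \<le> m * n \<Longrightarrow> ordge k (P ^ n)"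
  using ordge_power ordge_mono by blast

lemma ordge_compose: "ordge n P \<Longrightarrow> b $ 0 = 0 \<Longrightarrow> ordge n (b oo P)"
  unfolding ordge_def fps_compose_nth
proof (intro allI impI sum.neutral ballI)
  fix i j assume *: "\<forall>i<n. P $ i = 0" "b $ 0 = 0" "i < n" "j \<in> {0..i}"
  show "b $ j * P ^ j $ i = 0"
  proof (cases "j = 0")
    case False
    have "ordge (n * j) (P ^ j)" using * by (intro ordge_power) (simp add: ordge_def)
    moreover have "i < n * j" using False *(3) by (metis less_le_trans mult.right_neutral mult_le_mono2 One_nat_def Suc_leI neq0_conv)
    ultimately show ?thesis by (simp add: ordge_nthD)
  qed (use * in auto)
qed

text \<open>In the factorisation of \<open>P ^ s - Q ^ s\<close> the cofactor of
  \<open>P - Q\<close> is a sum of products of \<open>s - 1\<close> factors of order at least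
  \<open>m\<close>. This gain drives the inductions on precision below.\<close>

lemma ordge_power_diff:
  assumes "ordge N (P - Q)" "ordge m P" "ordge m Q" "s > 0"
  shows "ordge (N + m * (s - 1)) (P ^ s - Q ^ s)"
proof -
  obtain n where n: "s = Suc n" using assms(4) by (cases s) auto
  have "P ^ s - Q ^ s = (P - Q) * (\<Sum>i<s. P ^ i * Q ^ (n - i))"
    unfolding n by (rule diff_power_eq_sum)
  moreover have "ordge (m * n) (P ^ i * Q ^ (n - i))" if "i < s" for i
  proof -
    have "m * i + m * (n - i) = m * n" using that n by (simp flip: distrib_left)
    then show ?thesis using ordge_mult[OF ordge_power[OF assms(2)] ordge_power[OF assms(3)], of i "n - i"] by simp
  qed
  then have "ordge (m * n) (\<Sum>i<s. P ^ i * Q ^ (n - i))" by (intro ordge_sum) auto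
  ultimately show ?thesis using ordge_mult[OF assms(1)] n by simp
qed

lemma ordge_power_diff': "ordge N (P - Q) \<Longrightarrow> ordge N (P ^ s - Q ^ s)"
  using ordge_power_diff[of N P Q 0 s] by (cases "s = 0") auto

lemma ordge_compose_diff: "ordge N (P - Q) \<Longrightarrow> ordge N ((b oo P) - (b oo Q))"
  using ordge_power_diff'[of N P Q] by (auto simp: ordge_def fps_compose_nth)

lemma ordge_all_imp_0: "(\<And>n. ordge n P) \<Longrightarrow> P = 0"
  by (auto simp: ordge_def fps_eq_iff)

section \<open>Evaluation of two-variable series at formal power series\<close>

text \<open>Truncation of the double sum at \<open>n\<close> is exact when \<open>P\<close> and
  \<open>Q\<close> have no constant term, because \<open>P ^ a * Q ^ b\<close> then has order at
  least \<open>a + b\<close>.\<close>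

definition ser_ev :: "ser2 \<Rightarrow> 'a::field_char_0 fps \<Rightarrow> 'a fps \<Rightarrow> 'a fps" where
  "ser_ev f P Q = Abs_fps (\<lambda>n. \<Sum>a\<le>n. \<Sum>b\<le>n. of_rat (f (a,b)) * (P ^ a * Q ^ b) $ n)"

definition ser_ord :: "nat \<Rightarrow> ser2 \<Rightarrow> bool" where
  "ser_ord n f \<longleftrightarrow> (\<forall>i j. i + j < n \<longrightarrow> f (i,j) = 0)"

definition ser_agree :: "nat \<Rightarrow> ser2 \<Rightarrow> ser2 \<Rightarrow> bool" where
  "ser_agree n f g \<longleftrightarrow> (\<forall>i j. i + j < n \<longrightarrow> f (i,j) = g (i,j))"

lemma ser_agree_refl [simp]: "ser_agree n f f"
  by (simp add: ser_agree_def)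

lemma ser_agree_sym: "ser_agree n f g \<Longrightarrow> ser_agree n g f"
  by (simp add: ser_agree_def)

lemma ser_agree_trans: "ser_agree n f g \<Longrightarrow> ser_agree n g h \<Longrightarrow> ser_agree n f h"
  by (simp add: ser_agree_def)

lemma ser_agree_mono: "ser_agree n f g \<Longrightarrow> m \<le> n \<Longrightarrow> ser_agree m f g"
  by (auto simp: ser_agree_def)

lemma ser_ord_mult: "ser_ord m f \<Longrightarrow> ser_ord n g \<Longrightarrow> ser_ord (m + n) (ser_mult f g)"
  unfolding ser_ord_def ser_mult_def
proof (clarsimp, intro sum.neutral ballI)
  fix i j a b assume *: "\<forall>i j. i + j < m \<longrightarrow> f (i,j) = 0" "\<forall>i j. i + j < n \<longrightarrow> g (i,j) = 0"
    "i + j < m + n" "a \<in> {..i}" "b \<in> {..j}"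
  then have "a + b < m \<or> (i - a) + (j - b) < n" by auto
  then show "f (a,b) * g (i - a, j - b) = 0" using * by auto
qed

lemma ser_ord_pow: "ser_ord 1 f \<Longrightarrow> ser_ord n (ser_pow f n)"
proof (induction n)
  case (Suc n)
  then show ?case using ser_ord_mult[of 1 f n] by simp
qed (simp add: ser_ord_def)

lemma ser_agree_mult:
  assumes "ser_agree M f f'" "ser_ord s f" "ser_ord s f'" "ser_agree N g g'" "ser_ord r g" "ser_ord r g'"
  shows "ser_agree (min (M + r) (N + s)) (ser_mult f g) (ser_mult f' g')"
  unfolding ser_agree_def ser_mult_def
proof (clarsimp, intro sum.cong refl)
  fix i j a b assume *: "i + j < M + r" "i + j < N + s" "a \<in> {..i}" "b \<in> {..j}"
  consider "a + b < s" | "(i - a) + (j - b) < r" | "a + b < M" "(i - a) + (j - b) < N"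
    using * by fastforce
  then show "f (a,b) * g (i - a, j - b) = f' (a,b) * g' (i - a, j - b)"
    by cases (use assms in \<open>auto simp: ser_agree_def ser_ord_def\<close>)
qed

text \<open>Exchanging one factor costs an error of degree at least \<open>n\<close>, and each of
  the other \<open>a - 1\<close> factors raises that degree by one.\<close>

lemma ser_agree_pow:
  assumes "ser_agree n f f'" "ser_ord 1 f" "ser_ord 1 f'"
  shows "ser_agree (n + a - 1) (ser_pow f a) (ser_pow f' a)"
proof (induction a)
  case (Suc a)
  show ?case
  proof (cases "a = 0")
    case True
    have "ser_agree (min (n + 0) (n + 1)) (ser_mult f ser_one) (ser_mult f' ser_one)"
      by (rule ser_agree_mult) (use assms in \<open>auto simp: ser_ord_def\<close>)
    then show ?thesis using True by simp
  next
    case False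
    have "ser_agree (min (n + a) (n + a - 1 + 1)) (ser_mult f (ser_pow f a)) (ser_mult f' (ser_pow f' a))"
      by (rule ser_agree_mult) (use assms Suc ser_ord_pow in auto)
    then show ?thesis using False by simp
  qed
qed simp

lemma ser_agree_monomial:
  assumes "ser_agree n f f'" "ser_ord 1 f" "ser_ord 1 f'" "ser_agree n g g'" "ser_ord 1 g" "ser_ord 1 g'"
    "a + b > 0"
  shows "ser_agree (n + a + b - 1) (ser_mult (ser_pow f a) (ser_pow g b)) (ser_mult (ser_pow f' a) (ser_pow g' b))"
proof -
  have A: "ser_agree (if a = 0 then n + a + b else n + a - 1) (ser_pow f a) (ser_pow f' a)"
    using ser_agree_pow[OF assms(1-3), of a] by auto
  have B: "ser_agree (if b = 0 then n + a + b else n + b - 1) (ser_pow g b) (ser_pow g' b)"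
    using ser_agree_pow[OF assms(4-6), of b] by auto
  show ?thesis
    by (rule ser_agree_mono[OF ser_agree_mult[OF A _ _ B, of a b]])
      (use assms ser_ord_pow in auto)
qed

lemma sum_atMost_rev: "(\<Sum>a\<le>i. g a) = (\<Sum>a\<le>(i::nat). g (i - a))"
  by (rule sum.reindex_bij_witness[of _ "\<lambda>a. i - a" "\<lambda>a. i - a"]) auto

lemma ser_mult_commute: "ser_mult f g = ser_mult g f"
proof (rule ext, clarify)
  fix i j
  have "ser_mult f g (i,j) = (\<Sum>a\<le>i. \<Sum>b\<le>j. f (i - a, j - b) * g (a, b))"
  proof -
    have "ser_mult f g (i,j) = (\<Sum>a\<le>i. \<Sum>b\<le>j. f (i - a, b) * g (i - (i - a), j - b))"
      unfolding ser_mult_def prod.case by (rule sum_atMost_rev)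
    also have "\<dots> = (\<Sum>a\<le>i. \<Sum>b\<le>j. f (i - a, j - b) * g (i - (i - a), j - (j - b)))"
      by (rule sum.cong[OF refl], rule sum_atMost_rev)
    also have "\<dots> = (\<Sum>a\<le>i. \<Sum>b\<le>j. f (i - a, j - b) * g (a, b))" by (intro sum.cong refl) auto
    finally show ?thesis .
  qed
  then show "ser_mult f g (i,j) = ser_mult g f (i,j)" by (simp add: ser_mult_def mult.commute)
qed

lemma ser_mult_one: "ser_mult f ser_one = f" "ser_mult ser_one f = f"
proof -
  show *: "ser_mult f ser_one = f"
  proof (rule ext, clarify)
    fix i j
    have "ser_mult f ser_one (i,j) = (\<Sum>a\<le>i. \<Sum>b\<le>j. if b = j then (if a = i then f (i,j) else 0) else 0)"
      unfolding ser_mult_def ser_one_def prod.case by (intro sum.cong refl) auto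
    then show "ser_mult f ser_one (i,j) = f (i,j)" by simp
  qed
  then show "ser_mult ser_one f = f" by (simp add: ser_mult_commute)
qed

lemma ser_comp_single:
  "ser_comp (\<lambda>(a,b). if a = m \<and> b = n then 1 else 0) G (i,j)
     = (if m + n \<le> i + j then ser_mult (ser_pow (fst G) m) (ser_pow (snd G) n) (i,j) else 0)"
proof -
  let ?c = "ser_mult (ser_pow (fst G) m) (ser_pow (snd G) n) (i,j)"
  have "ser_comp (\<lambda>(a,b). if a = m \<and> b = n then 1 else 0) G (i,j)
    = (\<Sum>a\<le>i+j. \<Sum>b\<le>i+j-a. if b = n then (if a = m then ?c else 0) else 0)"
    unfolding ser_comp_def prod.case by (intro sum.cong refl) auto
  also have "\<dots> = (\<Sum>a\<le>i+j. if a = m then (if n \<le> i + j - m then ?c else 0) else 0)"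
    by (intro sum.cong refl) auto
  also have "\<dots> = (if m + n \<le> i + j then ?c else 0)" by auto
  finally show ?thesis .
qed

lemma ser_comp_X1: assumes "no_const G" shows "ser_comp ser_X1 G = fst G"
proof (rule ext, clarify)
  fix i j
  show "ser_comp ser_X1 G (i,j) = fst G (i,j)"
    using ser_comp_single[of 1 0 G i j] assms
    by (auto simp: ser_X1_def ser_mult_one no_const_def not_less_eq_eq)
qed

lemma ser_comp_X2: assumes "no_const G" shows "ser_comp ser_X2 G = snd G"
proof (rule ext, clarify)
  fix i j
  show "ser_comp ser_X2 G (i,j) = snd G (i,j)"
    using ser_comp_single[of 0 1 G i j] assms
    by (auto simp: ser_X2_def ser_mult_one no_const_def not_less_eq_eq)
qed

definition ser_diff :: "ser2 \<Rightarrow> ser2 \<Rightarrow> ser2" where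
  "ser_diff f g = (\<lambda>ij. f ij - g ij)"

lemma ser_comp_diff: "ser_comp (ser_diff f g) G (i,j) = ser_comp f G (i,j) - ser_comp g G (i,j)"
  by (simp add: ser_comp_def ser_diff_def left_diff_distrib sum_subtractf)

lemma ser_agree_comp:
  assumes f: "ser_ord 2 f" and G: "no_const G" "no_const G'"
    and agree: "ser_agree n (fst G) (fst G')" "ser_agree n (snd G) (snd G')"
  shows "ser_agree (Suc n) (ser_comp f G) (ser_comp f G')"
  unfolding ser_agree_def
proof (intro allI impI)
  fix i j assume ij: "i + j < Suc n"
  show "ser_comp f G (i, j) = ser_comp f G' (i, j)"
    unfolding ser_comp_def prod.case
  proof (intro sum.cong refl)
    fix a b
    have ord: "ser_ord 1 (fst G)" "ser_ord 1 (fst G')" "ser_ord 1 (snd G)" "ser_ord 1 (snd G')"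
      using G by (auto simp: no_const_def ser_ord_def)
    show "f (a, b) * ser_mult (ser_pow (fst G) a) (ser_pow (snd G) b) (i, j)
      = f (a, b) * ser_mult (ser_pow (fst G') a) (ser_pow (snd G') b) (i, j)"
    proof (cases "a + b < 2")
      case True
      then show ?thesis using f by (simp add: ser_ord_def)
    next
      case False
      then have "ser_agree (n + a + b - 1) (ser_mult (ser_pow (fst G) a) (ser_pow (snd G) b))
         (ser_mult (ser_pow (fst G') a) (ser_pow (snd G') b))"
        using agree ord by (intro ser_agree_monomial) auto
      moreover have "i + j < n + a + b - 1" using ij False by auto
      ultimately show ?thesis by (simp add: ser_agree_def)
    qed
  qed
qed

lemma ser_comp_00: "ser_comp f G (0,0) = f (0,0)"
  by (simp add: ser_comp_def ser_mult_def ser_one_def)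

text \<open>The inverse is the fixed point of a map that gains one degree of precision at each step.\<close>
lemma ser2_inverse_exists_unique:
  assumes L: "ser_ord 2 (ser_diff (fst L) ser_X1)" "ser_ord 2 (ser_diff (snd L) ser_X2)"
  shows "\<exists>!M. no_const M \<and> ser2_comp L M = (ser_X1, ser_X2)"
proof -
  define N1 N2 where "N1 = ser_diff (fst L) ser_X1" and "N2 = ser_diff (snd L) ser_X2"
  \<comment> \<open>With \<open>L = X + N\<close> and \<open>N\<close> of order two, the equation
    \<open>L(M) = X\<close> reads \<open>M = X - N(M)\<close>.\<close>
  define \<Phi> where "\<Phi> = (\<lambda>M. (ser_diff ser_X1 (ser_comp N1 M), ser_diff ser_X2 (ser_comp N2 M)))"
  have N00: "N1 (0,0) = 0" "N2 (0,0) = 0" using L by (auto simp: N1_def N2_def ser_ord_def)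
  have eqv: "ser2_comp L M = (ser_X1, ser_X2) \<longleftrightarrow> \<Phi> M = M" if M: "no_const M" for M
  proof -
    have "ser_comp N1 M ij = ser_comp (fst L) M ij - fst M ij"
      "ser_comp N2 M ij = ser_comp (snd L) M ij - snd M ij" for ij
      by (cases ij; simp add: N1_def N2_def ser_comp_diff ser_comp_X1[OF M] ser_comp_X2[OF M])+
    then show ?thesis
      by (auto simp: \<Phi>_def ser2_comp_def ser_diff_def prod_eq_iff fun_eq_iff algebra_simps)
  qed
  have \<Phi>_nc: "no_const (\<Phi> M)" for M
    by (simp add: \<Phi>_def no_const_def ser_diff_def ser_comp_00 N00 ser_X1_def ser_X2_def)
  have contr: "ser_agree (Suc n) (fst (\<Phi> G)) (fst (\<Phi> G')) \<and> ser_agree (Suc n) (snd (\<Phi> G)) (snd (\<Phi> G'))"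
    if "no_const G" "no_const G'" "ser_agree n (fst G) (fst G')" "ser_agree n (snd G) (snd G')" for n G G'
    using ser_agree_comp[OF _ that, of N1] ser_agree_comp[OF _ that, of N2] L
    by (simp add: \<Phi>_def N1_def N2_def) (simp add: ser_agree_def ser_diff_def)
  define X where "X = (\<lambda>k. (\<Phi> ^^ k) ((\<lambda>_. 0), (\<lambda>_. 0)))"
  have X_nc: "no_const (X k)" for k
    by (cases k) (auto simp: X_def \<Phi>_nc, simp add: no_const_def)
  have next_agree: "ser_agree (Suc k) (fst (X k)) (fst (X (Suc k))) \<and> ser_agree (Suc k) (snd (X k)) (snd (X (Suc k)))" for k
  proof (induction k)
    case 0
    show ?case using X_nc[of 0] X_nc[of 1] by (auto simp: ser_agree_def no_const_def)
  next
    case (Suc k)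
    then show ?case using contr[OF X_nc X_nc, of "Suc k" k "Suc k"] by (simp add: X_def)
  qed
  have steps: "ser_agree (Suc k) (fst (X k)) (fst (X l)) \<and> ser_agree (Suc k) (snd (X k)) (snd (X l))" if "k \<le> l" for k l
    using that
  proof (induction l rule: dec_induct)
    case (step l)
    have "ser_agree (Suc k) (fst (X l)) (fst (X (Suc l)))" "ser_agree (Suc k) (snd (X l)) (snd (X (Suc l)))"
      using next_agree[of l] step.hyps by (auto intro: ser_agree_mono)
    then show ?case using step.IH ser_agree_trans by blast
  qed simp
  \<comment> \<open>Coefficients of total degree \<open>i + j\<close> no longer change from the
    iterate with index \<open>i + j\<close> on.\<close>
  define M where "M = ((\<lambda>(i,j). fst (X (i + j)) (i,j)), (\<lambda>(i,j). snd (X (i + j)) (i,j)))"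
  have MX: "ser_agree (Suc k) (fst M) (fst (X k)) \<and> ser_agree (Suc k) (snd M) (snd (X k))" for k
  proof -
    have "fst M (i,j) = fst (X k) (i,j) \<and> snd M (i,j) = snd (X k) (i,j)" if "i + j < Suc k" for i j
      using steps[of "i + j" k] that by (simp add: ser_agree_def M_def)
    then show ?thesis by (simp add: ser_agree_def)
  qed
  have M_nc: "no_const M" using X_nc[of 0] by (simp add: M_def no_const_def)
  have \<Phi>M: "\<Phi> M = M"
  proof -
    have agree: "ser_agree (Suc (Suc k)) (fst (\<Phi> M)) (fst M) \<and> ser_agree (Suc (Suc k)) (snd (\<Phi> M)) (snd M)" for k
      using contr[OF M_nc X_nc, of "Suc k" k] MX[of k] MX[of "Suc k"]
      by (auto simp: X_def intro: ser_agree_trans ser_agree_sym)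
    have "fst (\<Phi> M) (i,j) = fst M (i,j)" "snd (\<Phi> M) (i,j) = snd M (i,j)" for i j
      using agree[of "i + j"] by (auto simp: ser_agree_def)
    then show ?thesis by (auto simp: prod_eq_iff fun_eq_iff)
  qed
  show ?thesis
  proof (rule ex1I[of _ M])
    show "no_const M \<and> ser2_comp L M = (ser_X1, ser_X2)" using M_nc \<Phi>M eqv by blast
  next
    fix M' assume M': "no_const M' \<and> ser2_comp L M' = (ser_X1, ser_X2)"
    then have \<Phi>M': "\<Phi> M' = M'" using eqv by blast
    have agree: "ser_agree n (fst M') (fst M) \<and> ser_agree n (snd M') (snd M)" for n
    proof (induction n)
      case (Suc n)
      then show ?case using contr[of M' M n] M' M_nc \<Phi>M \<Phi>M' by simp
    qed (simp add: ser_agree_def)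
    have "fst M' (i,j) = fst M (i,j)" "snd M' (i,j) = snd M (i,j)" for i j
      using agree[of "Suc (i + j)"] by (auto simp: ser_agree_def)
    then show "M' = M" by (auto simp: prod_eq_iff fun_eq_iff)
  qed
qed

lemma monomial_nth_0: "(P :: 'a::comm_ring_1 fps) $ 0 = 0 \<Longrightarrow> Q $ 0 = 0 \<Longrightarrow> n < a + b \<Longrightarrow> (P ^ a * Q ^ b) $ n = 0"
  using ordge_mult[OF ordge_power[of 1 P a] ordge_power[of 1 Q b]]
  by (simp add: ordge_1_iff ordge_nthD)

context
  fixes P Q :: "'a::field_char_0 fps"
  assumes P0: "P $ 0 = 0" and Q0: "Q $ 0 = 0"
begin

lemma ser_ev_nth_box:
  assumes "n \<le> N"
  shows "ser_ev f P Q $ n = (\<Sum>a\<le>N. \<Sum>b\<le>N. of_rat (f (a,b)) * (P ^ a * Q ^ b) $ n)"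
proof -
  have "(\<Sum>a\<le>N. \<Sum>b\<le>N. of_rat (f (a,b)) * (P ^ a * Q ^ b) $ n)
    = (\<Sum>a\<le>N. \<Sum>b\<le>n. of_rat (f (a,b)) * (P ^ a * Q ^ b) $ n)"
    using assms by (intro sum.cong refl sum.mono_neutral_right) (auto simp: monomial_nth_0[OF P0 Q0])
  also have "\<dots> = (\<Sum>a\<le>n. \<Sum>b\<le>n. of_rat (f (a,b)) * (P ^ a * Q ^ b) $ n)"
    using assms by (intro sum.mono_neutral_right) (auto simp: monomial_nth_0[OF P0 Q0])
  finally show ?thesis by (simp add: ser_ev_def)
qed

lemma ser_ev_nth_triangle:
  "ser_ev f P Q $ n = (\<Sum>a\<le>n. \<Sum>b\<le>n - a. of_rat (f (a,b)) * (P ^ a * Q ^ b) $ n)"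
  unfolding ser_ev_def fps_nth_Abs_fps
  by (intro sum.cong refl sum.mono_neutral_right) (auto simp: monomial_nth_0[OF P0 Q0])

lemma ser_ev_smult: "ser_ev (ser_smult c f) P Q = fps_const (of_rat c) * ser_ev f P Q"
  by (simp add: fps_eq_iff ser_ev_def ser_smult_def sum_distrib_left of_rat_mult mult.assoc)

lemma ser_ev_one: "ser_ev ser_one P Q = 1"
proof (rule fps_ext)
  fix n
  have "ser_ev ser_one P Q $ n = (\<Sum>a\<le>n. \<Sum>b\<le>n. if b = 0 then (if a = 0 then 1 $ n else 0) else 0)"
    unfolding ser_ev_def ser_one_def fps_nth_Abs_fps by (intro sum.cong refl) auto
  then show "ser_ev ser_one P Q $ n = 1 $ n" by (simp cong: if_cong)
qed

lemma ser_ev_single: "m + n > 0 \<Longrightarrow> ser_ev (\<lambda>(a,b). if a = m \<and> b = n then 1 else 0) P Q = P ^ m * Q ^ n"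
proof (rule fps_ext)
  fix k
  have "ser_ev (\<lambda>(a,b). if a = m \<and> b = n then 1 else 0) P Q $ k
    = (\<Sum>a\<le>k + m + n. \<Sum>b\<le>k + m + n. if b = n then (if a = m then (P ^ m * Q ^ n) $ k else 0) else 0)"
    unfolding ser_ev_nth_box[of k "k + m + n", OF trans_le_add1[OF le_add1]]
    by (intro sum.cong refl) auto
  then show "ser_ev (\<lambda>(a,b). if a = m \<and> b = n then 1 else 0) P Q $ k = (P ^ m * Q ^ n) $ k"
    by (simp cong: if_cong)
qed

lemma ser_ev_X1: "ser_ev ser_X1 P Q = P" and ser_ev_X2: "ser_ev ser_X2 P Q = Q"
  using ser_ev_single[of 1 0] ser_ev_single[of 0 1] by (simp_all add: ser_X1_def ser_X2_def)

text \<open>The convolution in the series variable merges two monomials into one; then the box sums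
  are regrouped along \<open>a + c = i\<close> and \<open>b + d = j\<close>, the terms beyond the
  triangle vanishing in coefficient \<open>n\<close>.\<close>

lemma ser_ev_mult: "ser_ev (ser_mult f g) P Q = ser_ev f P Q * ser_ev g P Q"
proof (rule fps_ext)
  fix n
  define w where "w = (\<lambda>a b. P ^ a * Q ^ b)"
  define F G :: "nat \<Rightarrow> nat \<Rightarrow> 'a" where "F = (\<lambda>a b. of_rat (f (a,b)))" and "G = (\<lambda>a b. of_rat (g (a,b)))"
  have w0: "w a b $ m = 0" if "m < a + b" for a b m using monomial_nth_0[OF P0 Q0 that] by (simp add: w_def)
  have "(ser_ev f P Q * ser_ev g P Q) $ n
    = (\<Sum>m=0..n. (\<Sum>a\<le>n. \<Sum>b\<le>n. F a b * w a b $ m) * (\<Sum>c\<le>n. \<Sum>d\<le>n. G c d * w c d $ (n - m)))"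
    unfolding fps_mult_nth by (intro sum.cong refl) (simp add: ser_ev_nth_box[of _ n] F_def G_def w_def)
  also have "\<dots> = (\<Sum>m=0..n. \<Sum>a\<le>n. \<Sum>b\<le>n. \<Sum>c\<le>n. \<Sum>d\<le>n. F a b * G c d * (w a b $ m * w c d $ (n - m)))"
    unfolding sum_distrib_right unfolding sum_distrib_left by (intro sum.cong refl) (simp add: mult_ac)
  also have "\<dots> = (\<Sum>a\<le>n. \<Sum>b\<le>n. \<Sum>c\<le>n. \<Sum>d\<le>n. \<Sum>m=0..n. F a b * G c d * (w a b $ m * w c d $ (n - m)))"
    by (subst sum.swap, rule sum.cong[OF refl], subst sum.swap, rule sum.cong[OF refl], subst sum.swap,
        rule sum.cong[OF refl], subst sum.swap, rule refl)
  also have "\<dots> = (\<Sum>a\<le>n. \<Sum>b\<le>n. \<Sum>c\<le>n. \<Sum>d\<le>n. F a b * G c d * w (a + c) (b + d) $ n)"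
  proof (intro sum.cong refl)
    fix a b c d
    have "w (a + c) (b + d) = w a b * w c d" by (simp add: w_def power_add)
    then show "(\<Sum>m=0..n. F a b * G c d * (w a b $ m * w c d $ (n - m))) = F a b * G c d * w (a + c) (b + d) $ n"
      by (simp add: fps_mult_nth sum_distrib_left)
  qed
  also have "\<dots> = (\<Sum>a\<le>n. \<Sum>c\<le>n. \<Sum>b\<le>n. \<Sum>d\<le>n. F a b * G c d * w (a + c) (b + d) $ n)"
    by (rule sum.cong[OF refl], rule sum.swap)
  also have "\<dots> = (\<Sum>i\<le>n. \<Sum>a\<le>i. \<Sum>j\<le>n. \<Sum>b\<le>j. F a b * G (i - a) (j - b) * w i j $ n)"
  proof -
    have tri: "(\<Sum>a\<le>n. \<Sum>c\<le>n. h a c) = (\<Sum>i\<le>n. \<Sum>a\<le>i. h a (i - a))"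
      if "\<And>a c. n < a + c \<Longrightarrow> h a c = 0" for h :: "nat \<Rightarrow> nat \<Rightarrow> 'a"
    proof -
      have "(\<Sum>a\<le>n. \<Sum>c\<le>n. h a c) = (\<Sum>(a,c)\<in>{..n} \<times> {..n}. h a c)" by (simp add: sum.cartesian_product)
      also have "\<dots> = (\<Sum>(a,c)\<in>{(a,c). a + c \<le> n}. h a c)"
        by (rule sum.mono_neutral_right) (auto intro!: that)
      also have "\<dots> = (\<Sum>i\<le>n. \<Sum>a\<le>i. h a (i - a))" by (rule sum.triangle_reindex_eq)
      finally show ?thesis .
    qed
    have "(\<Sum>a\<le>n. \<Sum>c\<le>n. \<Sum>b\<le>n. \<Sum>d\<le>n. F a b * G c d * w (a + c) (b + d) $ n)
       = (\<Sum>i\<le>n. \<Sum>a\<le>i. \<Sum>b\<le>n. \<Sum>d\<le>n. F a b * G (i - a) d * w (a + (i - a)) (b + d) $ n)"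
      by (rule tri) (auto intro!: sum.neutral simp: w0)
    also have "\<dots> = (\<Sum>i\<le>n. \<Sum>a\<le>i. \<Sum>j\<le>n. \<Sum>b\<le>j. F a b * G (i - a) (j - b) * w (a + (i - a)) (b + (j - b)) $ n)"
      by (intro sum.cong refl tri) (auto simp: w0)
    also have "\<dots> = (\<Sum>i\<le>n. \<Sum>a\<le>i. \<Sum>j\<le>n. \<Sum>b\<le>j. F a b * G (i - a) (j - b) * w i j $ n)"
      by (intro sum.cong refl) auto
    finally show ?thesis .
  qed
  also have "\<dots> = (\<Sum>i\<le>n. \<Sum>j\<le>n. \<Sum>a\<le>i. \<Sum>b\<le>j. F a b * G (i - a) (j - b) * w i j $ n)"
    by (rule sum.cong[OF refl], rule sum.swap)
  also have "\<dots> = ser_ev (ser_mult f g) P Q $ n"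
    by (simp add: ser_ev_def ser_mult_def F_def G_def w_def of_rat_sum of_rat_mult sum_distrib_right)
  finally show "ser_ev (ser_mult f g) P Q $ n = (ser_ev f P Q * ser_ev g P Q) $ n" ..
qed

lemma ser_ev_pow: "ser_ev (ser_pow f n) P Q = ser_ev f P Q ^ n"
  by (induction n) (simp_all add: ser_ev_one ser_ev_mult)

text \<open>A rearrangement of finite sums, since coefficient \<open>n\<close> only sees
  \<open>a + b \<le> i + j \<le> n\<close>. It turns the substitution used to define
  \<open>LT_mult\<close> into composition of evaluations.\<close>

lemma ser_ev_comp:
  assumes G: "no_const G"
  shows "ser_ev (ser_comp f G) P Q = ser_ev f (ser_ev (fst G) P Q) (ser_ev (snd G) P Q)"
proof (rule fps_ext)
  fix n
  define A B where "A = ser_ev (fst G) P Q" and "B = ser_ev (snd G) P Q"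
  define m where "m = (\<lambda>a b. ser_mult (ser_pow (fst G) a) (ser_pow (snd G) b))"
  have mm: "ser_mult (ser_pow (fst G) a) (ser_pow (snd G) b) = m a b" for a b by (simp add: m_def)
  have ord: "m a b (i,j) = 0" if "i + j < a + b" for a b i j
    using ser_ord_mult[OF ser_ord_pow[of "fst G" a] ser_ord_pow[of "snd G" b]] G that
    by (simp add: m_def ser_ord_def no_const_def)
  have "ser_ev (ser_comp f G) P Q $ n
    = (\<Sum>i\<le>n. \<Sum>j\<le>n. \<Sum>a\<le>n. \<Sum>b\<le>n. of_rat (f (a,b)) * of_rat (m a b (i,j)) * (P ^ i * Q ^ j) $ n)"
    unfolding ser_ev_def fps_nth_Abs_fps
  proof (intro sum.cong refl)
    fix i j
    show "of_rat (ser_comp f G (i, j)) * (P ^ i * Q ^ j) $ n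
      = (\<Sum>a\<le>n. \<Sum>b\<le>n. of_rat (f (a, b)) * of_rat (m a b (i, j)) * (P ^ i * Q ^ j) $ n)"
    proof (cases "i + j \<le> n")
      case False
      then show ?thesis using monomial_nth_0[OF P0 Q0, of n i j] by simp
    next
      case True
      have "ser_comp f G (i, j) = (\<Sum>a\<le>i+j. \<Sum>b\<le>n. f (a,b) * m a b (i,j))"
        unfolding ser_comp_def mm prod.case
        using True by (intro sum.cong[OF refl], intro sum.mono_neutral_left) (auto simp: ord)
      also have "\<dots> = (\<Sum>a\<le>n. \<Sum>b\<le>n. f (a,b) * m a b (i,j))"
        using True by (intro sum.mono_neutral_left) (auto simp: ord)
      finally show ?thesis by (simp add: of_rat_sum of_rat_mult sum_distrib_right)
    qed
  qed
  also have "\<dots> = (\<Sum>i\<le>n. \<Sum>a\<le>n. \<Sum>b\<le>n. \<Sum>j\<le>n. of_rat (f (a,b)) * of_rat (m a b (i,j)) * (P ^ i * Q ^ j) $ n)"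
    by (rule sum.cong[OF refl], subst sum.swap, rule sum.cong[OF refl], subst sum.swap, rule refl)
  also have "\<dots> = (\<Sum>a\<le>n. \<Sum>b\<le>n. \<Sum>i\<le>n. \<Sum>j\<le>n. of_rat (f (a,b)) * of_rat (m a b (i,j)) * (P ^ i * Q ^ j) $ n)"
    by (subst sum.swap, rule sum.cong[OF refl], subst sum.swap, rule refl)
  also have "\<dots> = (\<Sum>a\<le>n. \<Sum>b\<le>n. of_rat (f (a,b)) * ser_ev (m a b) P Q $ n)"
    by (simp add: ser_ev_def sum_distrib_left mult.assoc)
  also have "\<dots> = ser_ev f A B $ n"
    by (simp add: m_def ser_ev_mult ser_ev_pow A_def B_def) (simp add: ser_ev_def)
  finally show "ser_ev (ser_comp f G) P Q $ n = ser_ev f (ser_ev (fst G) P Q) (ser_ev (snd G) P Q) $ n"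
    by (simp add: A_def B_def)
qed

end

section \<open>Polynomial functions with integer coefficients\<close>

text \<open>Polynomials enter only through their values at series, so functions suffice; a
  congruence modulo \<open>p\<close> is stated by exhibiting a cofactor in the same set.\<close>

inductive_set polyfun :: "((nat \<Rightarrow> 's::comm_ring_1) \<Rightarrow> 's) set" where
  const: "(\<lambda>w. of_int c) \<in> polyfun"
| var: "(\<lambda>w. w i) \<in> polyfun"
| add: "f \<in> polyfun \<Longrightarrow> g \<in> polyfun \<Longrightarrow> (\<lambda>w. f w + g w) \<in> polyfun"
| mult: "f \<in> polyfun \<Longrightarrow> g \<in> polyfun \<Longrightarrow> (\<lambda>w. f w * g w) \<in> polyfun"

lemma polyfun_of_nat: "(\<lambda>w. of_nat n) \<in> polyfun"
  using polyfun.const[of "int n"] by simp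

lemma polyfun_diff: "f \<in> polyfun \<Longrightarrow> g \<in> polyfun \<Longrightarrow> (\<lambda>w. f w - g w) \<in> polyfun"
  using polyfun.add[OF _ polyfun.mult[OF polyfun.const[of "-1"]], of f g] by simp

lemma polyfun_power: "f \<in> polyfun \<Longrightarrow> (\<lambda>w. f w ^ n) \<in> polyfun"
  by (induction n) (use polyfun.const[of 1] polyfun.mult in auto)

lemma polyfun_sum: "(\<And>i. i \<in> A \<Longrightarrow> f i \<in> polyfun) \<Longrightarrow> (\<lambda>w. \<Sum>i\<in>A. f i w) \<in> polyfun"
  by (induction A rule: infinite_finite_induct) (use polyfun.const[of 0] polyfun.add in auto)

lemma polyfun_subst_power: "f \<in> polyfun \<Longrightarrow> (\<lambda>w. f (\<lambda>i. w i ^ n)) \<in> polyfun"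
  by (induction rule: polyfun.induct) (auto intro: polyfun.intros polyfun_power)

text \<open>The inner binomial coefficients are divisible by \<open>p\<close>. The factor
  \<open>g w\<close> stays visible in the error term because later \<open>g\<close> is itself
  divisible by a power of \<open>p\<close>.\<close>

lemma polyfun_binomial:
  fixes f g :: "(nat \<Rightarrow> 's::comm_ring_1) \<Rightarrow> 's"
  assumes p: "prime p" and f: "f \<in> polyfun" and g: "g \<in> polyfun"
  shows "\<exists>e\<in>polyfun. \<forall>w. (f w + g w) ^ p = f w ^ p + g w ^ p + of_nat p * g w * e w"
proof -
  define e where "e = (\<lambda>w. \<Sum>k\<in>{1..<p}. of_nat ((p choose k) div p) * f w ^ k * g w ^ (p - k - 1))"
  have "e \<in> polyfun" unfolding e_def
    by (intro polyfun_sum polyfun.mult polyfun_of_nat polyfun_power f g)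
  moreover have "(f w + g w) ^ p = f w ^ p + g w ^ p + of_nat p * g w * e w" for w
  proof -
    have p0: "p > 0" using p prime_gt_0_nat by blast
    have "{..p} = insert 0 (insert p {1..<p})" using p0 by auto
    then have "(f w + g w) ^ p = g w ^ p + (f w ^ p + (\<Sum>k\<in>{1..<p}. of_nat (p choose k) * f w ^ k * g w ^ (p - k)))"
      using p0 by (simp add: binomial_ring)
    moreover have "(\<Sum>k\<in>{1..<p}. of_nat (p choose k) * f w ^ k * g w ^ (p - k)) = of_nat p * g w * e w"
      unfolding e_def sum_distrib_left
    proof (intro sum.cong refl)
      fix k assume k: "k \<in> {1..<p}"
      then have "p dvd (p choose k)" using p by (intro dvd_choose_prime) auto
      then have "(of_nat (p choose k) :: 's) = of_nat p * of_nat ((p choose k) div p)"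
        by (simp flip: of_nat_mult)
      moreover have "g w ^ (p - k) = g w * g w ^ (p - k - 1)" using k by (simp flip: power_Suc add: Suc_diff_Suc)
      ultimately show "of_nat (p choose k) * f w ^ k * g w ^ (p - k)
        = of_nat p * g w * (of_nat ((p choose k) div p) * f w ^ k * g w ^ (p - k - 1))" by (simp add: mult_ac)
    qed
    ultimately show ?thesis by (simp add: algebra_simps)
  qed
  ultimately show ?thesis by blast
qed

text \<open>Each further \<open>p\<close>-th power gains one factor \<open>p\<close>: if the
  difference is divisible by \<open>p ^ (j + 1)\<close>, the mixed binomial terms get an extra
  \<open>p\<close>, and the pure power is divisible by \<open>p ^ ((j + 1) * p)\<close>.\<close>

lemma polyfun_prime_power:
  fixes f g :: "(nat \<Rightarrow> 's::comm_ring_1) \<Rightarrow> 's"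
  assumes p: "prime p" and f: "f \<in> polyfun" and g: "g \<in> polyfun"
  shows "\<exists>d\<in>polyfun. \<forall>w. (f w + of_nat p * g w) ^ (p ^ j) = f w ^ (p ^ j) + of_nat p ^ Suc j * d w"
proof (induction j)
  case 0
  show ?case using g by auto
next
  case (Suc j)
  then obtain d where d: "d \<in> polyfun" "\<And>w. (f w + of_nat p * g w) ^ (p ^ j) = f w ^ (p ^ j) + of_nat p ^ Suc j * d w"
    by blast
  have f': "(\<lambda>w. f w ^ (p ^ j)) \<in> polyfun" using f polyfun_power by blast
  have d': "(\<lambda>w. of_nat p ^ Suc j * d w) \<in> polyfun"
    using d polyfun.mult[OF polyfun_of_nat[of "p ^ Suc j"] d(1)] by simp
  obtain e where e: "e \<in> polyfun" "\<And>w. (f w ^ (p ^ j) + of_nat p ^ Suc j * d w) ^ p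
      = (f w ^ (p ^ j)) ^ p + (of_nat p ^ Suc j * d w) ^ p + of_nat p * (of_nat p ^ Suc j * d w) * e w"
    using polyfun_binomial[OF p f' d'] by blast
  \<comment> \<open>Surplus of the exponent of \<open>p\<close> in the pure power term over the
    required \<open>j + 2\<close>; nonnegative as \<open>p \<ge> 2\<close>.\<close>
  define s where "s = Suc j * p - Suc (Suc j)"
  have "p \<ge> 2" using p prime_ge_2_nat by blast
  then have "Suc j * p \<ge> Suc j * 2" by (intro mult_le_mono) auto
  then have s: "Suc j * p = Suc (Suc j) + s" by (simp add: s_def)
  have "(f w + of_nat p * g w) ^ (p ^ Suc j)
      = f w ^ (p ^ Suc j) + of_nat p ^ Suc (Suc j) * (of_nat p ^ s * d w ^ p + d w * e w)" for w
  proof -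
    have "(f w + of_nat p * g w) ^ (p ^ Suc j) = ((f w + of_nat p * g w) ^ (p ^ j)) ^ p"
      by (simp add: power_mult mult.commute[of p])
    also have "\<dots> = f w ^ (p ^ Suc j) + of_nat p ^ (Suc j * p) * d w ^ p + of_nat p ^ Suc (Suc j) * d w * e w"
      unfolding d e power_mult_distrib by (simp add: mult.commute[of p] mult.assoc power_mult_distrib power_add flip: power_mult)
    also have "\<dots> = f w ^ (p ^ Suc j) + of_nat p ^ Suc (Suc j) * (of_nat p ^ s * d w ^ p + d w * e w)"
      unfolding s power_add by (simp add: algebra_simps)
    finally show ?thesis .
  qed
  moreover have "(\<lambda>w. of_nat p ^ s * d w ^ p + d w * e w) \<in> polyfun"
    using polyfun.add[OF polyfun.mult[OF polyfun_of_nat[of "p ^ s"] polyfun_power[OF d(1)]] polyfun.mult[OF d(1) e(1)]] by simp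
  ultimately show ?case by (intro bexI[of _ "\<lambda>w. of_nat p ^ s * d w ^ p + d w * e w"]) auto
qed

lemma fermat_int:
  assumes p: "prime p" shows "int p dvd c - c ^ p"
proof -
  have step: "\<exists>e. (c + 1) ^ p = c ^ p + 1 + int p * e" for c :: int
  proof -
    have "(\<lambda>w::nat \<Rightarrow> int. of_int c) \<in> polyfun" "(\<lambda>w::nat \<Rightarrow> int. of_int 1) \<in> polyfun" by (rule polyfun.const)+
    from polyfun_binomial[OF p this] show ?thesis by auto
  qed
  show ?thesis
  proof (induction c rule: int_induct[of _ 0])
    case base
    then show ?case using p prime_gt_0_nat[OF p] by (simp add: power_0_left)
  next
    case (step1 i)
    obtain e where e: "(i + 1) ^ p = i ^ p + 1 + int p * e" using step by blast
    obtain d where d: "i - i ^ p = int p * d" using step1 by blast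
    have "(i + 1) - (i + 1) ^ p = int p * (d - e)" using e d by (simp add: algebra_simps)
    then show ?case by simp
  next
    case (step2 i)
    obtain e where e: "(i - 1 + 1) ^ p = (i - 1) ^ p + 1 + int p * e" using step by blast
    obtain d where d: "i - i ^ p = int p * d" using step2 by blast
    have "(i - 1) - (i - 1) ^ p = int p * (d + e)" using e d by (simp add: algebra_simps)
    then show ?case by simp
  qed
qed

text \<open>Induction on the construction of \<open>f\<close>: constants are Fermat's little
  theorem, sums are \<open>polyfun_binomial\<close>.\<close>

lemma polyfun_frobenius1:
  fixes f :: "(nat \<Rightarrow> 's::comm_ring_1) \<Rightarrow> 's"
  assumes p: "prime p" and f: "f \<in> polyfun"
  shows "\<exists>s\<in>polyfun. \<forall>w. f (\<lambda>i. w i ^ p) = f w ^ p + of_nat p * s w"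
  using f
proof (induction rule: polyfun.induct)
  case (const c)
  obtain d where d: "c - c ^ p = int p * d" using fermat_int[OF p, of c] by blast
  have "of_int c = (of_int c :: 's) ^ p + of_nat p * of_int d"
    using arg_cong[OF d, of "of_int :: int \<Rightarrow> 's"] by (simp add: algebra_simps)
  then show ?case using polyfun.const[of d] by (intro bexI[of _ "\<lambda>w. of_int d"]) auto
next
  case (var i)
  show ?case using polyfun.const[of 0] by (intro bexI[of _ "\<lambda>w. of_int 0"]) auto
next
  case (add f g)
  then obtain s t where st: "s \<in> polyfun" "\<And>w. f (\<lambda>i. w i ^ p) = f w ^ p + of_nat p * s w"
    "t \<in> polyfun" "\<And>w. g (\<lambda>i. w i ^ p) = g w ^ p + of_nat p * t w" by blast
  obtain e where e: "e \<in> polyfun" "\<And>w. (f w + g w) ^ p = f w ^ p + g w ^ p + of_nat p * g w * e w"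
    using polyfun_binomial[OF p add.hyps] by blast
  have "(\<lambda>w. s w + t w - g w * e w) \<in> polyfun" using st e add
    by (intro polyfun_diff polyfun.intros)
  then show ?case by (rule bexI[rotated]) (simp add: st e algebra_simps)
next
  case (mult f g)
  then obtain s t where st: "s \<in> polyfun" "\<And>w. f (\<lambda>i. w i ^ p) = f w ^ p + of_nat p * s w"
    "t \<in> polyfun" "\<And>w. g (\<lambda>i. w i ^ p) = g w ^ p + of_nat p * t w" by blast
  have "(\<lambda>w. f w ^ p * t w + s w * g w ^ p + of_nat p * (s w * t w)) \<in> polyfun" using st mult
    by (intro polyfun.intros polyfun_power polyfun_of_nat)
  then show ?case by (rule bexI[rotated]) (simp add: st power_mult_distrib algebra_simps)
qed

text \<open>The Frobenius congruence that Hazewinkel's argument requires. Apply the case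
  \<open>j\<close> at the point of \<open>p\<close>-th powers, and raise the congruence of the case
  1 to the power \<open>p ^ j\<close>.\<close>

lemma polyfun_frobenius:
  fixes f :: "(nat \<Rightarrow> 's::comm_ring_1) \<Rightarrow> 's"
  assumes p: "prime p" and f: "f \<in> polyfun"
  shows "\<exists>s\<in>polyfun. \<forall>w. f (\<lambda>i. w i ^ (p ^ j)) = f w ^ (p ^ j) + of_nat p * s w"
proof (induction j)
  case 0
  show ?case using polyfun.const[of 0] by (intro bexI[of _ "\<lambda>w. of_int 0"]) auto
next
  case (Suc j)
  then obtain s where s: "s \<in> polyfun" "\<And>w. f (\<lambda>i. w i ^ (p ^ j)) = f w ^ (p ^ j) + of_nat p * s w" by blast
  obtain t where t: "t \<in> polyfun" "\<And>w. f (\<lambda>i. w i ^ p) = f w ^ p + of_nat p * t w"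
    using polyfun_frobenius1[OF p f] by blast
  obtain d where d: "d \<in> polyfun" "\<And>w. (f w ^ p + of_nat p * t w) ^ (p ^ j) = (f w ^ p) ^ (p ^ j) + of_nat p ^ Suc j * d w"
    using polyfun_prime_power[OF p polyfun_power[OF f] t(1)] by blast
  have "f (\<lambda>i. w i ^ (p ^ Suc j)) = f w ^ (p ^ Suc j) + of_nat p * (of_nat (p ^ j) * d w + s (\<lambda>i. w i ^ p))" for w
  proof -
    have "f (\<lambda>i. w i ^ (p ^ Suc j)) = f (\<lambda>i. (w i ^ p) ^ (p ^ j))" by (simp add: power_mult)
    also have "\<dots> = f (\<lambda>i. w i ^ p) ^ (p ^ j) + of_nat p * s (\<lambda>i. w i ^ p)" by (rule s)
    also have "\<dots> = f w ^ (p ^ Suc j) + of_nat p * (of_nat (p ^ j) * d w + s (\<lambda>i. w i ^ p))"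
      unfolding t d by (simp add: algebra_simps flip: power_mult)
    finally show ?thesis .
  qed
  moreover have "(\<lambda>w. of_nat (p ^ j) * d w + s (\<lambda>i. w i ^ p)) \<in> polyfun"
    by (intro polyfun.add polyfun.mult polyfun_of_nat d polyfun_subst_power s)
  ultimately show ?case by (intro bexI[of _ "\<lambda>w. of_nat (p ^ j) * d w + s (\<lambda>i. w i ^ p)"]) auto
qed

section \<open>The logarithm\<close>

text \<open>Coefficients of \<open>beta(t) = t + p^-2 t^q + p^-4 t^(q^2) + ...\<close> with
  \<open>q = p ^ h\<close>. Both logarithm components are built from it:
  \<open>L1 = beta(x1) + beta(x2^q1) / p\<close> and
  \<open>L2 = beta(x2) + beta(x1^q2) / p\<close>.\<close>

definition beta_coeff :: "nat \<Rightarrow> nat \<Rightarrow> nat \<Rightarrow> rat" where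
  "beta_coeff p h i = (\<Sum>k\<le>i. if i = p ^ (k * h) then 1 / of_nat p ^ (2 * k) else 0)"

definition beta_fps :: "nat \<Rightarrow> nat \<Rightarrow> 'a::field_char_0 fps" where
  "beta_fps p h = Abs_fps (\<lambda>i. of_rat (beta_coeff p h i))"

lemma fps_compose_X_power_nth:
  assumes "s > 0"
  shows "((b :: 'a::comm_ring_1 fps) oo fps_X ^ s) $ n = (if s dvd n then b $ (n div s) else 0)"
proof -
  have "(b oo fps_X ^ s) $ n = (\<Sum>i=0..n. b $ i * (if n = s * i then 1 else 0))"
    unfolding fps_compose_nth power_mult[symmetric] by (simp add: fps_X_power_nth)
  also have "\<dots> = (\<Sum>i=0..n. if i = n div s then (if s dvd n then b $ (n div s) else 0) else 0)"
    using assms by (intro sum.cong refl) auto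
  also have "\<dots> = (if s dvd n then b $ (n div s) else 0)" by simp
  finally show ?thesis .
qed

locale lubin_tate = padic v p for v :: "'a::field_char_0 \<Rightarrow> real" and p :: nat +
  fixes h1 h2 :: nat
  assumes h1_pos: "h1 > 0" and h2_pos: "h2 > 0"
begin

abbreviation "h \<equiv> h1 + h2"
abbreviation "q1 \<equiv> p ^ h1"
abbreviation "q2 \<equiv> p ^ h2"
abbreviation "q \<equiv> p ^ h"

abbreviation b :: "'a fps" where "b \<equiv> beta_fps p h"
abbreviation cp :: "'a fps" where "cp \<equiv> fps_const (1 / of_nat p)"

lemma q_eq: "q1 * q2 = q" "q2 * q1 = q" by (simp_all add: power_add mult.commute)

lemma q1_ge: "q1 \<ge> 2" and q2_ge: "q2 \<ge> 2"
  using h1_pos h2_pos p_ge_2 self_le_power[of p h1] self_le_power[of p h2] by linarith+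

lemma q_ge: "q \<ge> q1 + 2" "q \<ge> q2 + 2" "q \<ge> 4"
proof -
  have "q1 * 2 \<le> q1 * q2" "2 * q2 \<le> q1 * q2" "2 * 2 \<le> q1 * q2" using q1_ge q2_ge by (intro mult_le_mono; simp)+
  then show "q \<ge> q1 + 2" "q \<ge> q2 + 2" "q \<ge> 4" using q1_ge q2_ge unfolding q_eq by linarith+
qed

lemma pow_h_inj: "p ^ (k * h) = p ^ (l * h) \<longleftrightarrow> k = l"
  using p_ge_2 h1_pos by (simp add: power_inject_exp)

lemma less_pow_h: "k < p ^ (k * h)"
proof -
  have "k < p ^ k" using p_ge_2 by (simp add: less_exp power_gt_expt)
  also have "\<dots> \<le> p ^ (k * h)" using h1_pos p_ge_2 by (intro power_increasing) auto
  finally show ?thesis .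
qed

lemma beta_coeff_pow: "beta_coeff p h (p ^ (k * h)) = 1 / of_nat p ^ (2 * k)"
proof -
  have "beta_coeff p h (p ^ (k * h)) = (\<Sum>l\<le>p ^ (k * h). if l = k then 1 / of_nat p ^ (2 * k) else 0)"
    unfolding beta_coeff_def by (intro sum.cong refl) (auto simp: pow_h_inj)
  then show ?thesis using less_pow_h[of k] by simp
qed

lemma beta_coeff_other: "(\<And>k. n \<noteq> p ^ (k * h)) \<Longrightarrow> beta_coeff p h n = 0"
  by (simp add: beta_coeff_def)

lemma beta_coeff_0: "beta_coeff p h 0 = 0" by (rule beta_coeff_other) simp

lemma b_nth_pow: "b $ (p ^ (k * h)) = 1 / of_nat p ^ (2 * k)"
  by (simp add: beta_fps_def beta_coeff_pow of_rat_divide of_rat_power)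

lemma b_nth_other: "(\<And>k. n \<noteq> p ^ (k * h)) \<Longrightarrow> b $ n = 0"
  by (simp add: beta_fps_def beta_coeff_other)

lemma b_nth_0 [simp]: "b $ 0 = 0" by (rule b_nth_other) simp

lemma b_nth_1 [simp]: "b $ Suc 0 = 1" using b_nth_pow[of 0] by simp

lemma b_functional: "b = fps_X + cp ^ 2 * (b oo fps_X ^ q)"
proof (rule fps_ext)
  fix n
  have q0: "q > 0" using p_ge_2 by simp
  have rhs: "(fps_X + cp ^ 2 * (b oo fps_X ^ q)) $ n
      = (if n = 1 then 1 else 0) + (1 / of_nat p ^ 2) * (if q dvd n then b $ (n div q) else 0)"
    by (simp add: fps_compose_X_power_nth[OF q0] fps_const_power power_divide)
  show "b $ n = (fps_X + cp ^ 2 * (b oo fps_X ^ q)) $ n"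
  proof (cases "\<exists>k. n = p ^ (k * h)")
    case True
    then obtain k where k: "n = p ^ (k * h)" by blast
    show ?thesis
    proof (cases k)
      case 0
      have "\<not> q dvd 1" using q_ge(3) by (metis One_nat_def nat_dvd_1_iff_1 numeral_le_one_iff semiring_norm(69))
      then show ?thesis unfolding rhs using k 0 h1_pos by simp
    next
      case (Suc l)
      then have n: "n = q * p ^ (l * h)" using k by (simp add: power_add)
      then have "n \<noteq> 1" using q_ge(3) by (metis nat_mult_eq_1_iff numeral_le_one_iff semiring_norm(69))
      moreover have "q dvd n" "n div q = p ^ (l * h)" using n q0 by auto
      moreover have "b $ n = 1 / of_nat p ^ (2 * Suc l)" using k Suc b_nth_pow[of "Suc l"] by simp
      ultimately show ?thesis unfolding rhs by (simp add: b_nth_pow power2_eq_square)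
    qed
  next
    case False
    then have "b $ n = 0" by (intro b_nth_other) blast
    moreover have "n \<noteq> 1" using False by (metis mult_0 power_0)
    moreover have "b $ (n div q) = 0" if "q dvd n"
    proof (rule b_nth_other)
      fix k show "n div q \<noteq> p ^ (k * h)"
      proof
        assume "n div q = p ^ (k * h)"
        then have "n = q * p ^ (k * h)" using that by (metis dvd_mult_div_cancel)
        then have "n = p ^ (Suc k * h)" by (simp add: power_add)
        then show False using False by blast
      qed
    qed
    ultimately show ?thesis using rhs by simp
  qed
qed

lemma q_pos [simp]: "q > 0" "q1 > 0" "q2 > 0" by simp_all

lemma beta_functional: assumes "P $ 0 = 0" shows "(b oo P) = P + cp ^ 2 * (b oo P ^ q)"
proof -
  have "(b oo P) = (fps_X + cp ^ 2 * (b oo fps_X ^ q)) oo P" using b_functional by simp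
  also have "\<dots> = P + cp ^ 2 * ((b oo fps_X ^ q) oo P)"
    using assms by (simp add: fps_compose_add_distrib fps_compose_mult_distrib fps_const_power)
  also have "(b oo fps_X ^ q) oo P = (b oo (fps_X ^ q oo P))" using assms by (subst fps_compose_assoc) auto
  also have "fps_X ^ q oo P = P ^ q" using assms by (simp add: fps_X_power_compose)
  finally show ?thesis .
qed

lemma beta_expand:
  assumes "P $ 0 = 0" shows "(b oo P) = (\<Sum>k<n. cp ^ (2 * k) * P ^ (q ^ k)) + cp ^ (2 * n) * (b oo P ^ (q ^ n))"
proof (induction n)
  case (Suc n)
  have "(b oo P ^ (q ^ n)) = P ^ (q ^ n) + cp ^ 2 * (b oo P ^ (q ^ Suc n))"
    using beta_functional[of "P ^ (q ^ n)"] assms by (simp add: mult.commute flip: power_mult)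
  then show ?case using Suc by (simp add: algebra_simps power_add power2_eq_square)
qed (simp add: fps_compose_def)

definition Lam1 :: "'a fps \<Rightarrow> 'a fps \<Rightarrow> 'a fps" where
  "Lam1 P Q = (b oo P) + cp * (b oo Q ^ q1)"

definition Lam2 :: "'a fps \<Rightarrow> 'a fps \<Rightarrow> 'a fps" where
  "Lam2 P Q = (b oo Q) + cp * (b oo P ^ q2)"

text \<open>One application of \<open>beta_functional\<close> in each case. The first pair is the
  equation with \<open>\<psi>\<close>. The second pair raises both coordinates to the same power and
  exchanges the components of the logarithm, which is the form that fits the Frobenius
  congruence.\<close>

lemma Lam_functional:
  assumes "P $ 0 = 0" "Q $ 0 = 0"
  shows "Lam1 P Q = P + cp * Lam1 (Q ^ q1) (P ^ q2)" "Lam2 P Q = Q + cp * Lam2 (Q ^ q1) (P ^ q2)"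
    "Lam1 P Q = P + cp * Lam2 (P ^ q1) (Q ^ q1)" "Lam2 P Q = Q + cp * Lam1 (P ^ q2) (Q ^ q2)"
  using beta_functional[OF assms(1)] beta_functional[OF assms(2)]
  by (simp_all add: Lam1_def Lam2_def q_eq algebra_simps power2_eq_square flip: power_mult)

lemma Lam_nth_0 [simp]: "Lam1 P Q $ 0 = 0" "Lam2 P Q $ 0 = 0"
  by (simp_all add: Lam1_def Lam2_def)

lemma ordge_Lam:
  "ordge n P \<Longrightarrow> ordge n Q \<Longrightarrow> ordge n (Lam1 P Q)" "ordge n P \<Longrightarrow> ordge n Q \<Longrightarrow> ordge n (Lam2 P Q)"
  using q1_ge q2_ge
  by (auto simp: Lam1_def Lam2_def simp del: q_pos intro!: ordge_add ordge_mult2 ordge_compose ordge_power'[of n])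

lemma ordge_Lam_diff:
  assumes "ordge n (P - P')" "ordge n (Q - Q')"
  shows "ordge n (Lam1 P Q - Lam1 P' Q')" "ordge n (Lam2 P Q - Lam2 P' Q')"
proof -
  have "Lam1 P Q - Lam1 P' Q' = ((b oo P) - (b oo P')) + cp * ((b oo Q ^ q1) - (b oo Q' ^ q1))"
    "Lam2 P Q - Lam2 P' Q' = ((b oo Q) - (b oo Q')) + cp * ((b oo P ^ q2) - (b oo P' ^ q2))"
    by (simp_all add: Lam1_def Lam2_def algebra_simps)
  then show "ordge n (Lam1 P Q - Lam1 P' Q')" "ordge n (Lam2 P Q - Lam2 P' Q')"
    using assms by (auto intro!: ordge_add ordge_mult2 ordge_compose_diff ordge_power_diff')
qed

lemma Lam_zero [simp]: "Lam1 0 0 = 0" "Lam2 0 0 = 0"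
  by (simp_all add: Lam1_def Lam2_def power_0_left)

text \<open>Each application of the functional equation gains one order of vanishing.\<close>
lemma Lam_inj:
  assumes z: "P $ 0 = 0" "Q $ 0 = 0" "P' $ 0 = 0" "Q' $ 0 = 0"
    and eq: "Lam1 P Q = Lam1 P' Q'" "Lam2 P Q = Lam2 P' Q'"
  shows "P = P' \<and> Q = Q'"
proof -
  have "ordge n (P - P') \<and> ordge n (Q - Q')" for n
  proof (induction n)
    case (Suc n)
    have "P - P' = cp * (Lam1 (Q' ^ q1) (P' ^ q2) - Lam1 (Q ^ q1) (P ^ q2))"
      "Q - Q' = cp * (Lam2 (Q' ^ q1) (P' ^ q2) - Lam2 (Q ^ q1) (P ^ q2))"
      using Lam_functional(1,2)[OF z(1,2)] Lam_functional(1,2)[OF z(3,4)] eq by (simp_all add: algebra_simps)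
    moreover have "ordge (Suc n) (Q' ^ q1 - Q ^ q1)" "ordge (Suc n) (P' ^ q2 - P ^ q2)"
    proof -
      have "ordge n (Q' - Q)" "ordge n (P' - P)" using Suc ordge_minus by fastforce+
      then have "ordge (n + 1 * (q1 - 1)) (Q' ^ q1 - Q ^ q1)" "ordge (n + 1 * (q2 - 1)) (P' ^ q2 - P ^ q2)"
        using z by (intro ordge_power_diff; simp add: ordge_1_iff)+
      then show "ordge (Suc n) (Q' ^ q1 - Q ^ q1)" "ordge (Suc n) (P' ^ q2 - P ^ q2)"
        using q1_ge q2_ge by (auto intro: ordge_mono)
    qed
    ultimately show ?case using ordge_Lam_diff[of "Suc n" "Q' ^ q1" "Q ^ q1" "P' ^ q2" "P ^ q2"]
      by (auto intro: ordge_mult2)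
  qed simp
  then show ?thesis using ordge_all_imp_0[of "P - P'"] ordge_all_imp_0[of "Q - Q'"] by auto
qed

lemma LT_L1_eq: "LT_L1 p h1 h2 = (\<lambda>(i,j). (if j = 0 then beta_coeff p h i else 0)
    + (if i = 0 \<and> q1 dvd j then beta_coeff p h (j div q1) / of_nat p else 0))"
  and LT_L2_eq: "LT_L2 p h1 h2 = (\<lambda>(i,j). (if i = 0 then beta_coeff p h j else 0)
    + (if j = 0 \<and> q2 dvd i then beta_coeff p h (i div q2) / of_nat p else 0))"
proof -
  have *: "(\<Sum>k\<le>j. if j = p ^ (g + k * h) then 1 / of_nat p ^ (2 * k + 1) else 0)
    = (if p ^ g dvd j then beta_coeff p h (j div p ^ g) / of_nat p else (0::rat))" for g j
  proof (cases "p ^ g dvd j")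
    case False
    then have "j \<noteq> p ^ (g + k * h)" for k by (auto simp: power_add)
    then show ?thesis using False by simp
  next
    case True
    then obtain i where i: "j = p ^ g * i" by blast
    have ij: "i \<le> j" using p_ge_2 by (simp add: i)
    \<comment> \<open>The summation ranges differ, but every \<open>k > i\<close> has
      \<open>p ^ (k * h) > k > i\<close> and contributes nothing.\<close>
    have "beta_coeff p h i = (\<Sum>k\<le>j. if i = p ^ (k * h) then 1 / of_nat p ^ (2 * k) else 0)"
      unfolding beta_coeff_def using less_pow_h ij
      by (intro sum.mono_neutral_left) (auto simp: not_le, metis less_asym)
    from arg_cong[OF this, of "\<lambda>x. x / of_nat p"]
    have "beta_coeff p h i / of_nat p = (\<Sum>k\<le>j. if i = p ^ (k * h) then 1 / of_nat p ^ (2 * k + 1) else 0)"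
      unfolding sum_divide_distrib by (rule trans) (intro sum.cong refl, simp)
    then show ?thesis using True by (simp add: i power_add)
  qed
  have **: "(\<Sum>k\<le>i. if i = p ^ (k * h) then 1 / of_nat p ^ (2 * k) else 0) = beta_coeff p h i" for i
    by (simp add: beta_coeff_def)
  show "LT_L1 p h1 h2 = (\<lambda>(i,j). (if j = 0 then beta_coeff p h i else 0)
    + (if i = 0 \<and> q1 dvd j then beta_coeff p h (j div q1) / of_nat p else 0))"
  proof (rule ext, clarify)
    fix i j
    show "LT_L1 p h1 h2 (i,j) = (if j = 0 then beta_coeff p h i else 0)
      + (if i = 0 \<and> q1 dvd j then beta_coeff p h (j div q1) / of_nat p else 0)"
      unfolding LT_L1_def prod.case *[of j h1] **[of i] by simp
  qed
  show "LT_L2 p h1 h2 = (\<lambda>(i,j). (if i = 0 then beta_coeff p h j else 0)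
    + (if j = 0 \<and> q2 dvd i then beta_coeff p h (i div q2) / of_nat p else 0))"
  proof (rule ext, clarify)
    fix i j
    show "LT_L2 p h1 h2 (i,j) = (if i = 0 then beta_coeff p h j else 0)
      + (if j = 0 \<and> q2 dvd i then beta_coeff p h (i div q2) / of_nat p else 0)"
      unfolding LT_L2_def prod.case *[of i h2] **[of j] by simp
  qed
qed

lemma beta_scaled_nth:
  assumes "Q $ 0 = 0" "s > 0"
  shows "(cp * (b oo Q ^ s)) $ n = (\<Sum>j\<le>n. of_rat (if s dvd j then beta_coeff p h (j div s) / of_nat p else 0) * (Q ^ j) $ n)"
proof -
  have "(b oo Q ^ s) = (b oo fps_X ^ s) oo Q"
    using assms by (subst fps_compose_assoc[symmetric]) (auto simp: fps_X_power_compose)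
  then have "cp * (b oo Q ^ s) = (cp * (b oo fps_X ^ s)) oo Q"
    using assms by (simp add: fps_compose_mult_distrib)
  moreover have "(cp * (b oo fps_X ^ s)) $ j = of_rat (if s dvd j then beta_coeff p h (j div s) / of_nat p else 0)" for j
    by (simp add: fps_compose_X_power_nth[OF assms(2)]) (simp add: beta_fps_def of_rat_divide)
  ultimately show ?thesis by (simp add: fps_compose_nth atMost_atLeast0)
qed

lemma ser_ev_LT_L:
  assumes "P $ 0 = 0" "Q $ 0 = 0"
  shows "ser_ev (LT_L1 p h1 h2) P Q = Lam1 P Q" "ser_ev (LT_L2 p h1 h2) P Q = Lam2 P Q"
proof -
  have b: "(b oo P) $ n = (\<Sum>a\<le>n. of_rat (beta_coeff p h a) * (P ^ a) $ n)" for n P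
    by (simp add: fps_compose_nth beta_fps_def atMost_atLeast0)
  show "ser_ev (LT_L1 p h1 h2) P Q = Lam1 P Q"
  proof (rule fps_ext)
    fix n
    have "ser_ev (LT_L1 p h1 h2) P Q $ n = (\<Sum>i\<le>n. \<Sum>j\<le>n. (if j = 0 then of_rat (beta_coeff p h i) * (P ^ i) $ n else 0)
        + (if i = 0 then of_rat (if q1 dvd j then beta_coeff p h (j div q1) / of_nat p else 0) * (Q ^ j) $ n else 0))"
      unfolding ser_ev_def LT_L1_eq fps_nth_Abs_fps by (intro sum.cong refl) (auto simp: of_rat_add algebra_simps)
    also have "\<dots> = (\<Sum>i\<le>n. of_rat (beta_coeff p h i) * (P ^ i) $ n)
        + (\<Sum>j\<le>n. of_rat (if q1 dvd j then beta_coeff p h (j div q1) / of_nat p else 0) * (Q ^ j) $ n)"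
      unfolding sum.distrib by (subst (2) sum.swap) (simp cong: if_cong)
    finally show "ser_ev (LT_L1 p h1 h2) P Q $ n = Lam1 P Q $ n"
      unfolding Lam1_def fps_add_nth b beta_scaled_nth[OF assms(2) q_pos(2)] .
  qed
  show "ser_ev (LT_L2 p h1 h2) P Q = Lam2 P Q"
  proof (rule fps_ext)
    fix n
    have "ser_ev (LT_L2 p h1 h2) P Q $ n = (\<Sum>i\<le>n. \<Sum>j\<le>n. (if i = 0 then of_rat (beta_coeff p h j) * (Q ^ j) $ n else 0)
        + (if j = 0 then of_rat (if q2 dvd i then beta_coeff p h (i div q2) / of_nat p else 0) * (P ^ i) $ n else 0))"
      unfolding ser_ev_def LT_L2_eq fps_nth_Abs_fps by (intro sum.cong refl) (auto simp: of_rat_add algebra_simps)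
    also have "\<dots> = (\<Sum>j\<le>n. of_rat (beta_coeff p h j) * (Q ^ j) $ n)
        + (\<Sum>i\<le>n. of_rat (if q2 dvd i then beta_coeff p h (i div q2) / of_nat p else 0) * (P ^ i) $ n)"
      unfolding sum.distrib by (subst sum.swap) (simp cong: if_cong)
    finally show "ser_ev (LT_L2 p h1 h2) P Q $ n = Lam2 P Q $ n"
      unfolding Lam2_def fps_add_nth b beta_scaled_nth[OF assms(1) q_pos(3)] .
  qed
qed

lemma LT_L_ord: "ser_ord 2 (ser_diff (fst (LT_L p h1 h2)) ser_X1)" "ser_ord 2 (ser_diff (snd (LT_L p h1 h2)) ser_X2)"
proof -
  have hn: "h1 \<noteq> 0" "h2 \<noteq> 0" using h1_pos h2_pos by auto
  have c1: "beta_coeff p h (Suc 0) = 1" using beta_coeff_pow[of 0] by simp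
  have nd: "\<not> q1 dvd Suc 0" "\<not> q2 dvd Suc 0" using h1_pos h2_pos by auto
  have lt2: "(i = 0 \<and> j = 0) \<or> (i = 1 \<and> j = 0) \<or> (i = 0 \<and> j = 1)" if "i + j < 2" for i j :: nat
    using that by auto
  show "ser_ord 2 (ser_diff (fst (LT_L p h1 h2)) ser_X1)"
    unfolding ser_ord_def
  proof (intro allI impI)
    fix i j :: nat assume "i + j < 2"
    from lt2[OF this] show "ser_diff (fst (LT_L p h1 h2)) ser_X1 (i,j) = 0"
      by (elim disjE conjE) (simp_all add: LT_L_def ser_diff_def LT_L1_eq ser_X1_def beta_coeff_0 c1 nd hn)
  qed
  show "ser_ord 2 (ser_diff (snd (LT_L p h1 h2)) ser_X2)"
    unfolding ser_ord_def
  proof (intro allI impI)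
    fix i j :: nat assume "i + j < 2"
    from lt2[OF this] show "ser_diff (snd (LT_L p h1 h2)) ser_X2 (i,j) = 0"
      by (elim disjE conjE) (simp_all add: LT_L_def ser_diff_def LT_L2_eq ser_X2_def beta_coeff_0 c1 nd hn)
  qed
qed

definition Linv1 :: "'a fps \<Rightarrow> 'a fps \<Rightarrow> 'a fps" where
  "Linv1 = ser_ev (fst (ser2_inv (LT_L p h1 h2)))"

definition Linv2 :: "'a fps \<Rightarrow> 'a fps \<Rightarrow> 'a fps" where
  "Linv2 = ser_ev (snd (ser2_inv (LT_L p h1 h2)))"

lemma ser2_inv_LT_L: "no_const (ser2_inv (LT_L p h1 h2))"
  "ser2_comp (LT_L p h1 h2) (ser2_inv (LT_L p h1 h2)) = (ser_X1, ser_X2)"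
  using theI'[OF ser2_inverse_exists_unique[OF LT_L_ord]] by (auto simp: ser2_inv_def)

lemma Linv_nth_0 [simp]: "Linv1 P Q $ 0 = 0" "Linv2 P Q $ 0 = 0"
  using ser2_inv_LT_L(1) by (auto simp: Linv1_def Linv2_def no_const_def ser_ev_def)

lemma Lam_Linv:
  assumes "P $ 0 = 0" "Q $ 0 = 0"
  shows "Lam1 (Linv1 P Q) (Linv2 P Q) = P" "Lam2 (Linv1 P Q) (Linv2 P Q) = Q"
proof -
  have "ser_comp (LT_L1 p h1 h2) (ser2_inv (LT_L p h1 h2)) = ser_X1"
    "ser_comp (LT_L2 p h1 h2) (ser2_inv (LT_L p h1 h2)) = ser_X2"
    using ser2_inv_LT_L(2) by (auto simp: ser2_comp_def LT_L_def)
  note inv = this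
  have "Lam1 (Linv1 P Q) (Linv2 P Q) = ser_ev (LT_L1 p h1 h2) (Linv1 P Q) (Linv2 P Q)"
    "Lam2 (Linv1 P Q) (Linv2 P Q) = ser_ev (LT_L2 p h1 h2) (Linv1 P Q) (Linv2 P Q)"
    by (simp_all add: ser_ev_LT_L)
  then show "Lam1 (Linv1 P Q) (Linv2 P Q) = P" "Lam2 (Linv1 P Q) (Linv2 P Q) = Q"
    unfolding Linv1_def Linv2_def ser_ev_comp[OF assms ser2_inv_LT_L(1), symmetric] inv
    by (simp_all add: ser_ev_X1[OF assms] ser_ev_X2[OF assms])
qed

lemma Linv_Lam:
  assumes "P $ 0 = 0" "Q $ 0 = 0"
  shows "Linv1 (Lam1 P Q) (Lam2 P Q) = P" "Linv2 (Lam1 P Q) (Lam2 P Q) = Q"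
  using Lam_inj[OF Linv_nth_0(1)[of "Lam1 P Q" "Lam2 P Q"] Linv_nth_0(2)[of "Lam1 P Q" "Lam2 P Q"] assms]
    Lam_Linv[of "Lam1 P Q" "Lam2 P Q"] by simp_all

text \<open>Connects the multiplication series of the formal group with logarithms, where it is
  multiplication by the scalar.\<close>

lemma ser_ev_LT_mult:
  fixes a :: rat
  assumes "P $ 0 = 0" "Q $ 0 = 0"
  defines "c \<equiv> fps_const (of_rat a)"
  shows "ser_ev (fst (LT_mult p h1 h2 a)) P Q = Linv1 (c * Lam1 P Q) (c * Lam2 P Q)"
    "ser_ev (snd (LT_mult p h1 h2 a)) P Q = Linv2 (c * Lam1 P Q) (c * Lam2 P Q)"
proof -
  have "no_const (ser_smult a (LT_L1 p h1 h2), ser_smult a (LT_L2 p h1 h2))"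
    by (simp add: no_const_def ser_smult_def LT_L1_eq LT_L2_eq beta_coeff_0)
  note comp = ser_ev_comp[OF assms(1,2) this]
  show "ser_ev (fst (LT_mult p h1 h2 a)) P Q = Linv1 (c * Lam1 P Q) (c * Lam2 P Q)"
    "ser_ev (snd (LT_mult p h1 h2 a)) P Q = Linv2 (c * Lam1 P Q) (c * Lam2 P Q)"
    by (simp_all add: LT_mult_def ser2_comp_def comp Linv1_def Linv2_def ser_ev_smult[OF assms(1,2)]
        ser_ev_LT_L[OF assms(1,2)] c_def)
qed

end

section \<open>The functional equation lemma\<close>

context lubin_tate
begin

lemma cp_p: "cp ^ r * of_nat p ^ (r + k) = of_nat p ^ k"
proof -
  have "cp * of_nat p = 1" by (simp add: fps_of_nat[symmetric])
  then have "cp ^ r * of_nat p ^ r = 1" by (metis power_mult_distrib power_one)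
  then show ?thesis by (simp add: power_add flip: mult.assoc)
qed

text \<open>The two bases agree modulo \<open>p\<close>, so their powers with exponent
  \<open>p ^ j\<close> agree modulo \<open>p ^ (j + 1)\<close>, which absorbs the denominator
  \<open>p ^ r\<close>.\<close>

lemma polyfun_divided:
  assumes f: "f \<in> polyfun" and r: "r \<le> Suc j"
  shows "\<exists>d\<in>polyfun. \<forall>w. cp ^ r * (f (\<lambda>i. w i ^ (p ^ g)) ^ (p ^ j) - (f w ^ (p ^ g)) ^ (p ^ j)) = d w"
proof -
  obtain s where s: "s \<in> polyfun" "\<And>w. f (\<lambda>i. w i ^ (p ^ g)) = f w ^ (p ^ g) + of_nat p * s w"
    using polyfun_frobenius[OF prime_p f] by blast
  obtain d where d: "d \<in> polyfun"
    "\<And>w. (f w ^ (p ^ g) + of_nat p * s w) ^ (p ^ j) = (f w ^ (p ^ g)) ^ (p ^ j) + of_nat p ^ Suc j * d w"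
    using polyfun_prime_power[OF prime_p polyfun_power[OF f] s(1)] by blast
  have *: "cp ^ r * of_nat p ^ Suc j = of_nat p ^ (Suc j - r)" using cp_p[of r "Suc j - r"] r by simp
  have "cp ^ r * (f (\<lambda>i. w i ^ (p ^ g)) ^ (p ^ j) - (f w ^ (p ^ g)) ^ (p ^ j)) = of_nat p ^ (Suc j - r) * d w" for w
    unfolding s d using * by (simp add: mult.assoc[symmetric] del: power_Suc)
  moreover have "(\<lambda>w. of_nat p ^ (Suc j - r) * d w) \<in> polyfun"
    using polyfun.mult[OF polyfun_of_nat[of "p ^ (Suc j - r)"] d(1)] by simp
  ultimately show ?thesis by (intro bexI[of _ "\<lambda>w. of_nat p ^ (Suc j - r) * d w"]) auto
qed

text \<open>Common shape of \<open>Lam1\<close> and \<open>Lam2\<close>, obtained with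
  \<open>g = h1\<close> or \<open>g = h2\<close> and suitably ordered arguments; the integrality
  step is then carried out once.\<close>

definition Lgen :: "nat \<Rightarrow> 'a fps \<Rightarrow> 'a fps \<Rightarrow> 'a fps" where
  "Lgen g A B = (b oo B) + cp * (b oo A ^ (p ^ g))"

definition Ltrunc :: "nat \<Rightarrow> nat \<Rightarrow> 'a fps \<Rightarrow> 'a fps \<Rightarrow> 'a fps" where
  "Ltrunc g N A B = (\<Sum>k<N. cp ^ (2 * k) * B ^ (q ^ k)) + cp * (\<Sum>k<N. cp ^ (2 * k) * (A ^ (p ^ g)) ^ (q ^ k))"

lemma Lam_Lgen: "Lam1 P Q = Lgen h1 Q P" "Lam2 P Q = Lgen h2 P Q"
  by (simp_all add: Lam1_def Lam2_def Lgen_def)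

lemma ordge_Lgen_diff:
  assumes "ordge n (A - A')" "ordge n (B - B')"
  shows "ordge n (Lgen g A B - Lgen g A' B')"
proof -
  have "Lgen g A B - Lgen g A' B' = ((b oo B) - (b oo B')) + cp * ((b oo A ^ (p ^ g)) - (b oo A' ^ (p ^ g)))"
    by (simp add: Lgen_def algebra_simps)
  then show ?thesis
    using assms by (auto intro!: ordge_add ordge_mult2 ordge_compose_diff ordge_power_diff')
qed

lemma pow_pos: "p ^ g > 0" "p ^ g \<ge> Suc 0" using p_ge_2 by auto

lemma ordge_Ltrunc:
  assumes "ordge m A" "ordge m B" "m > 0" "M \<le> m * q ^ N"
  shows "ordge M (Lgen g A B - Ltrunc g N A B)"
proof -
  have z: "A $ 0 = 0" "B $ 0 = 0" using assms(1-3) ordge_nthD by blast+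
  then have z': "(A ^ (p ^ g)) $ 0 = 0" by simp
  have "Lgen g A B - Ltrunc g N A B
    = cp ^ (2 * N) * (b oo B ^ (q ^ N)) + cp * (cp ^ (2 * N) * (b oo (A ^ (p ^ g)) ^ (q ^ N)))"
    unfolding Lgen_def Ltrunc_def beta_expand[OF z(2), of N] beta_expand[OF z', of N]
    by (simp add: algebra_simps)
  moreover have "ordge M (B ^ (q ^ N))" using assms by (intro ordge_power'[of m])
  moreover have "ordge M ((A ^ (p ^ g)) ^ (q ^ N))"
  proof (rule ordge_power'[of m])
    show "ordge m (A ^ p ^ g)" using assms pow_pos(2)[of g] by (intro ordge_power'[of m]) auto
  qed (use assms in auto)
  ultimately show ?thesis by (auto intro!: ordge_add ordge_mult2 ordge_compose)
qed

text \<open>With the outer \<open>cp\<close>, the \<open>k\<close>-th terms have denominators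
  \<open>p ^ (2 k + 1)\<close> and \<open>p ^ (2 k + 2)\<close>, against powers with exponents
  \<open>p ^ (h k)\<close> and \<open>p ^ (g + h k)\<close>. The bounds \<open>h \<ge> 2\<close> and
  \<open>g \<ge> 1\<close> are just what \<open>polyfun_divided\<close> needs.\<close>

lemma Ltrunc_polyfun:
  assumes f: "f1 \<in> polyfun" "f2 \<in> polyfun" and g: "g > 0"
  shows "\<exists>d\<in>polyfun. \<forall>w. cp * (Ltrunc g N (f1 (\<lambda>i. w i ^ (p ^ e))) (f2 (\<lambda>i. w i ^ (p ^ e)))
     - Ltrunc g N (f1 w ^ (p ^ e)) (f2 w ^ (p ^ e))) = d w"
proof -
  have h2: "h \<ge> 2" using h1_pos h2_pos by linarith
  have hk: "2 * k \<le> h * k" for k using h2 by (intro mult_le_mono1)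
  have "\<forall>k. \<exists>d\<in>polyfun. \<forall>w. cp ^ Suc (2 * k) * (f2 (\<lambda>i. w i ^ (p ^ e)) ^ (p ^ (h * k)) - (f2 w ^ (p ^ e)) ^ (p ^ (h * k))) = d w"
    using hk by (intro allI polyfun_divided f) auto
  then obtain D2 where D2: "\<And>k. D2 k \<in> polyfun"
    "\<And>k w. cp ^ Suc (2 * k) * (f2 (\<lambda>i. w i ^ (p ^ e)) ^ (p ^ (h * k)) - (f2 w ^ (p ^ e)) ^ (p ^ (h * k))) = D2 k w" by metis
  have "\<forall>k. \<exists>d\<in>polyfun. \<forall>w. cp ^ Suc (Suc (2 * k)) * (f1 (\<lambda>i. w i ^ (p ^ e)) ^ (p ^ (g + h * k)) - (f1 w ^ (p ^ e)) ^ (p ^ (g + h * k))) = d w"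
  proof (intro allI polyfun_divided f)
    fix k show "Suc (Suc (2 * k)) \<le> Suc (g + h * k)" using hk[of k] g by linarith
  qed
  then obtain D1 where D1: "\<And>k. D1 k \<in> polyfun"
    "\<And>k w. cp ^ Suc (Suc (2 * k)) * (f1 (\<lambda>i. w i ^ (p ^ e)) ^ (p ^ (g + h * k)) - (f1 w ^ (p ^ e)) ^ (p ^ (g + h * k))) = D1 k w" by metis
  have qk: "q ^ k = p ^ (h * k)" for k by (simp add: power_mult)
  have qgk: "(X ^ p ^ g) ^ (q ^ k) = X ^ (p ^ (g + h * k))" for k and X :: "'a fps"
    unfolding qk by (simp add: power_add flip: power_mult)
  have "cp * (Ltrunc g N (f1 (\<lambda>i. w i ^ (p ^ e))) (f2 (\<lambda>i. w i ^ (p ^ e)))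
     - Ltrunc g N (f1 w ^ (p ^ e)) (f2 w ^ (p ^ e))) = (\<Sum>k<N. D2 k w) + (\<Sum>k<N. D1 k w)" for w
  proof -
    define u1 u2 t1 t2 where "u1 = f1 (\<lambda>i. w i ^ (p ^ e))" and "u2 = f2 (\<lambda>i. w i ^ (p ^ e))"
      and "t1 = f1 w ^ (p ^ e)" and "t2 = f2 w ^ (p ^ e)"
    have "cp * (Ltrunc g N u1 u2 - Ltrunc g N t1 t2)
      = (\<Sum>k<N. cp ^ Suc (2 * k) * (u2 ^ (q ^ k) - t2 ^ (q ^ k)))
      + (\<Sum>k<N. cp ^ Suc (Suc (2 * k)) * ((u1 ^ p ^ g) ^ (q ^ k) - (t1 ^ p ^ g) ^ (q ^ k)))"
      unfolding Ltrunc_def by (simp add: right_diff_distrib distrib_left sum_distrib_left sum_subtractf mult.assoc del: fps_const_power)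
    also have "\<dots> = (\<Sum>k<N. D2 k w) + (\<Sum>k<N. D1 k w)"
    proof -
      have "(\<Sum>k<N. cp ^ Suc (2 * k) * (u2 ^ (q ^ k) - t2 ^ (q ^ k))) = (\<Sum>k<N. D2 k w)"
        unfolding qk u2_def t2_def D2 by (rule refl)
      moreover have "(\<Sum>k<N. cp ^ Suc (Suc (2 * k)) * ((u1 ^ p ^ g) ^ (q ^ k) - (t1 ^ p ^ g) ^ (q ^ k))) = (\<Sum>k<N. D1 k w)"
        unfolding qgk u1_def t1_def D1 by (rule refl)
      ultimately show ?thesis by simp
    qed
    finally show ?thesis unfolding u1_def u2_def t1_def t2_def .
  qed
  moreover have "(\<lambda>w. (\<Sum>k<N. D2 k w) + (\<Sum>k<N. D1 k w)) \<in> polyfun"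
    by (intro polyfun.add polyfun_sum D1 D2)
  ultimately show ?thesis by (intro bexI[of _ "\<lambda>w. (\<Sum>k<N. D2 k w) + (\<Sum>k<N. D1 k w)"]) auto
qed

text \<open>Agreement up to terms of degree at least \<^term>\<open>n\<close> in the variables. Quantifying over the order \<open>m\<close> of the
  arguments makes substitution of \<open>s\<close>-th powers for the variables multiply the precision by \<open>s\<close>.\<close>
definition approx :: "nat \<Rightarrow> ((nat \<Rightarrow> 'a fps) \<Rightarrow> 'a fps) \<Rightarrow> ((nat \<Rightarrow> 'a fps) \<Rightarrow> 'a fps) \<Rightarrow> bool" where
  "approx n A f \<longleftrightarrow> (\<forall>m>0. \<forall>w. (\<forall>i. ordge m (w i)) \<longrightarrow> ordge (m * n) (A w - f w))"

lemma approxD: "approx n A f \<Longrightarrow> m > 0 \<Longrightarrow> (\<And>i. ordge m (w i)) \<Longrightarrow> ordge (m * n) (A w - f w)"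
  by (simp add: approx_def)

text \<open>The induction step of Hazewinkel's argument. Replacing \<open>A\<close>,
  \<open>B\<close> by polynomials of precision \<open>n\<close> costs nothing below degree
  \<open>n + 1\<close>: powers of the variables multiply the precision by \<open>s \<ge> 2\<close>,
  and powers of the values gain \<open>m * (s - 1)\<close>. The remaining truncated expression is
  integral by \<open>Ltrunc_polyfun\<close>.\<close>

lemma approx_step:
  assumes A: "approx n A f1" "approx 1 A (\<lambda>_. 0)" and B: "approx n B f2" "approx 1 B (\<lambda>_. 0)"
    and f: "f1 \<in> polyfun" "f2 \<in> polyfun" and g: "g > 0" and e: "e > 0" and n: "n > 0"
  shows "\<exists>d\<in>polyfun. approx (Suc n) (\<lambda>w. cp * (Lgen g (A (\<lambda>i. w i ^ (p ^ e))) (B (\<lambda>i. w i ^ (p ^ e)))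
       - Lgen g (A w ^ (p ^ e)) (B w ^ (p ^ e)))) d"
proof -
  obtain d where d: "d \<in> polyfun" "\<And>w. cp * (Ltrunc g n (f1 (\<lambda>i. w i ^ (p ^ e))) (f2 (\<lambda>i. w i ^ (p ^ e)))
     - Ltrunc g n (f1 w ^ (p ^ e)) (f2 w ^ (p ^ e))) = d w"
    using Ltrunc_polyfun[OF f g] by blast
  define s where "s = p ^ e"
  have s: "s \<ge> 2" using self_le_power[of p e] p_ge_2 e by (simp add: s_def)
  have "approx (Suc n) (\<lambda>w. cp * (Lgen g (A (\<lambda>i. w i ^ s)) (B (\<lambda>i. w i ^ s)) - Lgen g (A w ^ s) (B w ^ s))) d"
    unfolding approx_def
  proof (intro allI impI)
    fix m and w :: "nat \<Rightarrow> 'a fps" assume m: "m > 0" and w: "\<forall>i. ordge m (w i)"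
    let ?M = "m * Suc n" and ?w = "\<lambda>i. w i ^ s"
    have ws: "ordge (m * s) (?w i)" for i using w by (simp add: ordge_power)
    have ms: "m * s > 0" using m s by simp
    have sn: "Suc n \<le> s * n" using s n mult_le_mono1[of 2 s n] by linarith
    have MM: "?M \<le> m * s * n" using mult_le_mono2[OF sn, of m] by (simp add: mult.assoc)
    have small: "ordge m (F w)" "ordge (m * s) (F ?w)" "ordge m (f w)" "ordge m (f ?w)"
      "ordge ?M (F ?w - f ?w)" "ordge ?M (F w ^ s - f w ^ s)" "ordge m (F w ^ s)" "ordge m (f w ^ s)" "ordge m (F ?w)"
      if F: "approx n F f" "approx 1 F (\<lambda>_. 0)" for F f
    proof -
      show 1: "ordge m (F w)" using approxD[OF F(2) m] w by simp
      show 2: "ordge (m * s) (F ?w)" using approxD[OF F(2) ms] ws by simp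
      have 3: "ordge (m * n) (F w - f w)" using approxD[OF F(1) m] w by simp
      then have "ordge m (F w - f w)" using n by (auto intro: ordge_mono)
      then show 4: "ordge m (f w)" using ordge_diff[OF 1, of "F w - f w"] by simp
      show 5: "ordge ?M (F ?w - f ?w)" by (rule ordge_mono[OF approxD[OF F(1) ms ws] MM])
      show 6: "ordge m (F ?w)" using 2 s by (auto intro: ordge_mono)
      have "ordge m (F ?w - f ?w)" using 5 by (auto intro: ordge_mono)
      then show "ordge m (f ?w)" using ordge_diff[OF 6, of "F ?w - f ?w"] by simp
      have big: "ordge (m * n + m * (s - 1)) (F w ^ s - f w ^ s)" using s by (intro ordge_power_diff 1 3 4) auto
      have "m * 1 \<le> m * (s - 1)" using s by (intro mult_le_mono2) simp
      then have "?M \<le> m * n + m * (s - 1)" by simp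
      then show "ordge ?M (F w ^ s - f w ^ s)" by (rule ordge_mono[OF big])
      show "ordge m (F w ^ s)" "ordge m (f w ^ s)" using 1 4 s by (auto intro!: ordge_power'[of m])
    qed
    note sA = small[OF A] and sB = small[OF B]
    have qn: "Suc n \<le> q ^ n"
    proof -
      have "n < 2 ^ n" by (rule less_exp)
      also have "\<dots> \<le> q ^ n" using q_ge(3) by (intro power_mono) auto
      finally show ?thesis by simp
    qed
    have Mq: "?M \<le> m * q ^ n" using mult_le_mono2[OF qn] by simp
    \<comment> \<open>Four errors are bounded: passing to the polynomials in both terms, and
      truncating both logarithms.\<close>
    have t1: "ordge ?M (Lgen g (A ?w) (B ?w) - Lgen g (f1 ?w) (f2 ?w))" using sA sB by (intro ordge_Lgen_diff)
    have t2: "ordge ?M (Lgen g (A w ^ s) (B w ^ s) - Lgen g (f1 w ^ s) (f2 w ^ s))" using sA sB by (intro ordge_Lgen_diff)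
    have t3: "ordge ?M (Lgen g (f1 ?w) (f2 ?w) - Ltrunc g n (f1 ?w) (f2 ?w))" using sA sB m Mq by (intro ordge_Ltrunc)
    have t4: "ordge ?M (Lgen g (f1 w ^ s) (f2 w ^ s) - Ltrunc g n (f1 w ^ s) (f2 w ^ s))" using sA sB m Mq by (intro ordge_Ltrunc)
    have "cp * (Lgen g (A ?w) (B ?w) - Lgen g (A w ^ s) (B w ^ s)) - d w
      = cp * (((Lgen g (A ?w) (B ?w) - Lgen g (f1 ?w) (f2 ?w)) - (Lgen g (A w ^ s) (B w ^ s) - Lgen g (f1 w ^ s) (f2 w ^ s)))
        + ((Lgen g (f1 ?w) (f2 ?w) - Ltrunc g n (f1 ?w) (f2 ?w)) - (Lgen g (f1 w ^ s) (f2 w ^ s) - Ltrunc g n (f1 w ^ s) (f2 w ^ s))))"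
      unfolding d(2)[symmetric] s_def[symmetric] by (simp add: algebra_simps)
    then show "ordge ?M (cp * (Lgen g (A ?w) (B ?w) - Lgen g (A w ^ s) (B w ^ s)) - d w)"
      using ordge_mult2[OF ordge_add[OF ordge_diff[OF t1 t2] ordge_diff[OF t3 t4]], of cp] by (simp only:)
  qed
  then show ?thesis using d(1) unfolding s_def by blast
qed

text \<open>The inverse satisfies \<open>H = P - cp * Lam(...)\<close> with powers of
  \<open>H\<close> of exponent at least two inside, so a known order is doubled in each round until
  it reaches \<open>m\<close>.\<close>

lemma ordge_Linv:
  assumes "ordge m P" "ordge m Q" "m > 0"
  shows "ordge m (Linv1 P Q)" "ordge m (Linv2 P Q)"
proof -
  define H1 H2 where "H1 = Linv1 P Q" and "H2 = Linv2 P Q"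
  have z: "P $ 0 = 0" "Q $ 0 = 0" using assms ordge_nthD by blast+
  have z': "H1 $ 0 = 0" "H2 $ 0 = 0" by (simp_all add: H1_def H2_def)
  have "H1 + cp * Lam1 (H2 ^ q1) (H1 ^ q2) = P" "H2 + cp * Lam2 (H2 ^ q1) (H1 ^ q2) = Q"
    using Lam_functional(1,2)[OF z'] Lam_Linv[OF z] unfolding H1_def H2_def by simp_all
  then have H: "H1 = P - cp * Lam1 (H2 ^ q1) (H1 ^ q2)" "H2 = Q - cp * Lam2 (H2 ^ q1) (H1 ^ q2)"
    by (simp_all add: eq_diff_eq)
  have "ordge (min m (Suc j)) H1 \<and> ordge (min m (Suc j)) H2" for j
  proof (induction j)
    case 0
    then show ?case using z' by (auto simp: ordge_def)
  next
    case (Suc j)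
    let ?k = "min m (Suc j)" and ?l = "min m (Suc (Suc j))"
    have l: "?l \<le> ?k * 2" using assms(3) by (cases "m \<le> Suc j") auto
    have "?l \<le> ?k * q1" "?l \<le> ?k * q2"
      using mult_le_mono2[OF q1_ge, of ?k] mult_le_mono2[OF q2_ge, of ?k] l by linarith+
    then have "ordge ?l (H2 ^ q1)" "ordge ?l (H1 ^ q2)" using Suc by (auto intro: ordge_power'[of ?k])
    then have "ordge ?l (cp * Lam1 (H2 ^ q1) (H1 ^ q2))" "ordge ?l (cp * Lam2 (H2 ^ q1) (H1 ^ q2))"
      by (auto intro!: ordge_mult2 ordge_Lam)
    moreover have "ordge ?l P" "ordge ?l Q" using assms by (auto intro: ordge_mono)
    ultimately have "ordge ?l (P - cp * Lam1 (H2 ^ q1) (H1 ^ q2))" "ordge ?l (Q - cp * Lam2 (H2 ^ q1) (H1 ^ q2))"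
      using ordge_diff by blast+
    then show ?case using H by metis
  qed
  from this[of m] show "ordge m (Linv1 P Q)" "ordge m (Linv2 P Q)" by (simp_all add: H1_def H2_def)
qed

text \<open>First coordinate of the formal difference. Subtraction yields inverses and sums as well,
  so a single operation has to be shown integral.\<close>

definition sub1 :: "'a fps \<Rightarrow> 'a fps \<Rightarrow> 'a fps \<Rightarrow> 'a fps \<Rightarrow> 'a fps" where
  "sub1 P Q P' Q' = Linv1 (Lam1 P Q - Lam1 P' Q') (Lam2 P Q - Lam2 P' Q')"

definition sub2 :: "'a fps \<Rightarrow> 'a fps \<Rightarrow> 'a fps \<Rightarrow> 'a fps \<Rightarrow> 'a fps" where
  "sub2 P Q P' Q' = Linv2 (Lam1 P Q - Lam1 P' Q') (Lam2 P Q - Lam2 P' Q')"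

lemma Lam_sub:
  "Lam1 (sub1 P Q P' Q') (sub2 P Q P' Q') = Lam1 P Q - Lam1 P' Q'"
  "Lam2 (sub1 P Q P' Q') (sub2 P Q P' Q') = Lam2 P Q - Lam2 P' Q'"
  by (simp_all add: sub1_def sub2_def Lam_Linv)

lemma sub_nth_0 [simp]: "sub1 P Q P' Q' $ 0 = 0" "sub2 P Q P' Q' $ 0 = 0"
  by (simp_all add: sub1_def sub2_def)

text \<open>The four coordinates are packed into a sequence to match the variables of
  \<open>polyfun\<close>.\<close>

definition G1 :: "(nat \<Rightarrow> 'a fps) \<Rightarrow> 'a fps" where "G1 w = sub1 (w 0) (w 1) (w 2) (w 3)"
definition G2 :: "(nat \<Rightarrow> 'a fps) \<Rightarrow> 'a fps" where "G2 w = sub2 (w 0) (w 1) (w 2) (w 3)"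

text \<open>Apply the second pair of \<open>Lam_functional\<close> to
  \<open>L(G) = L(X) - L(Y)\<close>. The logarithms of the powered arguments on the right combine to
  the logarithm of \<open>G\<close> at the powered variables.\<close>

lemma G_recursion:
  assumes "\<And>i. w i $ 0 = 0"
  shows "G1 w = w 0 - w 2 + cp * (Lgen h2 (G1 (\<lambda>i. w i ^ q1)) (G2 (\<lambda>i. w i ^ q1)) - Lgen h2 (G1 w ^ q1) (G2 w ^ q1))"
    "G2 w = w 1 - w 3 + cp * (Lgen h1 (G2 (\<lambda>i. w i ^ q2)) (G1 (\<lambda>i. w i ^ q2)) - Lgen h1 (G2 w ^ q2) (G1 w ^ q2))"
proof -
  have L: "Lam1 (G1 w) (G2 w) = Lam1 (w 0) (w 1) - Lam1 (w 2) (w 3)"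
    "Lam2 (G1 w) (G2 w) = Lam2 (w 0) (w 1) - Lam2 (w 2) (w 3)" for w
    by (simp_all add: G1_def G2_def Lam_sub)
  have z: "G1 w $ 0 = 0" "G2 w $ 0 = 0" by (simp_all add: G1_def G2_def)
  show "G1 w = w 0 - w 2 + cp * (Lgen h2 (G1 (\<lambda>i. w i ^ q1)) (G2 (\<lambda>i. w i ^ q1)) - Lgen h2 (G1 w ^ q1) (G2 w ^ q1))"
  proof -
    have "Lgen h2 (G1 (\<lambda>i. w i ^ q1)) (G2 (\<lambda>i. w i ^ q1)) = Lam2 (w 0 ^ q1) (w 1 ^ q1) - Lam2 (w 2 ^ q1) (w 3 ^ q1)"
      unfolding Lam_Lgen(2)[symmetric] L by (rule refl)
    moreover have "G1 w + cp * Lam2 (G1 w ^ q1) (G2 w ^ q1)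
      = (w 0 + cp * Lam2 (w 0 ^ q1) (w 1 ^ q1)) - (w 2 + cp * Lam2 (w 2 ^ q1) (w 3 ^ q1))"
      using L(1)[of w] Lam_functional(3)[OF z] Lam_functional(3)[of "w 0" "w 1"] Lam_functional(3)[of "w 2" "w 3"] assms
      by simp
    ultimately show ?thesis unfolding Lam_Lgen(2)[symmetric] by (simp only:) (simp add: algebra_simps)
  qed
  show "G2 w = w 1 - w 3 + cp * (Lgen h1 (G2 (\<lambda>i. w i ^ q2)) (G1 (\<lambda>i. w i ^ q2)) - Lgen h1 (G2 w ^ q2) (G1 w ^ q2))"
  proof -
    have "Lgen h1 (G2 (\<lambda>i. w i ^ q2)) (G1 (\<lambda>i. w i ^ q2)) = Lam1 (w 0 ^ q2) (w 1 ^ q2) - Lam1 (w 2 ^ q2) (w 3 ^ q2)"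
      unfolding Lam_Lgen(1)[symmetric] L by (rule refl)
    moreover have "G2 w + cp * Lam1 (G1 w ^ q2) (G2 w ^ q2)
      = (w 1 + cp * Lam1 (w 0 ^ q2) (w 1 ^ q2)) - (w 3 + cp * Lam1 (w 2 ^ q2) (w 3 ^ q2))"
      using L(2)[of w] Lam_functional(4)[OF z] Lam_functional(4)[of "w 0" "w 1"] Lam_functional(4)[of "w 2" "w 3"] assms
      by simp
    ultimately show ?thesis unfolding Lam_Lgen(1)[symmetric] by (simp only:) (simp add: algebra_simps)
  qed
qed

lemma approx_cong:
  assumes "approx n A f" "\<And>w. (\<And>i. w i $ 0 = 0) \<Longrightarrow> A' w = A w"
  shows "approx n A' f"
  unfolding approx_def
proof (intro allI impI)
  fix m and w :: "nat \<Rightarrow> 'a fps" assume m: "m > 0" "\<forall>i. ordge m (w i)"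
  then have "A' w = A w" using assms(2) ordge_nthD by blast
  then show "ordge (m * n) (A' w - f w)" using approxD[OF assms(1)] m by simp
qed

lemma approx_add_polyfun: "approx n A f \<Longrightarrow> approx n (\<lambda>w. g w + A w) (\<lambda>w. g w + f w)"
  by (simp add: approx_def)

text \<open>Integrality of formal subtraction, expressed by integer polynomials for each precision
  \<open>n\<close>, which avoids series in four variables. Each round of \<open>G_recursion\<close>
  gains one degree by \<open>approx_step\<close>.\<close>

lemma sub_integral:
  assumes "n > 0" shows "\<exists>f1\<in>polyfun. \<exists>f2\<in>polyfun. approx n G1 f1 \<and> approx n G2 f2"
proof -
  have one: "approx 1 G1 (\<lambda>_. 0)" "approx 1 G2 (\<lambda>_. 0)"
    unfolding approx_def G1_def G2_def sub1_def sub2_def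
    by (auto intro!: ordge_Linv ordge_diff ordge_Lam)
  have "\<exists>f1\<in>polyfun. \<exists>f2\<in>polyfun. approx (Suc n) G1 f1 \<and> approx (Suc n) G2 f2" for n
  proof (induction n)
    case 0
    have "(\<lambda>_. 0) \<in> polyfun" using polyfun.const[of 0] by simp
    then show ?case using one by auto
  next
    case (Suc n)
    then obtain f1 f2 where f: "f1 \<in> polyfun" "f2 \<in> polyfun" "approx (Suc n) G1 f1" "approx (Suc n) G2 f2" by blast
    obtain d1 where d1: "d1 \<in> polyfun" "approx (Suc (Suc n)) (\<lambda>w. cp * (Lgen h2 (G1 (\<lambda>i. w i ^ q1)) (G2 (\<lambda>i. w i ^ q1))
       - Lgen h2 (G1 w ^ q1) (G2 w ^ q1))) d1"
      using approx_step[OF f(3) one(1) f(4) one(2) f(1,2) h2_pos h1_pos] by blast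
    obtain d2 where d2: "d2 \<in> polyfun" "approx (Suc (Suc n)) (\<lambda>w. cp * (Lgen h1 (G2 (\<lambda>i. w i ^ q2)) (G1 (\<lambda>i. w i ^ q2))
       - Lgen h1 (G2 w ^ q2) (G1 w ^ q2))) d2"
      using approx_step[OF f(4) one(2) f(3) one(1) f(2,1) h1_pos h2_pos] by blast
    have "approx (Suc (Suc n)) G1 (\<lambda>w. (w 0 - w 2) + d1 w)"
      by (rule approx_cong[OF approx_add_polyfun[OF d1(2)]]) (rule G_recursion(1))
    moreover have "approx (Suc (Suc n)) G2 (\<lambda>w. (w 1 - w 3) + d2 w)"
      by (rule approx_cong[OF approx_add_polyfun[OF d2(2)]]) (rule G_recursion(2))
    moreover have "(\<lambda>w. (w 0 - w 2) + d1 w) \<in> polyfun" "(\<lambda>w. (w 1 - w 3) + d2 w) \<in> polyfun"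
      by (intro polyfun.add polyfun_diff polyfun.var d1 d2)+
    ultimately show ?case by blast
  qed
  from this[of "n - 1"] show ?thesis using assms by simp
qed

end

section \<open>Evaluation of convergent series\<close>

text \<open>The algebra \<open>A\<close> holds all coefficients of the series considered, so that
  their values at 1 exist and lie in \<open>A\<close>.\<close>

locale lt_alg = lubin_tate v p h1 h2 for v :: "'a::field_char_0 \<Rightarrow> real" and p h1 h2 :: nat +
  fixes A :: "'a set"
  assumes fin_A: "fin_alg A"
begin

lemmas AD = fin_algD[OF fin_A]

text \<open>The bound has no constant factor, so for \<open>r \<ge> 0\<close> the set is closed
  under products and integer polynomials; \<open>r < 1\<close> gives convergence at 1.\<close>

definition S :: "real \<Rightarrow> 'a fps set" where
  "S r = {P. \<forall>n. P $ n \<in> A \<and> v (P $ n) \<le> r ^ n}"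

lemma A_sum: "(\<And>i. i \<in> I \<Longrightarrow> f i \<in> A) \<Longrightarrow> sum f I \<in> A"
  by (induction I rule: infinite_finite_induct) (auto intro: AD)

lemma S_mono: "P \<in> S r \<Longrightarrow> 0 \<le> r \<Longrightarrow> r \<le> r' \<Longrightarrow> P \<in> S r'"
  using power_mono[of r r'] unfolding S_def by (auto intro: order_trans)

lemma S_add: "P \<in> S r \<Longrightarrow> Q \<in> S r \<Longrightarrow> P + Q \<in> S r"
  and S_diff: "P \<in> S r \<Longrightarrow> Q \<in> S r \<Longrightarrow> P - Q \<in> S r"
  by (auto simp: S_def intro: AD v_add_le v_diff_le)

lemma S_mult: assumes "0 \<le> r" "P \<in> S r" "Q \<in> S r" shows "P * Q \<in> S r"
  unfolding S_def
proof (clarify, rule conjI)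
  fix n
  show "(P * Q) $ n \<in> A" unfolding fps_mult_nth using assms by (intro A_sum AD(5)) (auto simp: S_def)
  have "v (P $ i * Q $ (n - i)) \<le> r ^ n" if "i \<in> {0..n}" for i
  proof -
    have "v (P $ i) * v (Q $ (n - i)) \<le> r ^ i * r ^ (n - i)" using assms by (intro mult_mono) (auto simp: S_def)
    then show ?thesis using that by (simp add: v_mult flip: power_add)
  qed
  then show "v ((P * Q) $ n) \<le> r ^ n" unfolding fps_mult_nth using assms by (intro v_sum_le) auto
qed

lemma S_of_int: "0 \<le> r \<Longrightarrow> of_int c \<in> S r"
  using AD(1) AD(6)[of "of_int c"] v_of_int_le[of c] by (auto simp: S_def fps_of_int[symmetric])

lemma S_const_mult: assumes "c \<in> A" "v c \<le> 1" "P \<in> S r" shows "fps_const c * P \<in> S r"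
proof -
  have "v c * v (P $ n) \<le> r ^ n" for n
  proof -
    have "v c * v (P $ n) \<le> 1 * v (P $ n)" using assms by (intro mult_right_mono) auto
    then show ?thesis using assms(3) unfolding S_def by (auto intro: order_trans)
  qed
  then show ?thesis using assms by (auto simp: S_def v_mult intro: AD)
qed

lemma S_power: "0 \<le> r \<Longrightarrow> P \<in> S r \<Longrightarrow> P ^ n \<in> S r"
  by (induction n) (use S_of_int[of r 1] S_mult in auto)

lemma S_polyfun: "f \<in> polyfun \<Longrightarrow> 0 \<le> r \<Longrightarrow> (\<And>i. w i \<in> S r) \<Longrightarrow> f w \<in> S r"
  by (induction rule: polyfun.induct) (auto intro: S_of_int S_add S_mult)

definition psum :: "'a fps \<Rightarrow> nat \<Rightarrow> 'a" where "psum P N = (\<Sum>n<N. P $ n)"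

definition ev :: "'a fps \<Rightarrow> 'a" where "ev P = (THE s. conv_to v (psum P) s)"

lemma ev_eqI: "conv_to v (psum P) s \<Longrightarrow> ev P = s"
  unfolding ev_def using conv_to_unique by blast

context
  fixes r :: real
  assumes r: "0 < r" "r < 1"
begin

lemma r_tendsto: "(\<lambda>n. r ^ n) \<longlonglongrightarrow> 0"
  using r by (intro LIMSEQ_realpow_zero) auto

lemma ev_conv: assumes "P \<in> S r" shows "conv_to v (psum P) (ev P)" "ev P \<in> A"
proof -
  have "cauchy_v v (psum P)"
    by (rule cauchy_v_of_consecutive[OF _ r_tendsto]) (use assms in \<open>auto simp: psum_def S_def\<close>)
  moreover have "psum P n \<in> A" for n
    unfolding psum_def using assms by (intro A_sum) (auto simp: S_def)
  ultimately obtain s where s: "s \<in> A" "conv_to v (psum P) s"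
    using fin_alg_complete[OF fin_A] unfolding v_complete_def by blast
  then show "conv_to v (psum P) (ev P)" "ev P \<in> A" using ev_eqI by auto
qed

lemma ev_tail: assumes "P \<in> S r" shows "v (ev P - psum P N) \<le> r ^ N"
proof (rule conv_to_le)
  show "conv_to v (\<lambda>n. psum P n - psum P N) (ev P - psum P N)"
    using ev_conv(1)[OF assms] by (intro conv_to_diff) auto
  fix n assume n: "n \<ge> N"
  have "psum P n - psum P N = (\<Sum>i\<in>{N..<n}. P $ i)"
    unfolding psum_def using n by (simp add: sum_diff_nat_ivl[of 0 N n, symmetric] lessThan_atLeast0)
  moreover have "v (P $ i) \<le> r ^ N" if "i \<in> {N..<n}" for i
  proof -
    have "r ^ i \<le> r ^ N" using r that by (intro power_decreasing) auto
    then show ?thesis using assms unfolding S_def by (auto intro: order_trans)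
  qed
  ultimately show "v (psum P n - psum P N) \<le> r ^ N" using r by (simp only:) (intro v_sum_le, auto)
qed

lemma ev_ordge: "P \<in> S r \<Longrightarrow> ordge N P \<Longrightarrow> v (ev P) \<le> r ^ N"
  using ev_tail[of P N] by (simp add: psum_def ordge_def)

lemma ev_add: "P \<in> S r \<Longrightarrow> Q \<in> S r \<Longrightarrow> ev (P + Q) = ev P + ev Q"
  using conv_to_add[OF ev_conv(1) ev_conv(1), of P Q]
  by (intro ev_eqI) (simp add: psum_def[abs_def] sum.distrib)

lemma ev_cmult: "P \<in> S r \<Longrightarrow> ev (fps_const c * P) = c * ev P"
  using conv_to_cmult[OF ev_conv(1), of P c]
  by (intro ev_eqI) (simp add: psum_def[abs_def] sum_distrib_left)

lemma ev_diff: "P \<in> S r \<Longrightarrow> Q \<in> S r \<Longrightarrow> ev (P - Q) = ev P - ev Q"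
  using conv_to_diff[OF ev_conv(1) ev_conv(1), of P Q]
  by (intro ev_eqI) (simp add: psum_def[abs_def] sum_subtractf)

text \<open>The product of the partial sums differs from the partial sum of the product only by
  terms with \<open>i + j \<ge> N\<close>, each of size at most \<open>r ^ N\<close>.\<close>

lemma ev_mult: assumes "P \<in> S r" "Q \<in> S r" shows "ev (P * Q) = ev P * ev Q"
proof (rule ev_eqI)
  have c: "conv_to v (\<lambda>N. psum P N * psum Q N) (ev P * ev Q)"
    using assms by (intro conv_to_mult ev_conv)
  have "v (psum (P * Q) N - psum P N * psum Q N) \<le> r ^ N" for N
  proof -
    let ?T = "{(i,j). i + j < N}" and ?B = "{..<N} \<times> {..<N}"
    have fB: "finite ?B" by simp
    have TB: "?T \<subseteq> ?B" by auto
    have "psum (P * Q) N = (\<Sum>n<N. \<Sum>i\<le>n. P $ i * Q $ (n - i))"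
      by (simp add: psum_def fps_mult_nth atMost_atLeast0)
    also have "\<dots> = (\<Sum>(i,j)\<in>?T. P $ i * Q $ j)" by (rule sum.triangle_reindex[symmetric])
    finally have 1: "psum (P * Q) N = (\<Sum>(i,j)\<in>?T. P $ i * Q $ j)" .
    have 2: "psum P N * psum Q N = (\<Sum>(i,j)\<in>?B. P $ i * Q $ j)"
      by (simp add: psum_def sum_product sum.cartesian_product)
    have "psum P N * psum Q N - psum (P * Q) N = (\<Sum>(i,j)\<in>?B - ?T. P $ i * Q $ j)"
      unfolding 1 2 by (subst sum_diff[OF fB TB]) simp
    moreover have "v (\<Sum>(i,j)\<in>?B - ?T. P $ i * Q $ j) \<le> r ^ N"
    proof (rule v_sum_le)
      fix x assume "x \<in> ?B - ?T"
      then obtain i j where x: "x = (i,j)" "i + j \<ge> N" by auto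
      have "v (P $ i) * v (Q $ j) \<le> r ^ i * r ^ j" using assms r by (intro mult_mono) (auto simp: S_def)
      also have "\<dots> \<le> r ^ N" using r x by (simp add: power_decreasing flip: power_add)
      finally show "v (case x of (i,j) \<Rightarrow> P $ i * Q $ j) \<le> r ^ N" using x by (simp add: v_mult)
    qed (use r in simp)
    ultimately show ?thesis by (simp add: v_diff_commute[of "psum (P * Q) N"])
  qed
  then have "conv_to v (\<lambda>N. psum (P * Q) N - psum P N * psum Q N) 0"
    by (intro conv_to_bound[OF r_tendsto]) simp
  from conv_to_add[OF this c] show "conv_to v (psum (P * Q)) (ev P * ev Q)" by simp
qed

lemma ev_power: "P \<in> S r \<Longrightarrow> n > 0 \<Longrightarrow> ev (P ^ n) = ev P ^ n"
proof (induction n)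
  case (Suc n)
  show ?case
  proof (cases "n = 0")
    case False
    then show ?thesis using Suc ev_mult[of P "P ^ n"] S_power[of r P n] r by simp
  qed simp
qed simp

lemma ev_polyfun_cong:
  "f \<in> polyfun \<Longrightarrow> (\<And>i. w i \<in> S r) \<Longrightarrow> (\<And>i. w' i \<in> S r) \<Longrightarrow> (\<And>i. ev (w i) = ev (w' i)) \<Longrightarrow> ev (f w) = ev (f w')"
proof (induction rule: polyfun.induct)
  case (add f g)
  then show ?case using r S_polyfun[of f r] S_polyfun[of g r] by (simp add: ev_add)
next
  case (mult f g)
  then show ?case using r S_polyfun[of f r] S_polyfun[of g r] by (simp add: ev_mult)
qed auto

text \<open>A single coefficient of the formal difference coincides with that of an integer
  polynomial in the arguments, and integer polynomials preserve \<open>S r\<close>.\<close>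

lemma G_S:
  assumes w: "\<And>i. w i \<in> S r" "\<And>i. w i $ 0 = 0"
  shows "G1 w \<in> S r" "G2 w \<in> S r"
proof -
  have w1: "ordge 1 (w i)" for i using w(2) by (simp add: ordge_1_iff)
  have "G1 w $ n \<in> A \<and> v (G1 w $ n) \<le> r ^ n \<and> G2 w $ n \<in> A \<and> v (G2 w $ n) \<le> r ^ n" for n
  proof -
    obtain f1 f2 where f: "f1 \<in> polyfun" "f2 \<in> polyfun" "approx (Suc n) G1 f1" "approx (Suc n) G2 f2"
      using sub_integral[of "Suc n"] by blast
    have "ordge (Suc n) (G1 w - f1 w)" "ordge (Suc n) (G2 w - f2 w)"
      using approxD[OF f(3) _ w1] approxD[OF f(4) _ w1] by auto
    then have "G1 w $ n = f1 w $ n" "G2 w $ n = f2 w $ n" by (auto dest!: ordge_nthD[of _ _ n])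
    moreover have "f1 w \<in> S r" "f2 w \<in> S r" using f r w by (auto intro: S_polyfun)
    ultimately show ?thesis by (auto simp: S_def)
  qed
  then show "G1 w \<in> S r" "G2 w \<in> S r" by (auto simp: S_def)
qed

text \<open>Makes formal subtraction well defined on values. Integer polynomials respect equality of
  values, and approximate \<open>G1\<close> and \<open>G2\<close> up to \<open>r ^ (n + 1)\<close>
  for every \<open>n\<close>.\<close>

lemma ev_G_cong:
  assumes w: "\<And>i. w i \<in> S r" "\<And>i. w i $ 0 = 0" and w': "\<And>i. w' i \<in> S r" "\<And>i. w' i $ 0 = 0"
    and eq: "\<And>i. ev (w i) = ev (w' i)"
  shows "ev (G1 w) = ev (G1 w')" "ev (G2 w) = ev (G2 w')"
proof -
  have o: "ordge 1 (w i)" "ordge 1 (w' i)" for i using w(2) w'(2) by (auto simp: ordge_1_iff)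
  have "v (ev (G1 w) - ev (G1 w')) \<le> r ^ Suc n \<and> v (ev (G2 w) - ev (G2 w')) \<le> r ^ Suc n" for n
  proof -
    obtain f1 f2 where f: "f1 \<in> polyfun" "f2 \<in> polyfun" "approx (Suc n) G1 f1" "approx (Suc n) G2 f2"
      using sub_integral[of "Suc n"] by blast
    have *: "v (ev (F w) - ev (F w')) \<le> r ^ Suc n"
      if "f \<in> polyfun" "approx (Suc n) F f" "F w \<in> S r" "F w' \<in> S r" for F f
    proof -
      have fS: "f w \<in> S r" "f w' \<in> S r" using that r w w' by (auto intro: S_polyfun)
      have "ordge (Suc n) (F w - f w)" "ordge (Suc n) (F w' - f w')"
        using approxD[OF that(2), of 1] o by auto
      then have "v (ev (F w - f w)) \<le> r ^ Suc n" "v (ev (F w' - f w')) \<le> r ^ Suc n"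
        using that fS by (auto intro!: ev_ordge S_diff simp del: power_Suc)
      then have "v ((ev (F w) - ev (f w)) - (ev (F w') - ev (f w'))) \<le> r ^ Suc n"
        using that fS by (intro v_diff_le[of "ev (F w) - ev (f w)"]) (simp_all add: ev_diff del: power_Suc)
      moreover have "ev (f w) = ev (f w')" by (rule ev_polyfun_cong[OF that(1) w(1) w'(1) eq])
      ultimately show ?thesis by simp
    qed
    show ?thesis by (intro conjI *[OF f(1,3)] *[OF f(2,4)] G_S w w')
  qed
  note close = this
  have zero: "x = 0" if "\<And>n. v x \<le> r ^ Suc n" for x
  proof -
    have "v x \<le> 0"
      by (rule LIMSEQ_le_const[OF LIMSEQ_Suc[OF r_tendsto]]) (use that in auto)
    then show ?thesis using v_nonneg[of x] v_eq_0[of x] by linarith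
  qed
  show "ev (G1 w) = ev (G1 w')" "ev (G2 w) = ev (G2 w')"
    using zero[of "ev (G1 w) - ev (G1 w')"] zero[of "ev (G2 w) - ev (G2 w')"] close by simp_all
qed

end

section \<open>Formal points and the group of their logarithms\<close>

definition SS :: "'a fps set" where
  "SS = {P. P $ 0 = 0 \<and> (\<exists>r. 0 < r \<and> r < 1 \<and> P \<in> S r)}"

lemma SS_nth_0: "P \<in> SS \<Longrightarrow> P $ 0 = 0" by (simp add: SS_def)

lemma SS_I: "P \<in> S r \<Longrightarrow> 0 < r \<Longrightarrow> r < 1 \<Longrightarrow> P $ 0 = 0 \<Longrightarrow> P \<in> SS" by (auto simp: SS_def)

text \<open>Four is the number of series in one formal subtraction; the largest of their radii
  serves all of them.\<close>

lemma SS_common: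
  assumes "P \<in> SS" "Q \<in> SS" "P' \<in> SS" "Q' \<in> SS"
  obtains r where "0 < r" "r < 1" "P \<in> S r" "Q \<in> S r" "P' \<in> S r" "Q' \<in> S r"
proof -
  obtain r1 r2 r3 r4 where r: "0 < r1" "r1 < 1" "P \<in> S r1" "0 < r2" "r2 < 1" "Q \<in> S r2"
    "0 < r3" "r3 < 1" "P' \<in> S r3" "0 < r4" "r4 < 1" "Q' \<in> S r4" using assms by (auto simp: SS_def)
  define r where "r = max (max r1 r2) (max r3 r4)"
  show thesis by (rule that[of r]) (use r in \<open>auto simp: r_def intro: S_mono\<close>)
qed

lemma zero_SS [simp]: "0 \<in> SS" and zero_S: "0 < r \<Longrightarrow> 0 \<in> S r"
  using AD by (auto simp: SS_def S_def intro!: exI[of _ "1/2"])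

definition vec :: "'a fps \<Rightarrow> 'a fps \<Rightarrow> 'a fps \<Rightarrow> 'a fps \<Rightarrow> nat \<Rightarrow> 'a fps" where
  "vec P Q P' Q' i = (if i = 0 then P else if i = 1 then Q else if i = 2 then P' else Q')"

lemma G_vec: "G1 (vec P Q P' Q') = sub1 P Q P' Q'" "G2 (vec P Q P' Q') = sub2 P Q P' Q'"
  by (simp_all add: G1_def G2_def vec_def)

lemma sub_S:
  assumes "0 < r" "r < 1" "P \<in> S r" "Q \<in> S r" "P' \<in> S r" "Q' \<in> S r"
    "P $ 0 = 0" "Q $ 0 = 0" "P' $ 0 = 0" "Q' $ 0 = 0"
  shows "sub1 P Q P' Q' \<in> S r" "sub2 P Q P' Q' \<in> S r"
  using G_S[OF assms(1,2), of "vec P Q P' Q'"] assms unfolding G_vec by (auto simp: vec_def)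

lemma sub_SS:
  assumes "P \<in> SS" "Q \<in> SS" "P' \<in> SS" "Q' \<in> SS"
  shows "sub1 P Q P' Q' \<in> SS" "sub2 P Q P' Q' \<in> SS"
proof -
  obtain r where r: "0 < r" "r < 1" "P \<in> S r" "Q \<in> S r" "P' \<in> S r" "Q' \<in> S r"
    using SS_common[OF assms] by blast
  then show "sub1 P Q P' Q' \<in> SS" "sub2 P Q P' Q' \<in> SS"
    using sub_S[OF r] assms by (auto simp: SS_def)
qed

lemma ev_sub_cong:
  assumes "P \<in> SS" "Q \<in> SS" "P' \<in> SS" "Q' \<in> SS" "R \<in> SS" "T \<in> SS" "R' \<in> SS" "T' \<in> SS"
    "ev P = ev R" "ev Q = ev T" "ev P' = ev R'" "ev Q' = ev T'"
  shows "ev (sub1 P Q P' Q') = ev (sub1 R T R' T')" "ev (sub2 P Q P' Q') = ev (sub2 R T R' T')"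
proof -
  obtain r1 where r1: "0 < r1" "r1 < 1" "P \<in> S r1" "Q \<in> S r1" "P' \<in> S r1" "Q' \<in> S r1"
    using SS_common[OF assms(1-4)] by blast
  obtain r2 where r2: "0 < r2" "r2 < 1" "R \<in> S r2" "T \<in> S r2" "R' \<in> S r2" "T' \<in> S r2"
    using SS_common[OF assms(5-8)] by blast
  define r where "r = max r1 r2"
  have r: "0 < r" "r < 1" using r1 r2 by (auto simp: r_def)
  have "P \<in> S r" "Q \<in> S r" "P' \<in> S r" "Q' \<in> S r" "R \<in> S r" "T \<in> S r" "R' \<in> S r" "T' \<in> S r"
    using r1 r2 by (auto simp: r_def intro: S_mono)
  then show "ev (sub1 P Q P' Q') = ev (sub1 R T R' T')" "ev (sub2 P Q P' Q') = ev (sub2 R T R' T')"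
    unfolding G_vec[symmetric] using assms
    by (intro ev_G_cong[OF r]; auto simp: vec_def SS_nth_0)+
qed

definition nul :: "'a fps \<Rightarrow> 'a fps \<Rightarrow> bool" where
  "nul x y \<longleftrightarrow> (\<exists>P Q. P \<in> SS \<and> Q \<in> SS \<and> ev P = 0 \<and> ev Q = 0 \<and> x = Lam1 P Q \<and> y = Lam2 P Q)"

definition logs :: "'a fps \<Rightarrow> 'a fps \<Rightarrow> bool" where
  "logs x y \<longleftrightarrow> (\<exists>P Q. P \<in> SS \<and> Q \<in> SS \<and> x = Lam1 P Q \<and> y = Lam2 P Q)"

lemma ev_0 [simp]: "ev 0 = 0"
  by (rule ev_eqI) (simp add: psum_def[abs_def])

lemma sub_self: "sub1 P Q P Q = 0" "sub2 P Q P Q = 0"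
  using Linv_Lam[of 0 0] by (simp_all add: sub1_def sub2_def)

lemma logs_Lam: "P \<in> SS \<Longrightarrow> Q \<in> SS \<Longrightarrow> logs (Lam1 P Q) (Lam2 P Q)"
  by (auto simp: logs_def)

lemma logs_diff: "logs x y \<Longrightarrow> logs x' y' \<Longrightarrow> logs (x - x') (y - y')"
  unfolding logs_def using sub_SS Lam_sub by metis

lemma nul_0 [simp]: "nul 0 0"
  unfolding nul_def by (rule exI[of _ 0], rule exI[of _ 0]) simp

lemma nul_imp_logs: "nul x y \<Longrightarrow> logs x y"
  by (auto simp: nul_def logs_def)

lemma nul_diff: assumes "nul x y" "nul x' y'" shows "nul (x - x') (y - y')"
proof -
  obtain P Q P' Q' where *: "P \<in> SS" "Q \<in> SS" "ev P = 0" "ev Q = 0" "x = Lam1 P Q" "y = Lam2 P Q"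
    "P' \<in> SS" "Q' \<in> SS" "ev P' = 0" "ev Q' = 0" "x' = Lam1 P' Q'" "y' = Lam2 P' Q'"
    using assms unfolding nul_def by blast
  have "ev (sub1 P Q P' Q') = ev (sub1 0 0 0 0)" "ev (sub2 P Q P' Q') = ev (sub2 0 0 0 0)"
    using * by (intro ev_sub_cong; simp)+
  then have "ev (sub1 P Q P' Q') = 0" "ev (sub2 P Q P' Q') = 0" by (simp_all add: sub_self)
  then show ?thesis unfolding nul_def using * sub_SS[of P Q P' Q'] Lam_sub[of P Q P' Q'] by metis
qed

lemma nul_minus: "nul x y \<Longrightarrow> nul (- x) (- y)"
  using nul_diff[OF nul_0] by fastforce

lemma nul_add: "nul x y \<Longrightarrow> nul x' y' \<Longrightarrow> nul (x + x') (y + y')"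
  using nul_diff[OF _ nul_minus, of x y x' y'] by simp

lemma nul_of_nat: "nul x y \<Longrightarrow> nul (of_nat n * x) (of_nat n * y)"
proof (induction n)
  case (Suc n)
  then show ?case using nul_add[of x y "of_nat n * x" "of_nat n * y"] by (simp add: algebra_simps)
qed simp

text \<open>Both directions come from \<open>ev_sub_cong\<close>: formal subtraction of points with
  equal values gives value zero, and adding a formal point of value zero does not change
  values.\<close>

lemma nul_Lam_iff:
  assumes "P \<in> SS" "Q \<in> SS" "P' \<in> SS" "Q' \<in> SS"
  shows "nul (Lam1 P Q - Lam1 P' Q') (Lam2 P Q - Lam2 P' Q') \<longleftrightarrow> ev P = ev P' \<and> ev Q = ev Q'"
proof
  assume "ev P = ev P' \<and> ev Q = ev Q'"
  then have "ev (sub1 P Q P' Q') = ev (sub1 P Q P Q)" "ev (sub2 P Q P' Q') = ev (sub2 P Q P Q)"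
    using assms by (intro ev_sub_cong; simp)+
  then have "ev (sub1 P Q P' Q') = 0" "ev (sub2 P Q P' Q') = 0" by (simp_all add: sub_self)
  then show "nul (Lam1 P Q - Lam1 P' Q') (Lam2 P Q - Lam2 P' Q')"
    unfolding nul_def using assms sub_SS[of P Q P' Q'] Lam_sub[of P Q P' Q'] by metis
next
  assume "nul (Lam1 P Q - Lam1 P' Q') (Lam2 P Q - Lam2 P' Q')"
  then obtain R T where R: "R \<in> SS" "T \<in> SS" "ev R = 0" "ev T = 0"
    "Lam1 P Q - Lam1 P' Q' = Lam1 R T" "Lam2 P Q - Lam2 P' Q' = Lam2 R T" unfolding nul_def by metis
  \<comment> \<open>The formal inverse of the second point; subtracting it expresses addition, so
    \<open>P\<close>, \<open>Q\<close> is the sum of \<open>R\<close>, \<open>T\<close> and the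
    second point.\<close>
  define M N where "M = sub1 0 0 P' Q'" and "N = sub2 0 0 P' Q'"
  have MN: "M \<in> SS" "N \<in> SS" using assms by (auto simp: M_def N_def intro: sub_SS)
  have LM: "Lam1 M N = - Lam1 P' Q'" "Lam2 M N = - Lam2 P' Q'" by (simp_all add: M_def N_def Lam_sub)
  have "sub1 R T M N = P" "sub2 R T M N = Q" "sub1 0 0 M N = P'" "sub2 0 0 M N = Q'"
    unfolding sub1_def sub2_def LM R(5,6)[symmetric] using assms SS_nth_0 by (simp_all add: Linv_Lam)
  moreover have "ev (sub1 R T M N) = ev (sub1 0 0 M N)" "ev (sub2 R T M N) = ev (sub2 0 0 M N)"
    using R MN by (intro ev_sub_cong; simp)+
  ultimately show "ev P = ev P' \<and> ev Q = ev Q'" by simp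
qed

lemma nul_Lam_iff_0: "P \<in> SS \<Longrightarrow> Q \<in> SS \<Longrightarrow> nul (Lam1 P Q) (Lam2 P Q) \<longleftrightarrow> ev P = 0 \<and> ev Q = 0"
  using nul_Lam_iff[of P Q 0 0] by simp

end

section \<open>Points killed by p\<close>

context nonarch
begin

definition unit1 :: "'a \<Rightarrow> bool" where "unit1 w \<longleftrightarrow> v (w - 1) < 1"

lemma unit1_v: "unit1 w \<Longrightarrow> v w = 1"
  using v_eq_of_close[of w 1] by (simp add: unit1_def)

lemma unit1_nonzero: "unit1 w \<Longrightarrow> w \<noteq> 0"
  using unit1_v by force

lemma unit1_mult: assumes "unit1 w" "unit1 w'" shows "unit1 (w * w')"
proof -
  have "v ((w - 1) * w' + (w' - 1)) < 1"
    using assms unit1_v[OF assms(2)] by (intro v_add_less) (auto simp: unit1_def v_mult)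
  then show ?thesis by (simp add: unit1_def algebra_simps)
qed

lemma unit1_1: "unit1 1" by (simp add: unit1_def)

lemma unit1_power: "unit1 w \<Longrightarrow> unit1 (w ^ n)"
  by (induction n) (auto simp: unit1_1 intro: unit1_mult)

lemma unit1_inverse: assumes "unit1 w" shows "unit1 (inverse w)"
proof -
  have "inverse w - 1 = (1 - w) * inverse w" using unit1_nonzero[OF assms] by (simp add: algebra_simps)
  then have "v (inverse w - 1) = v (1 - w) * v (inverse w)" by (simp only: v_mult)
  then show ?thesis using assms unit1_v[OF assms] by (simp add: unit1_def v_inverse v_diff_commute[of 1])
qed

end

context padic
begin

text \<open>Shows that \<open>x ^ N / p\<close> is dominated by \<open>y ^ s\<close> in the
  companion equation. Here \<open>eq\<close> bounds \<open>X ^ t\<close> by the larger of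
  \<open>Y / p\<close> and \<open>p * Y ^ N\<close>, and the \<open>s\<close>-th power bounds
  \<open>X ^ N\<close>. The first case uses \<open>s \<ge> 2\<close>; in the second,
  \<open>Y ^ s < 1 / p\<close> and \<open>N - 1 \<ge> s + 1\<close> beat
  \<open>p ^ (s + 1)\<close>.\<close>

lemma kernel_estimate:
  assumes s: "s \<ge> 2" and t: "t \<ge> 2" and N: "N = s * t"
    and eq: "x ^ t * (1 + b1) + y ^ N * (1 + b2) / of_nat p = - of_nat p * y"
    and b: "v b1 < 1" "v b2 < 1" and small: "v (y ^ s) < 1 / real p" and y: "y \<noteq> 0"
  shows "v (x ^ N / of_nat p) < v (y ^ s)"
proof -
  define Y X where "Y = v y" and "X = v x"
  have Y0: "Y > 0" using y v_pos by (simp add: Y_def)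
  have X0: "X \<ge> 0" by (simp add: X_def)
  have pr: "real p > 1" by simp
  have u1: "v (1 + b1) = 1" using b v_add_eq[of b1 1] by (simp add: add.commute)
  have u2: "v (1 + b2) = 1" using b v_add_eq[of b2 1] by (simp add: add.commute)
  have "x ^ t * (1 + b1) = - of_nat p * y - y ^ N * (1 + b2) / of_nat p" using eq by (simp add: eq_diff_eq)
  then have "v (x ^ t * (1 + b1)) \<le> max (v (- of_nat p * y)) (v (y ^ N * (1 + b2) / of_nat p))"
    using v_diff by metis
  then have "X ^ t \<le> max (Y / real p) (real p * Y ^ N)"
    by (simp add: v_mult v_power v_divide u1 u2 v_p X_def Y_def mult.commute)
  then have "(X ^ t) ^ s \<le> max (Y / real p) (real p * Y ^ N) ^ s" using X0 by (intro power_mono) auto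
  then have XN: "X ^ N \<le> max ((Y / real p) ^ s) ((real p * Y ^ N) ^ s)"
    by (auto simp: N max_def mult.commute simp flip: power_mult split: if_splits)
  have ps: "real p < real p ^ s" using power_strict_increasing[of 1 s "real p"] s pr by simp
  have 1: "real p * (Y / real p) ^ s < Y ^ s"
  proof -
    have "real p * (Y / real p) ^ s = Y ^ s * (real p / real p ^ s)" by (simp add: power_divide)
    also have "\<dots> < Y ^ s * 1" using ps Y0 by (intro mult_strict_left_mono) auto
    finally show ?thesis by simp
  qed
  have 2: "real p * (real p * Y ^ N) ^ s < Y ^ s"
  proof -
    have sm: "Y ^ s < 1 / real p" using small by (simp add: v_power Y_def)
    have "s * 2 \<le> N" unfolding N using t by (intro mult_le_mono2)
    then have Ns: "s + 2 \<le> N" using s by linarith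
    have strict: "(Y ^ s) ^ (N - 1) < 1 / real p ^ (s + 1)"
    proof -
      have "(Y ^ s) ^ (N - 1) < (1 / real p) ^ (N - 1)" using sm Y0 Ns by (intro power_strict_mono) auto
      also have "\<dots> \<le> (1 / real p) ^ (s + 1)" using Ns pr by (intro power_decreasing) auto
      finally show ?thesis by (simp add: power_one_over)
    qed
    have "real p * (real p * Y ^ N) ^ s = real p ^ (s + 1) * (Y ^ s) ^ N"
      by (simp add: power_mult_distrib mult.commute flip: power_mult)
    also have "(Y ^ s) ^ N = Y ^ s * (Y ^ s) ^ (N - 1)" using Ns by (simp flip: power_Suc)
    also have "real p ^ (s + 1) * (Y ^ s * (Y ^ s) ^ (N - 1)) = Y ^ s * (real p ^ (s + 1) * (Y ^ s) ^ (N - 1))"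
      by (simp add: mult_ac)
    also have "\<dots> < Y ^ s * 1"
    proof (rule mult_strict_left_mono)
      show "real p ^ (s + 1) * (Y ^ s) ^ (N - 1) < 1" using strict pr by (simp add: field_simps)
    qed (use Y0 in simp)
    finally show ?thesis by simp
  qed
  have "real p * X ^ N < Y ^ s"
  proof (cases "X ^ N \<le> (Y / real p) ^ s")
    case True
    then have "real p * X ^ N \<le> real p * (Y / real p) ^ s" using pr by (intro mult_left_mono) auto
    then show ?thesis using 1 by linarith
  next
    case False
    then have "X ^ N \<le> (real p * Y ^ N) ^ s" using XN by auto
    then have "real p * X ^ N \<le> real p * (real p * Y ^ N) ^ s" using pr by (intro mult_left_mono) auto
    then show ?thesis using 2 by linarith
  qed
  then show ?thesis by (simp add: v_divide v_power v_p X_def Y_def mult.commute)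
qed

text \<open>After absorbing the dominated terms the equations are \<open>- p x = y ^ s u\<close> and
  \<open>- p y = x ^ t u'\<close> with principal units \<open>u\<close>, \<open>u'\<close>.
  Eliminating \<open>y\<close> gives \<open>x ^ N = (- p) ^ (s + 1) x w\<close>.\<close>

lemma kernel_point:
  assumes s: "s \<ge> 2" and t: "t \<ge> 2" and N: "N = s * t"
    and eq1: "y ^ s * (1 + a1) + x ^ N * (1 + a2) / of_nat p = - of_nat p * x"
    and eq2: "x ^ t * (1 + b1) + y ^ N * (1 + b2) / of_nat p = - of_nat p * y"
    and ab: "v a1 < 1" "v a2 < 1" "v b1 < 1" "v b2 < 1"
    and small: "v (y ^ s) < 1 / real p" "v (x ^ t) < 1 / real p"
    and nz: "x \<noteq> 0 \<or> y \<noteq> 0"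
  shows "x \<noteq> 0 \<and> y \<noteq> 0 \<and> (\<exists>w. unit1 w \<and> x ^ (N - 1) = (- of_nat p) ^ (s + 1) * w)"
proof -
  have nz1: "1 + b1 \<noteq> 0" "1 + a1 \<noteq> 0" using ab v_minus[of 1] by (metis add_eq_0_iff less_irrefl v_1)+
  have st: "s > 0" "t > 0" "N > 0" using s t N by auto
  have x: "x \<noteq> 0" using nz eq1 nz1 st by (auto simp: power_0_left)
  have y: "y \<noteq> 0" using nz eq2 nz1 st by (auto simp: power_0_left)
  have N': "N = t * s" using N by simp
  have e1: "v (x ^ N / of_nat p) < v (y ^ s)" using kernel_estimate[OF s t N eq2 ab(3,4) small(1) y] .
  have e2: "v (y ^ N / of_nat p) < v (x ^ t)" using kernel_estimate[OF t s N' eq1 ab(1,2) small(2) x] .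
  have unit: "\<exists>u. unit1 u \<and> P * (1 + a) + R * (1 + c) = P * u"
    if "v R < v P" "v a < 1" "v c < 1" for P R a c
  proof -
    have P0: "P \<noteq> 0" using that(1) v_nonneg[of R] by (auto simp del: v_nonneg)
    define u where "u = 1 + (a + R / P * (1 + c))"
    have "v (1 + c) = 1" using that v_add_eq[of c 1] by (simp add: add.commute)
    then have "v (R / P * (1 + c)) < 1" using that(1) v_pos[OF P0] by (simp add: v_mult v_divide)
    then have "unit1 u" using that by (auto simp: unit1_def u_def intro: v_add_less)
    moreover have "P * (1 + a) + R * (1 + c) = P * u" using P0 by (simp add: u_def field_simps)
    ultimately show ?thesis by blast
  qed
  obtain u where u: "unit1 u" "- of_nat p * x = y ^ s * u"
    using unit[OF e1 ab(1,2)] eq1 by auto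
  obtain u' where u': "unit1 u'" "- of_nat p * y = x ^ t * u'"
    using unit[OF e2 ab(3,4)] eq2 by auto
  define w where "w = inverse (u * u' ^ s)"
  have w: "unit1 w" unfolding w_def using u u' by (intro unit1_inverse unit1_mult unit1_power)
  have uz: "u \<noteq> 0" "u' \<noteq> 0" using u u' unit1_nonzero by auto
  have "x ^ N * u' ^ s = (x ^ t * u') ^ s" by (simp add: power_mult_distrib N mult.commute flip: power_mult)
  also have "\<dots> = (- of_nat p) ^ s * y ^ s" unfolding u'(2)[symmetric] power_mult_distrib by (rule refl)
  finally have "x ^ N * u' ^ s * u = (- of_nat p) ^ s * (y ^ s * u)" by (simp add: mult_ac)
  also have "\<dots> = (- of_nat p) ^ (s + 1) * x" unfolding u(2)[symmetric] by (simp add: mult_ac)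
  finally have "x ^ N = (- of_nat p) ^ (s + 1) * x * w" using uz by (simp add: w_def field_simps)
  moreover have "x ^ N = x ^ (N - 1) * x" using st by (cases N) auto
  ultimately have "x ^ (N - 1) * x = ((- of_nat p) ^ (s + 1) * w) * x" by (metis mult.assoc mult.commute)
  then have "x ^ (N - 1) = (- of_nat p) ^ (s + 1) * w" using x by (metis mult_right_cancel)
  then show ?thesis using x y w by blast
qed

text \<open>For a monic polynomial \<open>v (poly P x)\<close> is the product of the distances from
  \<open>x\<close> to the roots, so one of them is below 1.\<close>

lemma root_close:
  assumes "alg_closed_field TYPE('a)" "lead_coeff P = 1" "v (poly P x) < 1"
  shows "\<exists>z. poly P z = 0 \<and> v (x - z) < 1"
  using assms(2,3)
proof (induction "degree P" arbitrary: P)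
  case 0
  then have "P = 1" by (metis lead_coeff_pCons(2) degree_eq_zeroE one_pCons pCons_0_0 coeff_pCons_0 degree_pCons_0)
  then show ?case using 0 by simp
next
  case (Suc n)
  then obtain z where z: "poly P z = 0" using assms(1) unfolding alg_closed_field_def by (metis Suc_le_mono One_nat_def le0)
  then obtain Q where Q: "P = [:- z, 1:] * Q" using poly_eq_0_iff_dvd by blast
  then have "Q \<noteq> 0" using Suc by auto
  then have deg: "degree P = Suc (degree Q)" unfolding Q by (subst degree_mult_eq) auto
  have lc: "lead_coeff Q = 1" using Suc(3) unfolding Q lead_coeff_mult by simp
  show ?case
  proof (cases "v (x - z) < 1")
    case True then show ?thesis using z by blast
  next
    case False
    have "v (x - z) * v (poly Q x) < 1" using Suc(4) by (simp add: Q algebra_simps flip: v_mult)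
    then have "v (poly Q x) < 1" using False mult_right_mono[of 1 "v (x - z)" "v (poly Q x)"] by auto
    then obtain z' where "poly Q z' = 0" "v (x - z') < 1" using Suc(1)[of Q] Suc(2) deg lc by auto
    then show ?thesis using Q by auto
  qed
qed

lemma root_of_unity_close:
  assumes "alg_closed_field TYPE('a)" "unit1 (x ^ n)" "n > 0"
  shows "\<exists>z. z ^ n = 1 \<and> v (x - z) < 1"
proof -
  define P :: "'a poly" where "P = monom 1 n + [:- 1:]"
  have d: "degree P = n" using assms(3) unfolding P_def
    by (subst degree_add_eq_left) (auto simp: degree_monom_eq)
  have "lead_coeff P = 1" using assms(3) unfolding d by (simp add: P_def coeff_pCons split: nat.splits)
  moreover have ev: "poly P y = y ^ n - 1" for y by (simp add: P_def poly_monom)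
  ultimately show ?thesis using root_close[OF assms(1), of P x] assms(2) by (simp add: unit1_def)
qed

end

section \<open>The action of roots of unity and the inverse logarithm on multiples of p\<close>

context lt_alg
begin

lemma zeta_pow: "(z :: 'a) ^ q = z \<Longrightarrow> z ^ (p ^ (k * h)) = z"
proof (induction k)
  case (Suc k)
  have "p ^ (Suc k * h) = q * p ^ (k * h)" unfolding mult_Suc by (rule power_add)
  then have "z ^ (p ^ (Suc k * h)) = z ^ (q * p ^ (k * h))" by (rule arg_cong)
  also have "\<dots> = (z ^ q) ^ (p ^ (k * h))" by (rule power_mult)
  finally show ?case using Suc by simp
qed simp

lemma beta_zeta: assumes "z ^ q = z" shows "b oo (fps_const z * P) = fps_const z * (b oo P)"
proof (rule fps_ext)
  fix n
  have "b $ i * ((fps_const z * P) ^ i) $ n = z * (b $ i * (P ^ i) $ n)" for i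
  proof (cases "\<exists>k. i = p ^ (k * h)")
    case True
    then have "z ^ i = z" using zeta_pow assms by blast
    then show ?thesis by (simp add: power_mult_distrib fps_const_power)
  next
    case False
    then have "b $ i = 0" by (intro b_nth_other) blast
    then show ?thesis by simp
  qed
  then show "(b oo (fps_const z * P)) $ n = (fps_const z * (b oo P)) $ n"
    unfolding fps_compose_nth fps_mult_left_const_nth sum_distrib_left by (intro sum.cong refl)
qed

text \<open>The series \<open>b\<close> only has exponents \<open>q ^ k\<close>, which fix
  \<open>z\<close>. The weight \<open>z ^ q2\<close> on the second coordinate matches the mixed
  terms: \<open>P ^ q2\<close> produces \<open>z ^ q2\<close>, and
  \<open>(z ^ q2) ^ q1 = z\<close>.\<close>

lemma Lam_zeta:
  assumes "z ^ q = z"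
  shows "Lam1 (fps_const z * P) (fps_const (z ^ q2) * Q) = fps_const z * Lam1 P Q"
    "Lam2 (fps_const z * P) (fps_const (z ^ q2) * Q) = fps_const (z ^ q2) * Lam2 P Q"
proof -
  have z2: "(z ^ q2) ^ q = z ^ q2" using assms by (metis power_mult mult.commute)
  have z1: "(z ^ q2) ^ q1 = z" using assms by (simp add: q_eq flip: power_mult)
  show "Lam1 (fps_const z * P) (fps_const (z ^ q2) * Q) = fps_const z * Lam1 P Q"
    unfolding Lam1_def power_mult_distrib fps_const_power z1 beta_zeta[OF assms] by (simp add: algebra_simps)
  show "Lam2 (fps_const z * P) (fps_const (z ^ q2) * Q) = fps_const (z ^ q2) * Lam2 P Q"
    unfolding Lam2_def power_mult_distrib fps_const_power beta_zeta[OF z2] by (simp add: algebra_simps)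
qed

lemma v_zeta: assumes "z ^ q = z" shows "v z \<le> 1"
proof (rule ccontr)
  assume "\<not> v z \<le> 1"
  moreover have "q > 1" using q_ge by linarith
  ultimately have "v z ^ 1 < v z ^ q" by (intro power_strict_increasing) auto
  then show False using assms by (simp flip: v_power)
qed

lemma SS_cmult: "c \<in> A \<Longrightarrow> v c \<le> 1 \<Longrightarrow> P \<in> SS \<Longrightarrow> fps_const c * P \<in> SS"
  by (auto simp: SS_def intro: S_const_mult)

lemma ev_cmult_SS: "P \<in> SS \<Longrightarrow> ev (fps_const c * P) = c * ev P"
  using ev_cmult by (auto simp: SS_def)

lemma v_ev_SS: "P \<in> SS \<Longrightarrow> v (ev P) < 1" "P \<in> SS \<Longrightarrow> ev P \<in> A"
  using ev_ordge[of _ P 1] ev_conv(2)[of _ P] by (fastforce simp: SS_def ordge_1_iff)+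

lemma A_power: "c \<in> A \<Longrightarrow> c ^ n \<in> A"
  by (induction n) (auto intro: AD)

lemma zeta_props: assumes "z ^ q = z" "z \<in> A" shows "z ^ q2 \<in> A" "v (z ^ q2) \<le> 1" "v z \<le> 1"
  using assms v_zeta[OF assms(1)] by (auto intro: A_power simp: v_power power_le_one)

lemma nul_zeta:
  assumes "nul x y" "z ^ q = z" "z \<in> A" shows "nul (fps_const z * x) (fps_const (z ^ q2) * y)"
proof -
  obtain P Q where PQ: "P \<in> SS" "Q \<in> SS" "ev P = 0" "ev Q = 0" "x = Lam1 P Q" "y = Lam2 P Q"
    using assms(1) unfolding nul_def by blast
  have "fps_const z * P \<in> SS" "fps_const (z ^ q2) * Q \<in> SS" using PQ zeta_props[OF assms(2,3)] assms(3) by (auto intro: SS_cmult)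
  moreover have "ev (fps_const z * P) = 0" "ev (fps_const (z ^ q2) * Q) = 0" using PQ by (auto simp: ev_cmult_SS)
  ultimately show ?thesis unfolding nul_def PQ(5,6) Lam_zeta[OF assms(2), symmetric] by blast
qed

lemma logs_zeta:
  assumes "logs x y" "z ^ q = z" "z \<in> A" shows "logs (fps_const z * x) (fps_const (z ^ q2) * y)"
proof -
  obtain P Q where PQ: "P \<in> SS" "Q \<in> SS" "x = Lam1 P Q" "y = Lam2 P Q"
    using assms(1) unfolding logs_def by blast
  have "fps_const z * P \<in> SS" "fps_const (z ^ q2) * Q \<in> SS" using PQ zeta_props[OF assms(2,3)] assms(3) by (auto intro: SS_cmult)
  then show ?thesis unfolding logs_def PQ(3,4) Lam_zeta[OF assms(2), symmetric] by blast
qed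

abbreviation fp :: "'a fps" where "fp \<equiv> fps_const (of_nat p)"

lemma nul_fp: "nul x y \<Longrightarrow> nul (fp * x) (fp * y)"
  using nul_of_nat[of x y p] by (simp add: fps_of_nat)

lemma logs_of_nat: "logs x y \<Longrightarrow> logs (of_nat n * x) (of_nat n * y)"
proof (induction n)
  case (Suc n)
  have "logs 0 0" using nul_imp_logs by simp
  then have "logs (0 - x) (0 - y)" using Suc.prems by (rule logs_diff)
  then have "logs (of_nat n * x - (0 - x)) (of_nat n * y - (0 - y))" using Suc logs_diff by blast
  then show ?case by (simp add: algebra_simps)
qed (simp add: nul_imp_logs)

text \<open>By \<open>pS_iff\<close> these are the multiples by \<open>p\<close> of
  \<open>S r\<close>. On them powers of \<open>p\<close> outweigh the denominators of the logarithm,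
  so \<open>L^-1\<close> preserves decay there (\<open>Linv_pS\<close>).\<close>

definition pS :: "real \<Rightarrow> 'a fps set" where "pS r = {P. \<forall>n. P $ n \<in> A \<and> v (P $ n) \<le> r ^ n / real p}"

lemma pS_iff: "P \<in> pS r \<longleftrightarrow> (\<exists>P'\<in>S r. P = fp * P')"
proof
  assume P: "P \<in> pS r"
  have "cp * P \<in> S r" unfolding S_def
  proof (clarify, rule conjI)
    fix n
    have "1 / of_nat p \<in> A" by (intro AD(6) Qp_divide) auto
    then show "(cp * P) $ n \<in> A" using P by (auto simp: pS_def intro!: AD(5)[of "1 / of_nat p", simplified])
    show "v ((cp * P) $ n) \<le> r ^ n" using P by (simp add: pS_def v_divide v_p field_simps)
  qed
  moreover have "P = fp * (cp * P)" by (simp flip: mult.assoc)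
  ultimately show "\<exists>P'\<in>S r. P = fp * P'" by blast
next
  assume "\<exists>P'\<in>S r. P = fp * P'"
  then show "P \<in> pS r" using AD(6)[of "of_nat p"] by (auto simp: pS_def S_def v_mult v_p divide_right_mono intro!: AD(5))
qed

lemma pS_power_nth:
  assumes "P \<in> pS r" "0 \<le> r" shows "(P ^ s) $ n \<in> A" "v ((P ^ s) $ n) \<le> r ^ n / real p ^ s"
proof -
  obtain P' where P': "P' \<in> S r" "P = fp * P'" using assms pS_iff by blast
  have "P' ^ s \<in> S r" using S_power P' assms by blast
  moreover have "(P ^ s) $ n = of_nat p ^ s * (P' ^ s) $ n" by (simp add: P' power_mult_distrib fps_const_power)
  ultimately show "(P ^ s) $ n \<in> A" "v ((P ^ s) $ n) \<le> r ^ n / real p ^ s"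
    using A_power[OF AD(6)[of "of_nat p"]] by (auto simp: S_def v_mult v_power v_p power_one_over divide_right_mono intro: AD(5))
qed

lemma b_nth_A: "b $ i \<in> A"
  using AD(6)[OF Qp_of_rat] by (simp add: beta_fps_def)

lemma four_pow: "2 * k + 1 \<le> (4::nat) ^ k" by (induction k) auto

lemma q_pow_ge: "j * q ^ k \<ge> j + 2 * k" if "j > 0"
proof -
  have "2 * k + 1 \<le> q ^ k" using four_pow[of k] power_mono[OF q_ge(3), of k] by simp
  then have "j * (2 * k + 1) \<le> j * q ^ k" by (rule mult_le_mono2)
  moreover have "j + 2 * k \<le> j * (2 * k + 1)" using that by (simp add: algebra_simps)
  ultimately show ?thesis by linarith
qed

lemma cp_A: "1 / of_nat p ^ e \<in> A"
  using AD(6)[of "1 / of_nat p ^ e"] Qp_of_rat[of "1 / of_nat p ^ e"] by (simp add: of_rat_divide of_rat_power)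

text \<open>The condition \<open>j \<ge> e + 1\<close> leaves one factor \<open>p\<close> after
  cancelling the denominators \<open>p ^ e\<close> and \<open>p ^ (2 k)\<close>, by
  \<open>q_pow_ge\<close>.\<close>

lemma beta_small_nth:
  assumes "P \<in> pS r" "0 \<le> r" "j \<ge> e + 1"
  shows "(cp ^ e * (b oo P ^ j)) $ n \<in> A" "v ((cp ^ e * (b oo P ^ j)) $ n) \<le> r ^ n / real p"
proof -
  have nth: "(cp ^ e * (b oo P ^ j)) $ n = 1 / of_nat p ^ e * (\<Sum>i=0..n. b $ i * (P ^ (j * i)) $ n)"
    by (simp add: fps_const_power fps_compose_nth power_one_over power_mult)
  have term_A: "b $ i * (P ^ (j * i)) $ n \<in> A" for i using pS_power_nth[OF assms(1,2)] b_nth_A by (intro AD(5))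
  show "(cp ^ e * (b oo P ^ j)) $ n \<in> A" unfolding nth by (intro AD(5) cp_A A_sum term_A)
  have "v (b $ i * (P ^ (j * i)) $ n) \<le> r ^ n / real p ^ (e + 1)" for i
    \<comment> \<open>only \<open>i = q ^ k\<close> contributes, and there \<open>p\<close> divides with exponent \<open>j q ^ k - 2 k\<close>\<close>
  proof (cases "\<exists>k. i = p ^ (k * h)")
    case True
    then obtain k where k: "i = p ^ (k * h)" by blast
    then have iq: "i = q ^ k" by (simp add: mult.commute[of k] flip: power_mult)
    have ji: "j * i \<ge> e + 1 + 2 * k" using q_pow_ge[of j k] assms(3) iq by simp
    have "v (b $ i) = real p ^ (2 * k)" unfolding k b_nth_pow by (simp add: v_divide v_power v_p power_one_over)
    then have "v (b $ i * (P ^ (j * i)) $ n) \<le> real p ^ (2 * k) * (r ^ n / real p ^ (j * i))"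
      using pS_power_nth(2)[OF assms(1,2), of "j * i" n] unfolding v_mult by (simp only:) (intro mult_left_mono, auto)
    also have "\<dots> \<le> real p ^ (2 * k) * (r ^ n / real p ^ (e + 1 + 2 * k))"
      using ji assms by (intro mult_left_mono divide_left_mono power_increasing) auto
    also have "\<dots> = r ^ n / real p ^ (e + 1)" by (simp add: power_add)
    finally show ?thesis .
  next
    case False
    then have "b $ i = 0" by (intro b_nth_other) blast
    then show ?thesis using assms by simp
  qed
  then have "v (\<Sum>i=0..n. b $ i * (P ^ (j * i)) $ n) \<le> r ^ n / real p ^ (e + 1)" using assms by (intro v_sum_le) auto
  then have "real p ^ e * v (\<Sum>i=0..n. b $ i * (P ^ (j * i)) $ n) \<le> real p ^ e * (r ^ n / real p ^ (e + 1))"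
    by (intro mult_left_mono) auto
  then show "v ((cp ^ e * (b oo P ^ j)) $ n) \<le> r ^ n / real p"
    unfolding nth by (simp add: v_mult v_divide v_power v_p power_one_over mult.commute)
qed

lemma pS_cutoff:
  assumes "\<And>m. m < n \<Longrightarrow> P $ m \<in> A \<and> v (P $ m) \<le> r ^ m / real p" "0 \<le> r"
  shows "fps_cutoff n P \<in> pS r"
  using assms AD(1) by (auto simp: pS_def fps_cutoff_def)

text \<open>Without constant term and with \<open>j \<ge> 2\<close>, coefficient \<open>n\<close> of
  \<open>P ^ j\<close> involves only coefficients of \<open>P\<close> below \<open>n\<close>; this
  permits recursion on the coefficient index.\<close>

lemma beta_cutoff:
  assumes "P $ 0 = 0" "j \<ge> 2"
  shows "(c * (b oo P ^ j)) $ n = (c * (b oo fps_cutoff n P ^ j)) $ n"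
proof (cases "n = 0")
  case True
  then show ?thesis by simp
next
  case False
  have "ordge n (P - fps_cutoff n P)" by (auto simp: ordge_def fps_cutoff_def)
  then have "ordge (n + 1 * (j - 1)) (P ^ j - fps_cutoff n P ^ j)"
    using assms False by (intro ordge_power_diff) (auto simp: ordge_1_iff fps_cutoff_def)
  then have "ordge (Suc n) (P ^ j - fps_cutoff n P ^ j)" using assms(2) by (auto intro: ordge_mono)
  then have "ordge (Suc n) (c * ((b oo P ^ j) - (b oo fps_cutoff n P ^ j)))"
    by (intro ordge_mult2 ordge_compose_diff)
  then show ?thesis using ordge_nthD[of "Suc n" _ n] by (fastforce simp: right_diff_distrib)
qed

text \<open>The equation \<open>L(H) = (P, Q)\<close> determines each coefficient of
  \<open>H\<close> from earlier ones. The correction terms pair one \<open>cp\<close> with exponent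
  \<open>q1\<close> or \<open>q2\<close>, and two with exponent \<open>q\<close>, which is the
  margin demanded by \<open>beta_small_nth\<close>.\<close>

lemma Linv_pS:
  assumes "P \<in> pS r" "Q \<in> pS r" "P $ 0 = 0" "Q $ 0 = 0" "0 \<le> r"
  shows "Linv1 P Q \<in> pS r" "Linv2 P Q \<in> pS r"
proof -
  define H1 H2 where "H1 = Linv1 P Q" and "H2 = Linv2 P Q"
  have z: "H1 $ 0 = 0" "H2 $ 0 = 0" by (simp_all add: H1_def H2_def)
  have L: "Lam1 H1 H2 = P" "Lam2 H1 H2 = Q" using Lam_Linv[OF assms(3,4)] by (simp_all add: H1_def H2_def)
  have H: "H1 = P - (cp ^ 1 * (b oo H2 ^ q1) + cp ^ 2 * (b oo H1 ^ q))"
    "H2 = Q - (cp ^ 1 * (b oo H1 ^ q2) + cp ^ 2 * (b oo H2 ^ q))"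
    using L beta_functional[OF z(1)] beta_functional[OF z(2)] unfolding Lam1_def Lam2_def
    by (simp_all add: algebra_simps)
  have "H1 $ n \<in> A \<and> v (H1 $ n) \<le> r ^ n / real p \<and> H2 $ n \<in> A \<and> v (H2 $ n) \<le> r ^ n / real p" for n
  proof (induction n rule: less_induct)
    case (less n)
    have T: "fps_cutoff n H1 \<in> pS r" "fps_cutoff n H2 \<in> pS r" using less assms(5) by (auto intro: pS_cutoff)
    have q1g: "q1 \<ge> 1 + 1" "q2 \<ge> 1 + 1" "q \<ge> 2 + 1" "q \<ge> 2" using q1_ge q2_ge q_ge by linarith+
    note bs = beta_small_nth[OF _ assms(5)]
    have 1: "H1 $ n = P $ n - ((cp ^ 1 * (b oo fps_cutoff n H2 ^ q1)) $ n + (cp ^ 2 * (b oo fps_cutoff n H1 ^ q)) $ n)"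
      using beta_cutoff[OF z(2) q1_ge] beta_cutoff[OF z(1) q1g(4)] arg_cong[OF H(1), of "\<lambda>F. F $ n"] by simp
    have 2: "H2 $ n = Q $ n - ((cp ^ 1 * (b oo fps_cutoff n H1 ^ q2)) $ n + (cp ^ 2 * (b oo fps_cutoff n H2 ^ q)) $ n)"
      using beta_cutoff[OF z(1) q2_ge] beta_cutoff[OF z(2) q1g(4)] arg_cong[OF H(2), of "\<lambda>F. F $ n"] by simp
    have PQ: "P $ n \<in> A" "v (P $ n) \<le> r ^ n / real p" "Q $ n \<in> A" "v (Q $ n) \<le> r ^ n / real p"
      using assms by (auto simp: pS_def)
    show ?case unfolding 1 2
      by (intro conjI AD(4) AD(3) v_diff_le[of "P $ n"] v_diff_le[of "Q $ n"] v_add_le PQ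
          bs(1)[OF T(1)] bs(1)[OF T(2)] bs(2)[OF T(1)] bs(2)[OF T(2)] q1g)
  qed
  then show "Linv1 P Q \<in> pS r" "Linv2 P Q \<in> pS r" by (auto simp: pS_def H1_def H2_def)
qed

lemma pS_S: "P \<in> pS r \<Longrightarrow> 0 \<le> r \<Longrightarrow> P \<in> S r"
  unfolding pS_iff using AD(6)[of "of_nat p"] by (auto simp: v_p intro!: S_const_mult)

lemma pS_ev: assumes "P \<in> pS r" "0 < r" "r < 1" "P $ 0 = 0" shows "v (ev P) < 1 / real p"
proof -
  obtain P' where P': "P' \<in> S r" "P = fp * P'" using assms pS_iff by blast
  then have "P' \<in> SS" using assms by (auto simp: SS_def)
  then have "v (ev P') < 1" by (rule v_ev_SS)
  moreover have "ev P = of_nat p * ev P'" using P' ev_cmult[OF assms(2,3)] by simp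
  ultimately show ?thesis by (simp add: v_mult v_p divide_strict_right_mono)
qed

text \<open>Write \<open>b = X (1 + a)\<close>. The nonzero coefficients of \<open>a\<close> sit at
  \<open>i = q ^ k - 1 \<ge> 2 k\<close> and have denominator \<open>p ^ (2 k)\<close>, which the
  factor \<open>p ^ i\<close> from \<open>P ^ i\<close> cancels.\<close>

lemma beta_unit:
  assumes "P \<in> pS r" "0 < r" "r < 1" "P $ 0 = 0"
  shows "\<exists>u\<in>S r. u $ 0 = 0 \<and> (b oo P) = P * (1 + u)"
proof -
  define a where "a = fps_shift 1 b - 1"
  have a0: "a $ 0 = 0" by (simp add: a_def)
  have "b = fps_X * (1 + a)" by (rule fps_ext) (simp add: a_def)
  then have "(b oo P) = P * (1 + (a oo P))"
    using assms(4) by (simp add: fps_compose_mult_distrib fps_compose_add_distrib)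
  moreover have "(a oo P) \<in> S r" unfolding S_def
  proof (clarify, rule conjI)
    fix n
    have nth: "(a oo P) $ n = (\<Sum>i=0..n. a $ i * (P ^ i) $ n)" by (simp add: fps_compose_nth)
    have aA: "a $ i \<in> A" for i using b_nth_A AD(1,2) by (auto simp: a_def intro!: AD(4))
    show "(a oo P) $ n \<in> A" unfolding nth using assms by (intro A_sum AD(5) aA pS_power_nth) auto
    have "v (a $ i * (P ^ i) $ n) \<le> r ^ n" for i
    proof (cases "i > 0 \<and> (\<exists>k. Suc i = p ^ (k * h))")
      case True
      then obtain k where k: "Suc i = p ^ (k * h)" "i > 0" by blast
      then have iq: "Suc i = q ^ k" by (simp add: mult.commute[of k] flip: power_mult)
      have ik: "i \<ge> 2 * k" using q_pow_ge[of 1 k] iq by simp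
      have "v (a $ i) = real p ^ (2 * k)"
        using k b_nth_pow[of k] by (simp add: a_def v_divide v_power v_p power_one_over)
      then have "v (a $ i * (P ^ i) $ n) \<le> real p ^ (2 * k) * (r ^ n / real p ^ i)"
        using pS_power_nth(2)[of P r i n] assms unfolding v_mult by (simp only:) (intro mult_left_mono, auto)
      also have "\<dots> \<le> real p ^ (2 * k) * (r ^ n / real p ^ (2 * k))"
        using ik assms by (intro mult_left_mono divide_left_mono power_increasing) auto
      finally show ?thesis by simp
    next
      case False
      then have "a $ i = 0"
      proof (cases "i = 0")
        case False
        with \<open>\<not> (i > 0 \<and> _)\<close> have "b $ Suc i = 0" by (intro b_nth_other) auto
        then show ?thesis using False by (simp add: a_def)
      qed (simp add: a0)
      then show ?thesis using assms by simp
    qed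
    then show "v ((a oo P) $ n) \<le> r ^ n" unfolding nth using assms by (intro v_sum_le) auto
  qed
  ultimately show ?thesis using a0 by (intro bexI[of _ "a oo P"]) auto
qed

end

section \<open>Nonzero points killed by p and cyclicity of the torsion\<close>

context lt_alg
begin

text \<open>Lift of \<open>x\<close> whose exponent can be chosen to encode the size of
  \<open>x\<close>: it lies in \<open>S r\<close> as soon as \<open>v x \<le> r ^ k\<close>.\<close>

definition lin :: "'a \<Rightarrow> nat \<Rightarrow> 'a fps" where "lin x k = fps_const x * fps_X ^ k"

lemma lin_nth: "lin x k $ n = (if n = k then x else 0)"
  by (simp add: lin_def fps_X_power_nth)

lemma lin_S: "x \<in> A \<Longrightarrow> v x \<le> r ^ k \<Longrightarrow> 0 \<le> r \<Longrightarrow> lin x k \<in> S r"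
  using AD(1) by (auto simp: S_def lin_nth)

lemma ev_lin: "ev (lin x k) = x"
proof (rule ev_eqI)
  have "psum (lin x k) N = x" if "N \<ge> Suc k" for N
    using that by (simp add: psum_def lin_nth)
  then show "conv_to v (psum (lin x k)) x" unfolding conv_to_def by (intro allI impI exI[of _ "Suc k"]) simp
qed

lemma ev_1: "ev 1 = 1"
  using ev_lin[of 1 0] by (simp add: lin_def)

lemma ordge_lin: "ordge k (lin x k)"
  by (simp add: ordge_def lin_nth)

lemma lin_SS: assumes "x \<in> A" "v x < 1" shows "lin x 1 \<in> SS"
proof (rule SS_I)
  show "lin x 1 \<in> S (max (v x) (1/2))" using assms by (intro lin_S) auto
qed (use assms in \<open>auto simp: lin_nth\<close>)

lemma pS_power: assumes "P \<in> pS r" "0 \<le> r" "s > 0" shows "P ^ s \<in> pS r"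
  unfolding pS_def
proof (clarify, rule conjI)
  fix n
  show "(P ^ s) $ n \<in> A" using pS_power_nth assms by blast
  have "r ^ n / real p ^ s \<le> r ^ n / real p ^ 1"
    using assms by (intro divide_left_mono power_increasing) auto
  then show "v ((P ^ s) $ n) \<le> r ^ n / real p" using pS_power_nth(2)[OF assms(1,2), of s n] by simp
qed

lemma fp_cp [simp]: "fp * (cp * P) = P" "cp * (fp * P) = P"
  by (simp_all flip: mult.assoc)

text \<open>Being killed by \<open>p\<close> means that \<open>\<psi>(X)\<close> and
  \<open>H = L^-1(- p X)\<close> have the same value, because
  \<open>p L(X) = L(\<psi>(X)) - L(H)\<close>. The two equations are the values of
  \<open>L(H) = - p X\<close>, with each \<open>b oo ...\<close> replaced by its argument times a
  principal unit.\<close>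

lemma kernel_equations:
  assumes xy: "x \<in> A" "y \<in> A" "v x < 1" "v y < 1"
    and nul: "nul (fp * Lam1 (lin x 1) (lin y 1)) (fp * Lam2 (lin x 1) (lin y 1))"
  shows "\<exists>a1 a2 b1 b2. v a1 < 1 \<and> v a2 < 1 \<and> v b1 < 1 \<and> v b2 < 1
    \<and> y ^ q1 * (1 + a1) + x ^ q * (1 + a2) / of_nat p = - of_nat p * x
    \<and> x ^ q2 * (1 + b1) + y ^ q * (1 + b2) / of_nat p = - of_nat p * y
    \<and> v (y ^ q1) < 1 / real p \<and> v (x ^ q2) < 1 / real p"
proof -
  define r where "r = max (max (v x) (v y)) (1/2)"
  have r: "0 < r" "r < 1" "0 \<le> r" using xy by (auto simp: r_def)
  define P Q where "P = lin x 1" and "Q = lin y 1"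
  have PQ: "P \<in> S r" "Q \<in> S r" using xy r by (auto simp: P_def Q_def r_def intro!: lin_S)
  have PQ0: "P $ 0 = 0" "Q $ 0 = 0" by (simp_all add: P_def Q_def lin_nth)
  \<comment> \<open>The sign turns the vanishing of the formal sum of \<open>L^-1(p X)\<close> and
    \<open>\<psi>(X)\<close> into an equality of two values.\<close>
  define M1 M2 where "M1 = fp * (0 - P)" and "M2 = fp * (0 - Q)"
  have M: "M1 \<in> pS r" "M2 \<in> pS r" "M1 $ 0 = 0" "M2 $ 0 = 0"
    using PQ PQ0 zero_S[OF r(1)] S_diff unfolding pS_iff M1_def M2_def by (blast, blast, simp, simp)
  define H1 H2 where "H1 = Linv1 M1 M2" and "H2 = Linv2 M1 M2"
  have H: "H1 \<in> pS r" "H2 \<in> pS r" "H1 $ 0 = 0" "H2 $ 0 = 0"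
    using Linv_pS[OF M r(3)] by (auto simp: H1_def H2_def)
  have HS: "H1 \<in> S r" "H2 \<in> S r" using H pS_S r by blast+
  have LH: "Lam1 H1 H2 = M1" "Lam2 H1 H2 = M2" using Lam_Linv[OF M(3,4)] by (simp_all add: H1_def H2_def)
  define A1 A2 where "A1 = Q ^ q1" and "A2 = P ^ q2"
  have AS: "A1 \<in> SS" "A2 \<in> SS" "H1 \<in> SS" "H2 \<in> SS"
    using PQ PQ0 HS H(3,4) r by (auto simp: A1_def A2_def intro!: SS_I[OF _ r(1,2)] S_power)
  have "cp * Lam1 A1 A2 = Lam1 P Q - P" "cp * Lam2 A1 A2 = Lam2 P Q - Q"
    using Lam_functional(1,2)[OF PQ0] by (simp_all add: A1_def A2_def)
  then have "Lam1 A1 A2 = fp * (Lam1 P Q - P)" "Lam2 A1 A2 = fp * (Lam2 P Q - Q)"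
    by (metis fp_cp(1))+
  then have "Lam1 A1 A2 - Lam1 H1 H2 = fp * Lam1 P Q" "Lam2 A1 A2 - Lam2 H1 H2 = fp * Lam2 P Q"
    unfolding LH by (simp_all add: M1_def M2_def algebra_simps)
  then have "ev A1 = ev H1 \<and> ev A2 = ev H2"
    using nul nul_Lam_iff[OF AS] by (simp add: P_def Q_def)
  moreover have "ev A1 = y ^ q1" "ev A2 = x ^ q2"
    using ev_power[OF r(1,2)] PQ by (simp_all add: A1_def A2_def P_def Q_def ev_lin)
  ultimately have evH: "ev H1 = y ^ q1" "ev H2 = x ^ q2" by simp_all
  have small: "v (y ^ q1) < 1 / real p" "v (x ^ q2) < 1 / real p"
    using pS_ev[OF H(1) r(1,2) H(3)] pS_ev[OF H(2) r(1,2) H(4)] evH by simp_all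
  have unit_ev: "\<exists>a. v a < 1 \<and> ev (b oo X) = ev X * (1 + a) \<and> (b oo X) \<in> S r"
    if X: "X \<in> pS r" "X $ 0 = 0" for X
  proof -
    obtain u where u: "u \<in> S r" "u $ 0 = 0" "(b oo X) = X * (1 + u)" using beta_unit[OF X(1) r(1,2) X(2)] by blast
    have one: "1 \<in> S r" using S_of_int[of r 1] r by simp
    have "ev (b oo X) = ev X * (1 + ev u)"
      unfolding u(3) using u one pS_S[OF X(1) r(3)] by (simp add: ev_mult[OF r(1,2)] ev_add[OF r(1,2)] ev_1 S_add)
    moreover have "v (ev u) < 1" using u r by (intro v_ev_SS SS_I) auto
    moreover have "(b oo X) \<in> S r" unfolding u(3) using u one pS_S[OF X(1) r(3)] r by (intro S_mult S_add) auto
    ultimately show ?thesis by blast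
  qed
  have cpev: "ev (cp * X) = ev X / of_nat p" if "X \<in> S r" for X
    using ev_cmult[OF r(1,2) that, of "1 / of_nat p"] by simp
  have sumev: "ev (X + cp * Y) = ev X + ev Y / of_nat p" if "X \<in> S r" "Y \<in> S r" "X + cp * Y \<in> S r" for X Y
    using ev_diff[OF r(1,2) that(3,1)] cpev[OF that(2)] by simp
  have MS: "M1 \<in> S r" "M2 \<in> S r" using M pS_S r by blast+
  have evM: "ev M1 = - of_nat p * x" "ev M2 = - of_nat p * y"
  proof -
    have "ev M1 = of_nat p * (ev 0 - ev P)" "ev M2 = of_nat p * (ev 0 - ev Q)"
      unfolding M1_def M2_def using PQ zero_S[OF r(1)] S_diff
      by (simp_all only: ev_cmult[OF r(1,2)] ev_diff[OF r(1,2)])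
    then show "ev M1 = - of_nat p * x" "ev M2 = - of_nat p * y" by (simp_all add: P_def Q_def ev_lin)
  qed
  have HP: "H2 ^ q1 \<in> pS r" "H1 ^ q2 \<in> pS r" "(H2 ^ q1) $ 0 = 0" "(H1 ^ q2) $ 0 = 0"
    using pS_power H r by auto
  have evHP: "ev (H2 ^ q1) = x ^ q" "ev (H1 ^ q2) = y ^ q"
    using ev_power[OF r(1,2) HS(1)] ev_power[OF r(1,2) HS(2)] evH by (simp_all add: q_eq flip: power_mult)
  obtain a1 where a1: "v a1 < 1" "ev (b oo H1) = ev H1 * (1 + a1)" "(b oo H1) \<in> S r" using unit_ev H by blast
  obtain a2 where a2: "v a2 < 1" "ev (b oo H2 ^ q1) = ev (H2 ^ q1) * (1 + a2)" "(b oo H2 ^ q1) \<in> S r" using unit_ev HP by blast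
  obtain b1 where b1: "v b1 < 1" "ev (b oo H2) = ev H2 * (1 + b1)" "(b oo H2) \<in> S r" using unit_ev H by blast
  obtain b2 where b2: "v b2 < 1" "ev (b oo H1 ^ q2) = ev (H1 ^ q2) * (1 + b2)" "(b oo H1 ^ q2) \<in> S r" using unit_ev HP by blast
  have "y ^ q1 * (1 + a1) + x ^ q * (1 + a2) / of_nat p = - of_nat p * x"
    using sumev[OF a1(3) a2(3)] LH(1) MS(1) evM(1) unfolding Lam1_def by (simp add: a1 a2 evH evHP)
  moreover have "x ^ q2 * (1 + b1) + y ^ q * (1 + b2) / of_nat p = - of_nat p * y"
    using sumev[OF b1(3) b2(3)] LH(2) MS(2) evM(2) unfolding Lam2_def by (simp add: b1 b2 evH evHP)
  ultimately show ?thesis using a1 a2 b1 b2 small by blast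
qed

text \<open>Nullity depends only on values, so the lifts \<open>x t\<close>, \<open>y t\<close> may
  be used. \<open>kernel_point\<close> is applied twice, with the coordinates exchanged the second
  time.\<close>

lemma kernel_dichotomy:
  assumes PQ: "P \<in> SS" "Q \<in> SS" and nul: "nul (fp * Lam1 P Q) (fp * Lam2 P Q)"
  shows "(ev P = 0 \<and> ev Q = 0) \<or> (ev P \<noteq> 0 \<and> ev Q \<noteq> 0
    \<and> (\<exists>w. unit1 w \<and> ev P ^ (q - 1) = (- of_nat p) ^ (q1 + 1) * w)
    \<and> (\<exists>w. unit1 w \<and> ev Q ^ (q - 1) = (- of_nat p) ^ (q2 + 1) * w))"
proof -
  define x y where "x = ev P" and "y = ev Q"
  have xy: "x \<in> A" "y \<in> A" "v x < 1" "v y < 1" using v_ev_SS PQ by (auto simp: x_def y_def)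
  have l: "lin x 1 \<in> SS" "lin y 1 \<in> SS" using xy lin_SS by blast+
  have "nul (Lam1 P Q - Lam1 (lin x 1) (lin y 1)) (Lam2 P Q - Lam2 (lin x 1) (lin y 1))"
    using nul_Lam_iff[OF PQ l] by (simp add: ev_lin x_def y_def)
  from nul_diff[OF nul nul_fp[OF this]]
  have "nul (fp * Lam1 (lin x 1) (lin y 1)) (fp * Lam2 (lin x 1) (lin y 1))" by (simp add: algebra_simps)
  then obtain a1 a2 b1 b2 where eqs: "v a1 < 1" "v a2 < 1" "v b1 < 1" "v b2 < 1"
    "y ^ q1 * (1 + a1) + x ^ q * (1 + a2) / of_nat p = - of_nat p * x"
    "x ^ q2 * (1 + b1) + y ^ q * (1 + b2) / of_nat p = - of_nat p * y"
    "v (y ^ q1) < 1 / real p" "v (x ^ q2) < 1 / real p" using kernel_equations[OF xy] by blast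
  show ?thesis
  proof (cases "x = 0 \<and> y = 0")
    case False
    then have nz: "x \<noteq> 0 \<or> y \<noteq> 0" "y \<noteq> 0 \<or> x \<noteq> 0" by auto
    show ?thesis
      using kernel_point[OF q1_ge q2_ge q_eq(1)[symmetric] eqs(5,6,1-4,7,8) nz(1)]
        kernel_point[OF q2_ge q1_ge q_eq(2)[symmetric] eqs(6,5,3,4,1,2,8,7) nz(2)]
      by (auto simp: x_def y_def)
  qed (simp add: x_def y_def)
qed

lemma Lam_expand:
  assumes "P $ 0 = 0" "Q $ 0 = 0"
  shows "Lam1 P Q = P + (cp * (b oo Q ^ q1) + cp ^ 2 * (b oo P ^ q))"
    "Lam2 P Q = Q + (cp * (b oo P ^ q2) + cp ^ 2 * (b oo Q ^ q))"
  using beta_functional[OF assms(1)] beta_functional[OF assms(2)] by (simp_all add: Lam1_def Lam2_def algebra_simps)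

lemma ordge_tail:
  assumes "ordge m P" "ordge n Q" "k \<le> n * i" "k \<le> m * j"
  shows "ordge k (cp * (b oo Q ^ i) + cp ^ 2 * (b oo P ^ j))"
  using assms by (intro ordge_add ordge_mult2 ordge_compose ordge_power'[OF assms(2)] ordge_power'[OF assms(1)]) auto

lemma weight_bounds:
  fixes s t n :: nat
  assumes "s \<ge> 2" "t \<ge> 2" "s * t = n" "n \<ge> s + 2" "n \<ge> t + 2"
  shows "s + 2 \<le> (t + 1) * s" "s + 2 \<le> (s + 1) * n" "s \<le> 1 * s" "s \<le> 1 * n"
    "t + 1 \<le> (s + 1) * t" "t + 1 \<le> (t + 1) * n" "t + 1 \<le> s * t" "t + 1 \<le> 1 * n" "s + 2 \<le> s * n"
proof -
  have n: "(t + 1) * s = n + s" "(s + 1) * t = n + t" using assms(3) by (auto simp: algebra_simps)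
  have m: "n \<le> s * n" "n \<le> (s + 1) * n" "n \<le> (t + 1) * n" using assms(1) by auto
  show "s + 2 \<le> (t + 1) * s" "t + 1 \<le> (s + 1) * t" unfolding n using assms by linarith+
  show "s + 2 \<le> (s + 1) * n" "t + 1 \<le> (t + 1) * n" "s + 2 \<le> s * n" using m assms by linarith+
  show "s \<le> 1 * s" "s \<le> 1 * n" "t + 1 \<le> s * t" "t + 1 \<le> 1 * n" using assms by linarith+
qed

text \<open>The weights \<open>q1 + 1\<close> and \<open>q2 + 1\<close> are proportional to the valuations of the coordinates of a nonzero
  point killed by \<open>p\<close>.\<close>
lemma sub_leading:
  assumes "ordge (q1 + 1) P" "ordge (q2 + 1) Q" "ordge (q1 + 1) P'" "ordge (q2 + 1) Q'"
  shows "ordge (q1 + 2) (sub1 P Q P' Q' - (P - P'))"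
proof -
  define R T where "R = sub1 P Q P' Q'" and "T = sub2 P Q P' Q'"
  have z: "P $ 0 = 0" "Q $ 0 = 0" "P' $ 0 = 0" "Q' $ 0 = 0" "R $ 0 = 0" "T $ 0 = 0"
    using assms by (auto simp: ordge_def R_def T_def)
  define e1 e2 where "e1 = (\<lambda>P Q. cp * (b oo Q ^ q1) + cp ^ 2 * (b oo P ^ q))"
    and "e2 = (\<lambda>P Q. cp * (b oo P ^ q2) + cp ^ 2 * (b oo Q ^ q))"
  have "Lam1 R T = Lam1 P Q - Lam1 P' Q'" "Lam2 R T = Lam2 P Q - Lam2 P' Q'"
    by (simp_all add: R_def T_def Lam_sub)
  then have "R + e1 R T = (P + e1 P Q) - (P' + e1 P' Q')" "T + e2 R T = (Q + e2 P Q) - (Q' + e2 P' Q')"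
    using Lam_expand[OF z(1,2)] Lam_expand[OF z(3,4)] Lam_expand[OF z(5,6)] unfolding e1_def e2_def by simp_all
  then have R: "R = (P - P') + (e1 P Q - e1 P' Q' - e1 R T)" and T: "T = (Q - Q') + (e2 P Q - e2 P' Q' - e2 R T)"
    by (simp_all add: algebra_simps)
  note q = weight_bounds[OF q1_ge q2_ge q_eq(1) q_ge(1,2)]
  have e1: "ordge (q1 + 2) (e1 P Q)" "ordge (q1 + 2) (e1 P' Q')"
    unfolding e1_def by (rule ordge_tail[OF _ _ q(1,2)]; fact assms)+
  have e2: "ordge (q2 + 1) (e2 P Q)" "ordge (q2 + 1) (e2 P' Q')"
    unfolding e2_def by (rule ordge_tail[OF _ _ q(5,6)]; fact assms)+
  \<comment> \<open>The orders are raised alternately: \<open>R\<close> to \<open>q1\<close>, then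
    \<open>T\<close> to \<open>q2 + 1\<close>, and then the correction term of \<open>R\<close> to
    \<open>q1 + 2\<close>.\<close>
  have R1: "ordge 1 R" "ordge 1 T" using z by (auto simp: ordge_1_iff)
  have "ordge q1 (e1 R T)" unfolding e1_def by (rule ordge_tail[OF R1 q(3,4)])
  moreover have "ordge q1 (P - P')" using assms by (auto intro!: ordge_diff intro: ordge_mono)
  moreover have "ordge q1 (e1 P Q)" "ordge q1 (e1 P' Q')" using e1 by (auto intro: ordge_mono)
  ultimately have "ordge q1 ((P - P') + (e1 P Q - e1 P' Q' - e1 R T))" by (intro ordge_add[of q1 "P - P'"] ordge_diff[of q1 "_ - _" "e1 R T"] ordge_diff[of q1 "e1 P Q"])
  then have "ordge q1 R" by (subst R)
  then have "ordge (q2 + 1) (e2 R T)" unfolding e2_def by (rule ordge_tail[OF R1(2) _ q(7,8)])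
  then have "ordge (q2 + 1) T" using assms e2 by (subst T) (intro ordge_add ordge_diff)
  then have "ordge (q1 + 2) (e1 R T)" unfolding e1_def by (rule ordge_tail[OF \<open>ordge q1 R\<close> _ q(1,9)])
  moreover have "R - (P - P') = e1 P Q - e1 P' Q' - e1 R T" by (subst R) simp
  ultimately show ?thesis using e1 by (auto simp: R_def[symmetric] intro!: ordge_diff)
qed

text \<open>The quotient \<open>x' / x\<close> of first coordinates has a principal unit as
  \<open>(q - 1)\<close>-th power, so it is close to some root of unity \<open>z\<close>. The formal
  difference of the second point and \<open>z\<close> times the first is killed by \<open>p\<close>,
  but its first coordinate is smaller than that of any nonzero such point.\<close>

lemma kernel_cyclic:
  assumes closed: "alg_closed_field TYPE('a)" and mu: "\<And>z. z ^ q = z \<Longrightarrow> z \<in> A"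
    and g: "logs g1 g2" "nul (fp * g1) (fp * g2)" "\<not> nul g1 g2"
    and g': "logs g1' g2'" "nul (fp * g1') (fp * g2')"
  shows "\<exists>z. z ^ q = z \<and> nul (g1' - fps_const z * g1) (g2' - fps_const (z ^ q2) * g2)"
proof (cases "nul g1' g2'")
  case True
  then show ?thesis using q_pos(1) by (intro exI[of _ 0]) (simp add: power_0_left)
next
  case False
  obtain P Q where PQ: "P \<in> SS" "Q \<in> SS" "g1 = Lam1 P Q" "g2 = Lam2 P Q" using g(1) unfolding logs_def by blast
  obtain P' Q' where PQ': "P' \<in> SS" "Q' \<in> SS" "g1' = Lam1 P' Q'" "g2' = Lam2 P' Q'" using g'(1) unfolding logs_def by blast
  define x y x' y' where "x = ev P" and "y = ev Q" and "x' = ev P'" and "y' = ev Q'"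
  have inA: "x \<in> A" "y \<in> A" "x' \<in> A" "y' \<in> A" using PQ PQ' v_ev_SS(2) by (auto simp: x_def y_def x'_def y'_def)
  have "x \<noteq> 0 \<or> y \<noteq> 0" using g(3) nul_Lam_iff_0[OF PQ(1,2)] PQ by (auto simp: x_def y_def)
  then obtain w wy where X: "x \<noteq> 0" "y \<noteq> 0" "unit1 w" "x ^ (q - 1) = (- of_nat p) ^ (q1 + 1) * w"
    "unit1 wy" "y ^ (q - 1) = (- of_nat p) ^ (q2 + 1) * wy"
    using kernel_dichotomy[OF PQ(1,2)] g(2) PQ unfolding x_def y_def by blast
  have "x' \<noteq> 0 \<or> y' \<noteq> 0" using False nul_Lam_iff_0[OF PQ'(1,2)] PQ' by (auto simp: x'_def y'_def)
  then obtain w' wy' where X': "x' \<noteq> 0" "y' \<noteq> 0" "unit1 w'" "x' ^ (q - 1) = (- of_nat p) ^ (q1 + 1) * w'"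
    "unit1 wy'" "y' ^ (q - 1) = (- of_nat p) ^ (q2 + 1) * wy'"
    using kernel_dichotomy[OF PQ'(1,2)] g'(2) PQ' unfolding x'_def y'_def by blast
  have qm: "q - 1 > 0" using q_ge by simp
  have "(x' / x) ^ (q - 1) = w' * inverse w"
    using X X' unit1_nonzero[OF X(3)] by (simp add: power_divide field_simps)
  then have "unit1 ((x' / x) ^ (q - 1))" using X X' by (simp add: unit1_mult unit1_inverse)
  then obtain z where z: "z ^ (q - 1) = 1" "v (x' / x - z) < 1" using root_of_unity_close[OF closed _ qm] by blast
  have zq: "z ^ q = z" using z(1) qm by (metis Suc_diff_1 mult.right_neutral power_Suc q_pos(1))
  have zA: "z \<in> A" using mu zq by blast
  have "x' - z * x = x * (x' / x - z)" using X by (simp add: field_simps)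
  then have "v (x' - z * x) = v x * v (x' / x - z)" by (simp only: v_mult)
  then have close: "v (x' - z * x) < v x" using z(2) v_pos[OF X(1)] by simp
  \<comment> \<open>The unit in which nonzero points killed by \<open>p\<close> have coordinates of
    absolute value exactly \<open>\<rho> ^ (q1 + 1)\<close> and
    \<open>\<rho> ^ (q2 + 1)\<close>.\<close>
  define \<rho> where "\<rho> = root (q - 1) (1 / real p)"
  have \<rho>: "0 < \<rho>" "\<rho> < 1" "\<rho> ^ (q - 1) = 1 / real p"
    using qm by (auto simp: \<rho>_def real_root_gt_0_iff real_root_lt_1_iff real_root_pow_pos)
  have val: "v c = \<rho> ^ (s + 1)" if "unit1 u" "c ^ (q - 1) = (- of_nat p) ^ (s + 1) * u" for c u s
  proof -
    have "v c ^ (q - 1) = v ((- of_nat p) ^ (s + 1) * u)" unfolding v_power[symmetric] that(2) by (rule refl)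
    also have "\<dots> = (1 / real p) ^ (s + 1)" unfolding v_mult v_power v_minus v_p unit1_v[OF that(1)] by simp
    also have "\<dots> = (\<rho> ^ (s + 1)) ^ (q - 1)" unfolding \<rho>(3)[symmetric] power_mult[symmetric] by (simp only: mult.commute)
    finally have "v c ^ (q - 1) = (\<rho> ^ (s + 1)) ^ (q - 1)" .
    then show ?thesis using \<rho>(1) qm by (intro power_eq_imp_eq_base[of "v c" "q - 1"]) auto
  qed
  have vals: "v x = \<rho> ^ (q1 + 1)" "v y = \<rho> ^ (q2 + 1)" "v x' = \<rho> ^ (q1 + 1)" "v y' = \<rho> ^ (q2 + 1)"
    using val X X' by blast+
  \<comment> \<open>These lifts store the absolute values as orders of vanishing, so
    \<open>sub_leading\<close> bounds the nonlinear part of the difference by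
    \<open>\<rho> ^ (q1 + 2)\<close>.\<close>
  define X1 Y1 X1' Y1' where "X1 = lin x (q1 + 1)" and "Y1 = lin y (q2 + 1)" and "X1' = lin x' (q1 + 1)" and "Y1' = lin y' (q2 + 1)"
  have lifts: "X1 \<in> S \<rho>" "Y1 \<in> S \<rho>" "X1' \<in> S \<rho>" "Y1' \<in> S \<rho>"
    using inA vals \<rho> by (auto simp: X1_def Y1_def X1'_def Y1'_def intro!: lin_S)
  have lifts0: "X1 $ 0 = 0" "Y1 $ 0 = 0" "X1' $ 0 = 0" "Y1' $ 0 = 0"
    by (simp_all add: X1_def Y1_def X1'_def Y1'_def lin_nth)
  define ZX ZY where "ZX = fps_const z * X1" and "ZY = fps_const (z ^ q2) * Y1"
  have Z: "ZX \<in> S \<rho>" "ZY \<in> S \<rho>" "ZX $ 0 = 0" "ZY $ 0 = 0"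
    using lifts lifts0 zeta_props[OF zq zA] zA by (auto simp: ZX_def ZY_def intro!: S_const_mult)
  have SSs: "X1 \<in> SS" "Y1 \<in> SS" "X1' \<in> SS" "Y1' \<in> SS" "ZX \<in> SS" "ZY \<in> SS"
    using lifts lifts0 Z \<rho> by (auto intro: SS_I)
  define R T where "R = sub1 X1' Y1' ZX ZY" and "T = sub2 X1' Y1' ZX ZY"
  have RS: "R \<in> S \<rho>" using sub_S[OF \<rho>(1,2) lifts(3,4) Z(1,2) lifts0(3,4) Z(3,4)] by (simp add: R_def)
  have RT: "R \<in> SS" "T \<in> SS" using sub_SS SSs by (auto simp: R_def T_def)
  have LRT: "Lam1 R T = Lam1 X1' Y1' - fps_const z * Lam1 X1 Y1"
    "Lam2 R T = Lam2 X1' Y1' - fps_const (z ^ q2) * Lam2 X1 Y1"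
    by (simp_all add: R_def T_def Lam_sub ZX_def ZY_def Lam_zeta[OF zq])
  have n1: "nul (g1 - Lam1 X1 Y1) (g2 - Lam2 X1 Y1)"
    unfolding PQ(3,4) using nul_Lam_iff[OF PQ(1,2) SSs(1,2)] by (simp add: X1_def Y1_def ev_lin x_def y_def)
  have n2: "nul (g1' - Lam1 X1' Y1') (g2' - Lam2 X1' Y1')"
    unfolding PQ'(3,4) using nul_Lam_iff[OF PQ'(1,2) SSs(3,4)] by (simp add: X1'_def Y1'_def ev_lin x'_def y'_def)
  have n3: "nul ((g1' - fps_const z * g1) - Lam1 R T) ((g2' - fps_const (z ^ q2) * g2) - Lam2 R T)"
    using nul_diff[OF n2 nul_zeta[OF n1 zq zA]] unfolding LRT by (simp add: algebra_simps)
  have "nul (fp * (g1' - fps_const z * g1)) (fp * (g2' - fps_const (z ^ q2) * g2))"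
    using nul_diff[OF g'(2) nul_zeta[OF g(2) zq zA]] by (simp add: algebra_simps)
  from nul_diff[OF this nul_fp[OF n3]] have "nul (fp * Lam1 R T) (fp * Lam2 R T)" by (simp add: algebra_simps)
  note dich = kernel_dichotomy[OF RT this]
  have "ordge (q1 + 2) (R - (X1' - ZX))"
    unfolding R_def by (rule sub_leading) (auto simp: X1'_def Y1'_def ZX_def ZY_def X1_def Y1_def intro!: ordge_lin ordge_mult2)
  then have "v (ev (R - (X1' - ZX))) \<le> \<rho> ^ (q1 + 2)"
    using RS lifts Z by (intro ev_ordge[OF \<rho>(1,2)] S_diff)
  also have "\<dots> < \<rho> ^ (q1 + 1)" using \<rho> by simp
  finally have "v (ev R - (ev X1' - ev ZX)) < \<rho> ^ (q1 + 1)"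
    using RS lifts Z S_diff by (simp add: ev_diff[OF \<rho>(1,2)])
  moreover have "ev X1' - ev ZX = x' - z * x"
    using lifts by (simp add: ZX_def ev_cmult[OF \<rho>(1,2)] X1_def X1'_def ev_lin)
  ultimately have "v ((ev R - (x' - z * x)) + (x' - z * x)) < \<rho> ^ (q1 + 1)"
    using close vals by (intro v_add_less) auto
  then have "v (ev R) < \<rho> ^ (q1 + 1)" by simp
  then have "ev R = 0 \<and> ev T = 0" using dich val by (metis less_irrefl)
  then have "nul (Lam1 R T) (Lam2 R T)" using nul_Lam_iff_0[OF RT] by simp
  from nul_add[OF n3 this] show ?thesis using zq by auto
qed

text \<open>In \<^term>\<open>W a a'\<close>, \<^term>\<open>a\<close> is a finite Teichmueller expansion in \<open>p\<close>, and \<^term>\<open>a'\<close> its image under the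
  \<open>h2\<close>-th power of Frobenius; \<^term>\<open>a\<close> acts on logarithms by the diagonal matrix with entries \<^term>\<open>a\<close>, \<^term>\<open>a'\<close>.\<close>
inductive W :: "'a \<Rightarrow> 'a \<Rightarrow> bool" where
  zero: "W 0 0"
| step: "z ^ q = z \<Longrightarrow> W a a' \<Longrightarrow> W (z + of_nat p * a) (z ^ q2 + of_nat p * a')"

lemma nul_W:
  assumes mu: "\<And>z. z ^ q = z \<Longrightarrow> z \<in> A" and "W a a'" "nul x y"
  shows "nul (fps_const a * x) (fps_const a' * y)"
  using assms(2)
proof (induction rule: W.induct)
  case (step z a a')
  have "nul (fps_const z * x + fp * (fps_const a * x)) (fps_const (z ^ q2) * y + fp * (fps_const a' * y))"
    using step mu assms(3) by (intro nul_add nul_fp nul_zeta) auto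
  then show ?case by (simp add: algebra_simps flip: fps_const_add fps_const_mult)
qed simp

lemma logs_W:
  assumes mu: "\<And>z. z ^ q = z \<Longrightarrow> z \<in> A" and "W a a'" "logs x y"
  shows "logs (fps_const a * x) (fps_const a' * y)"
  using assms(2)
proof (induction rule: W.induct)
  case (step z a a')
  have "logs 0 0" using nul_imp_logs by simp
  then have "logs (0 - of_nat p * (fps_const a * x)) (0 - of_nat p * (fps_const a' * y))"
    using step logs_of_nat by (intro logs_diff)
  moreover have "logs (fps_const z * x) (fps_const (z ^ q2) * y)" using logs_zeta[OF assms(3)] step mu by blast
  ultimately have "logs (fps_const z * x - (0 - of_nat p * (fps_const a * x)))
    (fps_const (z ^ q2) * y - (0 - of_nat p * (fps_const a' * y)))" by (rule logs_diff[rotated])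
  then show ?case by (simp add: algebra_simps flip: fps_const_add fps_const_mult fps_of_nat)
qed (simp add: nul_imp_logs)

text \<open>One digit at a time: \<open>kernel_cyclic\<close> at the \<open>p ^ n\<close>-multiples
  yields \<open>z\<close>, the difference of \<open>X'\<close> and \<open>z X\<close> is killed by
  \<open>p ^ n\<close>, and by induction it is \<open>a (p X)\<close>, so
  \<open>X' = (z + p a) X\<close>. The guard \<open>n > 0\<close> admits the origin, where both
  points are null.\<close>

lemma torsion_cyclic:
  assumes closed: "alg_closed_field TYPE('a)" and mu: "\<And>z. z ^ q = z \<Longrightarrow> z \<in> A"
    and "logs g1 g2" "nul (fp ^ n * g1) (fp ^ n * g2)" "n > 0 \<Longrightarrow> \<not> nul (fp ^ (n - 1) * g1) (fp ^ (n - 1) * g2)"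
    and "logs g1' g2'" "nul (fp ^ n * g1') (fp ^ n * g2')"
  shows "\<exists>a a'. W a a' \<and> nul (g1' - fps_const a * g1) (g2' - fps_const a' * g2)"
  using assms(3-)
proof (induction n arbitrary: g1 g2 g1' g2')
  case 0
  then show ?case using W.zero by (intro exI[of _ 0]) auto
next
  case (Suc n)
  have fpn: "fp ^ n = of_nat (p ^ n)" by (simp add: fps_const_power fps_of_nat flip: of_nat_power)
  have lg: "logs (fp ^ n * g1) (fp ^ n * g2)" "logs (fp ^ n * g1') (fp ^ n * g2')"
    unfolding fpn using Suc.prems logs_of_nat by blast+
  have fpS: "fp * (fp ^ n * g) = fp ^ Suc n * g" for g by (simp only: power_Suc mult.assoc)
  have pn: "nul (fp * (fp ^ n * g1)) (fp * (fp ^ n * g2))" "nul (fp * (fp ^ n * g1')) (fp * (fp ^ n * g2'))"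
    "\<not> nul (fp ^ n * g1) (fp ^ n * g2)"
    unfolding fpS using Suc.prems(2,3,5) by auto
  obtain z where z: "z ^ q = z" "nul (fp ^ n * g1' - fps_const z * (fp ^ n * g1)) (fp ^ n * g2' - fps_const (z ^ q2) * (fp ^ n * g2))"
    using kernel_cyclic[OF closed mu lg(1) pn(1,3) lg(2) pn(2)] by blast
  define k1 k2 where "k1 = g1' - fps_const z * g1" and "k2 = g2' - fps_const (z ^ q2) * g2"
  have k: "logs k1 k2" unfolding k1_def k2_def using Suc.prems logs_zeta z(1) mu by (intro logs_diff) auto
  have kn: "nul (fp ^ n * k1) (fp ^ n * k2)" using z(2) unfolding k1_def k2_def by (simp add: algebra_simps)
  have l: "logs (fp * g1) (fp * g2)" using logs_of_nat[OF Suc.prems(1), of p] by (simp add: fps_of_nat)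
  have ln: "nul (fp ^ n * (fp * g1)) (fp ^ n * (fp * g2))" using Suc.prems(2) by (simp add: mult_ac)
  have lnn: "\<not> nul (fp ^ (n - 1) * (fp * g1)) (fp ^ (n - 1) * (fp * g2))" if "n > 0"
  proof -
    from that obtain m where m: "n = Suc m" by (cases n) auto
    have "fp ^ (n - 1) * (fp * g) = fp ^ n * g" for g
      unfolding m power_Suc by (simp only: diff_Suc_1 mult_ac)
    then show ?thesis using Suc.prems(3) by (simp only:) auto
  qed
  obtain a a' where a: "W a a'" "nul (k1 - fps_const a * (fp * g1)) (k2 - fps_const a' * (fp * g2))"
    using Suc.IH[OF l ln lnn k kn] by blast
  have "W (z + of_nat p * a) (z ^ q2 + of_nat p * a')" using W.step z(1) a(1) by blast
  moreover have "nul (g1' - fps_const (z + of_nat p * a) * g1) (g2' - fps_const (z ^ q2 + of_nat p * a') * g2)"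
    using a(2) unfolding k1_def k2_def by (simp add: algebra_simps flip: fps_const_add fps_const_mult)
  ultimately show ?case by blast
qed

end

section \<open>Roots of unity in unramified extensions\<close>

context padic
begin

lemma Qp_sum: "(\<And>i. i \<in> I \<Longrightarrow> f i \<in> Qp) \<Longrightarrow> sum f I \<in> Qp"
  by (induction I rule: infinite_finite_induct) auto

text \<open>Gaussian elimination: a vector \<open>u i0\<close> with nonzero coefficient at
  \<open>e\<close> is used to clear \<open>e\<close> from the others, and its own coefficient is
  recovered from \<open>s\<close>.\<close>

lemma Qp_span_dependent:
  assumes "finite I" "\<And>i. i \<in> I \<Longrightarrow> u i \<in> Qp_span es" "card I > length es"
  shows "\<exists>c. (\<forall>i\<in>I. c i \<in> Qp) \<and> (\<exists>i\<in>I. c i \<noteq> 0) \<and> (\<Sum>i\<in>I. c i * u i) = 0"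
  using assms
proof (induction es arbitrary: I u)
  case Nil
  then have "I \<noteq> {}" by auto
  moreover have "(\<Sum>i\<in>I. 1 * u i) = 0" using Nil by (intro sum.neutral) auto
  ultimately show ?case by (intro exI[of _ "\<lambda>_. 1"]) auto
next
  case (Cons e es)
  have "\<forall>i\<in>I. \<exists>c w. u i = c * e + w \<and> c \<in> Qp \<and> w \<in> Qp_span es" using Cons.prems(2) by auto
  then obtain c w where cw: "\<And>i. i \<in> I \<Longrightarrow> u i = c i * e + w i" "\<And>i. i \<in> I \<Longrightarrow> c i \<in> Qp" "\<And>i. i \<in> I \<Longrightarrow> w i \<in> Qp_span es"
    by metis
  show ?case
  proof (cases "\<forall>i\<in>I. c i = 0")
    case True
    then have "\<And>i. i \<in> I \<Longrightarrow> u i \<in> Qp_span es" using cw by simp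
    then show ?thesis using Cons by simp
  next
    case False
    then obtain i0 where i0: "i0 \<in> I" "c i0 \<noteq> 0" by blast
    define J where "J = I - {i0}"
    define u' where "u' = (\<lambda>i. u i - c i / c i0 * u i0)"
    have IJ: "I = insert i0 J" "i0 \<notin> J" "finite J" using i0 Cons.prems by (auto simp: J_def)
    have u': "u' i \<in> Qp_span es" if "i \<in> J" for i
    proof -
      have iI: "i \<in> I" using that by (simp add: J_def)
      have "u' i = w i - c i / c i0 * w i0" unfolding u'_def cw(1)[OF iI] cw(1)[OF i0(1)] using i0 by (simp add: field_simps)
      moreover have "c i / c i0 \<in> Qp" using cw iI i0 by auto
      ultimately show ?thesis using cw(3)[OF iI] cw(3)[OF i0(1)] Qp_span_diff Qp_span_scale by metis
    qed
    have "card J > length es" using Cons.prems IJ by simp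
    then obtain d where d: "\<forall>i\<in>J. d i \<in> Qp" "\<exists>i\<in>J. d i \<noteq> 0" "(\<Sum>i\<in>J. d i * u' i) = 0"
      using Cons.IH[of J u'] IJ u' by blast
    define s where "s = (\<Sum>i\<in>J. d i * (c i / c i0))"
    define f where "f = (\<lambda>i. if i = i0 then - s else d i)"
    have "s \<in> Qp" unfolding s_def
    proof -
      have "\<forall>i\<in>J. d i * (c i / c i0) \<in> Qp" using d(1) cw(2) i0(1) by (auto simp: J_def intro!: Qp_mult[OF _ Qp_divide] simp del: times_divide_eq_right)
      then show "(\<Sum>i\<in>J. d i * (c i / c i0)) \<in> Qp" by (intro Qp_sum) auto
    qed
    then have "\<forall>i\<in>I. f i \<in> Qp" using d IJ by (auto simp: f_def)
    moreover have "\<exists>i\<in>I. f i \<noteq> 0" using d(2) IJ by (auto simp: f_def)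
    moreover have "(\<Sum>i\<in>I. f i * u i) = 0"
    proof -
      have "(\<Sum>i\<in>I. f i * u i) = - s * u i0 + (\<Sum>i\<in>J. d i * u i)"
        using IJ by (auto simp: f_def intro!: sum.cong)
      also have "\<dots> = (\<Sum>i\<in>J. d i * u' i)"
        by (simp add: s_def u'_def sum_distrib_right right_diff_distrib sum_subtractf mult.assoc)
      finally show ?thesis using d by simp
    qed
    ultimately show ?thesis by blast
  qed
qed

lemma lin_comb_sum: "length cs = length bs \<Longrightarrow> lin_comb cs bs = (\<Sum>i<length bs. cs ! i * bs ! i)"
  by (simp add: lin_comb_def sum_list_sum_nth atLeast0LessThan)

lemma Qp_span_lin_comb: "Qp_span bs = {lin_comb cs bs | cs. length cs = length bs \<and> set cs \<subseteq> Qp}"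
proof (induction bs)
  case (Cons b bs)
  show ?case
  proof (intro equalityI subsetI)
    fix x assume "x \<in> Qp_span (b # bs)"
    then obtain c cs where "x = c * b + lin_comb cs bs" "c \<in> Qp" "length cs = length bs" "set cs \<subseteq> Qp"
      using Cons by auto
    then show "x \<in> {lin_comb cs (b # bs) | cs. length cs = length (b # bs) \<and> set cs \<subseteq> Qp}"
      by (intro CollectI exI[of _ "c # cs"]) (auto simp: lin_comb_def)
  next
    fix x assume "x \<in> {lin_comb cs (b # bs) | cs. length cs = length (b # bs) \<and> set cs \<subseteq> Qp}"
    then obtain c cs where "x = lin_comb (c # cs) (b # bs)" "length cs = length bs" "set (c # cs) \<subseteq> Qp"
      by (auto simp: length_Suc_conv)
    then show "x \<in> Qp_span (b # bs)" using Cons by (auto simp: lin_comb_def)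
  qed
qed (auto simp: lin_comb_def)

text \<open>The cofactor of \<open>a - c\<close> in \<open>a ^ p - c ^ p\<close> is
  \<open>p * c ^ (p - 1)\<close> up to terms divisible by differences \<open>a ^ i - c ^ i\<close>,
  hence of absolute value at most \<open>1 / p\<close>.\<close>

lemma prime_power_diff:
  assumes "v a \<le> 1" "v c \<le> 1" "v (a - c) \<le> 1 / real p"
  shows "v (a ^ p - c ^ p) \<le> v (a - c) / real p"
proof -
  obtain m where m: "p = Suc m" using p_pos(1) by (cases p) auto
  have "a ^ p - c ^ p = (a - c) * (\<Sum>i<p. a ^ i * c ^ (m - i))" unfolding m by (rule diff_power_eq_sum)
  moreover have "v (\<Sum>i<p. a ^ i * c ^ (m - i)) \<le> 1 / real p"
  proof -
    have pw: "v (a ^ i - c ^ i) \<le> 1 / real p" for i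
    proof (induction i)
      case (Suc i)
      have "v (a * (a ^ i - c ^ i) + (a - c) * c ^ i) \<le> 1 / real p"
      proof (rule v_add_le)
        show "v (a * (a ^ i - c ^ i)) \<le> 1 / real p"
          unfolding v_mult using mult_mono[OF assms(1) Suc] by simp
        have "v c ^ i \<le> 1" using assms by (simp add: power_le_one)
        then show "v ((a - c) * c ^ i) \<le> 1 / real p"
          unfolding v_mult v_power using mult_mono[OF assms(3)] by fastforce
      qed
      then show ?case by (simp add: algebra_simps)
    qed simp
    have "(\<Sum>i<p. a ^ i * c ^ (m - i)) = (\<Sum>i<p. (a ^ i - c ^ i) * c ^ (m - i)) + (\<Sum>i<p. c ^ m)"
      unfolding sum.distrib[symmetric]
    proof (intro sum.cong refl)
      fix i assume "i \<in> {..<p}"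
      then have "c ^ m = c ^ i * c ^ (m - i)" using m by (simp flip: power_add)
      then show "a ^ i * c ^ (m - i) = (a ^ i - c ^ i) * c ^ (m - i) + c ^ m" by (simp add: algebra_simps)
    qed
    moreover have "v (\<Sum>i<p. (a ^ i - c ^ i) * c ^ (m - i)) \<le> 1 / real p"
    proof (rule v_sum_le)
      fix i
      have "v c ^ (m - i) \<le> 1" using assms by (simp add: power_le_one)
      then show "v ((a ^ i - c ^ i) * c ^ (m - i)) \<le> 1 / real p"
        unfolding v_mult v_power using mult_mono[OF pw[of i]] by fastforce
    qed simp
    moreover have "v (\<Sum>i<p. c ^ m) \<le> 1 / real p"
      using assms by (simp add: v_mult v_p v_power power_le_one divide_right_mono)
    ultimately show ?thesis using v_add_le by simp
  qed
  ultimately have "v (a ^ p - c ^ p) \<le> v (a - c) * (1 / real p)"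
    by (simp only: v_mult) (intro mult_left_mono, auto)
  then show ?thesis by simp
qed

lemma prime_power_pow_diff:
  assumes "v a \<le> 1" "v c \<le> 1" "v (a - c) \<le> 1 / real p"
  shows "v (a ^ (p ^ Suc j) - c ^ (p ^ Suc j)) \<le> v (a - c) / real p"
proof (induction j)
  case 0
  then show ?case using prime_power_diff[OF assms] by simp
next
  case (Suc j)
  let ?a = "a ^ (p ^ Suc j)" and ?c = "c ^ (p ^ Suc j)"
  have "v (a - c) / real p \<le> (1 / real p) / 1" using assms(3) by (intro frac_le) auto
  then have "v (?a - ?c) \<le> 1 / real p" using Suc by simp
  moreover have "v ?a \<le> 1" "v ?c \<le> 1" using assms by (auto simp: v_power power_le_one)
  ultimately have "v (?a ^ p - ?c ^ p) \<le> v (?a - ?c) / real p" by (rule prime_power_diff[rotated 2])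
  also have "\<dots> \<le> v (?a - ?c) / 1" by (intro frac_le) auto
  also have "\<dots> \<le> v (a - c) / real p" using Suc by simp
  finally show ?case by (simp add: mult.commute flip: power_mult)
qed

lemma unit1_prod: "(\<And>i. i \<in> I \<Longrightarrow> unit1 (f i)) \<Longrightarrow> unit1 (prod f I)"
  by (induction I rule: infinite_finite_induct) (auto intro: unit1_mult unit1_1)

lemma conv_to_power: "conv_to v X a \<Longrightarrow> conv_to v (\<lambda>j. X j ^ m) (a ^ m)"
  by (induction m) (auto intro: conv_to_mult)

text \<open>Linear independence of the residue classes over the prime field.\<close>
definition resind :: "'a list \<Rightarrow> bool" where
  "resind es \<longleftrightarrow> (\<forall>k :: nat \<Rightarrow> int. v (\<Sum>i<length es. of_int (k i) * es ! i) < 1 \<longrightarrow> (\<forall>i<length es. int p dvd k i))"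

lemma resind_independent:
  assumes "resind es" "\<And>e. e \<in> set es \<Longrightarrow> v e \<le> 1" "\<And>i. i < length es \<Longrightarrow> c i \<in> Qp"
    "(\<Sum>i<length es. c i * es ! i) = 0" "i < length es"
  shows "c i = 0"
proof (rule ccontr)
  assume ci: "c i \<noteq> 0"
  define M where "M = (\<lambda>i. v (c i)) ` {..<length es}"
  have M: "finite M" "M \<noteq> {}" using assms(5) by (auto simp: M_def)
  obtain y where "y \<in> M" "\<forall>x\<in>M. x \<le> y" using Max_in[OF M] Max_ge[OF M(1)] by blast
  then obtain i0 where i0: "i0 < length es" "\<And>j. j < length es \<Longrightarrow> v (c j) \<le> v (c i0)"
    by (auto simp: M_def)
  have c0: "c i0 \<noteq> 0" using i0(2)[OF assms(5)] ci v_pos[OF ci] by auto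
  define d where "d = (\<lambda>j. c j / c i0)"
  have "\<exists>n::int. v (d j - of_int n) < 1" if "j < length es" for j
    using that i0 assms(3) v_pos[OF c0] by (intro Qp_int_approx) (auto simp: d_def v_divide)
  then obtain k where k: "\<And>j. j < length es \<Longrightarrow> v (d j - of_int (k j)) < 1" by metis
  have d0: "(\<Sum>j<length es. d j * es ! j) = 0"
    using assms(4) by (simp add: d_def flip: sum_divide_distrib)
  have "v (\<Sum>j<length es. (d j - of_int (k j)) * es ! j) < 1"
  proof (rule v_sum_less)
    fix j assume "j \<in> {..<length es}"
    then have "v (d j - of_int (k j)) < 1" "v (es ! j) \<le> 1" using k assms(2) by auto
    then have "v (d j - of_int (k j)) * v (es ! j) \<le> v (d j - of_int (k j)) * 1" by (intro mult_left_mono) auto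
    then show "v ((d j - of_int (k j)) * es ! j) < 1" unfolding v_mult using \<open>v (d j - of_int (k j)) < 1\<close> by simp
  qed simp
  then have "v (\<Sum>j<length es. of_int (k j) * es ! j) < 1"
    using d0 by (simp add: left_diff_distrib sum_subtractf)
  then have "int p dvd k i0" using assms(1) i0 unfolding resind_def by blast
  then have "v (of_int (k i0)) < 1" using v_of_int_less_1_iff by simp
  moreover have "v (1 - of_int (k i0)) < 1" using k[OF i0(1)] c0 by (simp add: d_def)
  ultimately have "v ((1 - of_int (k i0)) + of_int (k i0)) < 1" by (rule v_add_less[rotated])
  then show False by simp
qed

text \<open>In a nontrivial residue relation the coefficient of \<open>u\<close> is prime to
  \<open>p\<close>, since otherwise \<open>es\<close> itself would be related; multiplying by its
  inverse modulo \<open>p\<close> solves for \<open>u\<close>.\<close>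

lemma resind_extend:
  assumes es: "resind es" and u: "v u \<le> 1" and nr: "\<not> resind (es @ [u])"
  shows "\<exists>k :: nat \<Rightarrow> int. v (u - (\<Sum>i<length es. of_int (k i) * es ! i)) < 1"
proof -
  let ?n = "length es"
  obtain k :: "nat \<Rightarrow> int" where k: "v (\<Sum>i<Suc ?n. of_int (k i) * (es @ [u]) ! i) < 1" "\<exists>i<Suc ?n. \<not> int p dvd k i"
    using nr unfolding resind_def by auto
  define s where "s = (\<Sum>i<?n. of_int (k i) * es ! i)"
  have "(\<Sum>i<Suc ?n. of_int (k i) * (es @ [u]) ! i) = s + of_int (k ?n) * u"
    by (simp add: s_def nth_append)
  then have su: "v (s + of_int (k ?n) * u) < 1" using k(1) by simp
  have "\<not> int p dvd k ?n"
  proof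
    assume *: "int p dvd k ?n"
    then have "v (of_int (k ?n)) < 1" using v_of_int_less_1_iff by simp
    then have "v (of_int (k ?n) * u) < 1"
      using mult_left_mono[OF u, of "v (of_int (k ?n))"] by (simp add: v_mult)
    then have "v ((s + of_int (k ?n) * u) - of_int (k ?n) * u) < 1" using su by (rule v_diff_less[rotated])
    then have "\<forall>i<?n. int p dvd k i" using es unfolding resind_def s_def by simp
    then show False using k(2) * less_Suc_eq by auto
  qed
  then have "coprime (k ?n) (int p)" using prime_p
    by (metis coprime_commute prime_imp_coprime prime_nat_int_transfer)
  then obtain m where m: "[k ?n * m = 1] (mod int p)" using cong_solve_coprime_int by blast
  then have "int p dvd (k ?n * m - 1)" by (simp add: cong_iff_dvd_diff)
  then have vm: "v (of_int (k ?n * m - 1)) < 1" using v_of_int_less_1_iff by blast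
  have "v (of_int m * (s + of_int (k ?n) * u)) < 1"
    using mult_right_mono[OF v_of_int_le[of m], of "v (s + of_int (k ?n) * u)"] su by (simp add: v_mult)
  moreover have "v (of_int (k ?n * m - 1) * u) < 1"
    using mult_left_mono[OF u, of "v (of_int (k ?n * m - 1))"] vm by (simp only: v_mult) simp
  ultimately have "v (of_int m * (s + of_int (k ?n) * u) - of_int (k ?n * m - 1) * u) < 1" by (rule v_diff_less)
  then have "v (u - (- of_int m * s)) < 1" by (simp add: algebra_simps)
  moreover have "- of_int m * s = (\<Sum>i<?n. of_int (- m * k i) * es ! i)"
    by (simp add: s_def sum_distrib_left sum_negf mult.assoc)
  ultimately have "v (u - (\<Sum>i<?n. of_int (- m * k i) * es ! i)) < 1" by metis
  then show ?thesis by (intro exI[of _ "\<lambda>i. - m * k i"])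
qed

section \<open>The residue field of an unramified extension\<close>

context
  fixes U :: "'a set" and n :: nat
  assumes U: "is_subfield U" "Qp \<subseteq> U" "has_degree Qp U n" "unramified_over v Qp U" and n_pos: "n > 0"
begin

lemma U_ops: "0 \<in> U" "1 \<in> U" "x \<in> U \<Longrightarrow> y \<in> U \<Longrightarrow> x + y \<in> U" "x \<in> U \<Longrightarrow> y \<in> U \<Longrightarrow> x - y \<in> U"
  "x \<in> U \<Longrightarrow> y \<in> U \<Longrightarrow> x * y \<in> U" "x \<in> U \<Longrightarrow> inverse x \<in> U" "x \<in> Qp \<Longrightarrow> x \<in> U"
  using U(1,2) by (auto simp: is_subfield_def)

lemma U_power: "x \<in> U \<Longrightarrow> x ^ k \<in> U"
  by (induction k) (auto intro: U_ops)

lemma U_sum: "(\<And>i. i \<in> I \<Longrightarrow> f i \<in> U) \<Longrightarrow> sum f I \<in> U"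
  by (induction I rule: infinite_finite_induct) (auto intro: U_ops)

lemma U_basis: obtains bs where "length bs = n" "U = Qp_span bs"
  "\<forall>c. (\<forall>i<n. c i \<in> Qp) \<longrightarrow> (\<Sum>i<n. c i * bs ! i) = 0 \<longrightarrow> (\<forall>i<n. c i = 0)"
proof -
  obtain bs where bs: "length bs = n"
    "\<And>cs. length cs = n \<Longrightarrow> set cs \<subseteq> Qp \<Longrightarrow> lin_comb cs bs = 0 \<Longrightarrow> (\<forall>c\<in>set cs. c = 0)"
    "U = {lin_comb cs bs | cs. length cs = n \<and> set cs \<subseteq> Qp}"
    using U(3) unfolding has_degree_def by blast
  show thesis
  proof (rule that[OF bs(1)])
    show "U = Qp_span bs" using bs Qp_span_lin_comb by simp
    have "c i = 0" if c: "\<forall>i<n. c i \<in> Qp" "(\<Sum>i<n. c i * bs ! i) = 0" "i < n" for c i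
    proof -
      have "lin_comb (map c [0..<n]) bs = 0" using bs(1) c(2) by (subst lin_comb_sum) auto
      then have "\<forall>x\<in>set (map c [0..<n]). x = 0" using c(1) by (intro bs(2)) auto
      then show ?thesis using c(3) by simp
    qed
    then show "\<forall>c. (\<forall>i<n. c i \<in> Qp) \<longrightarrow> (\<Sum>i<n. c i * bs ! i) = 0 \<longrightarrow> (\<forall>i<n. c i = 0)" by blast
  qed
qed

lemma U_complete: "v_complete U"
proof -
  obtain bs where "U = Qp_span bs" using U_basis by blast
  then show ?thesis using Qp_span_complete by simp
qed

lemma U_fin_alg: "fin_alg U"
proof -
  obtain bs where "U = Qp_span bs" using U_basis by blast
  then show ?thesis unfolding fin_alg_def using U_ops by blast
qed

text \<open>The unramified hypothesis enters here: the values are integral powers of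
  \<open>p\<close>, so none lies strictly between \<open>1 / p\<close> and 1.\<close>

lemma U_small: assumes "y \<in> U" "v y < 1" shows "v y \<le> 1 / real p"
proof (cases "y = 0")
  case False
  then have "v y \<in> v ` (Qp - {0})" using U(4) assms unfolding unramified_over_def by blast
  then obtain z where z: "v y = v z" "z \<in> Qp" "z \<noteq> 0" by blast
  obtain m :: int where m: "v z = real p powr real_of_int m" using v_Qp_powr z by blast
  have "real p powr real_of_int m < real p powr 0" using m z assms by simp
  then have "real_of_int m < 0" using p_pos(3) by (metis powr_less_cancel_iff)
  then have "real p powr real_of_int m \<le> real p powr (-1)" using p_pos(3) by (intro powr_mono) auto
  then show ?thesis using m z by (simp add: powr_minus_divide)
qed simp

text \<open>Successive approximation: by \<open>U_small\<close> the error of a residue approximation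
  is divisible by \<open>p\<close>; divide and repeat. The limit stays in the span because the span
  is complete.\<close>

lemma U_span_of_residues:
  assumes es: "set es \<subseteq> U"
    and approx: "\<And>u. u \<in> U \<Longrightarrow> v u \<le> 1 \<Longrightarrow> \<exists>k :: nat \<Rightarrow> int. v (u - (\<Sum>i<length es. of_int (k i) * es ! i)) < 1"
  shows "U \<subseteq> Qp_span es"
proof
  have comb: "(\<Sum>i<length es. of_int (k i) * es ! i) \<in> Qp_span es" for k
    unfolding Qp_span_lin_comb
    by (intro CollectI exI[of _ "map (\<lambda>i. of_int (k i)) [0..<length es]"]) (auto simp: lin_comb_sum)
  have combU: "(\<Sum>i<length es. of_int (k i) * es ! i) \<in> U" for k
    using es by (intro U_sum U_ops(5)) (auto intro: U_ops(7))
  have integral: "u \<in> Qp_span es" if u: "u \<in> U" "v u \<le> 1" for u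
  proof -
    have "\<exists>w\<in>Qp_span es. u - w \<in> U \<and> v (u - w) \<le> (1 / real p) ^ j" for j
    proof (induction j)
      case 0
      show ?case using u by (intro bexI[of _ 0]) auto
    next
      case (Suc j)
      then obtain w where w: "w \<in> Qp_span es" "u - w \<in> U" "v (u - w) \<le> (1 / real p) ^ j" by blast
      define x where "x = (u - w) / of_nat p ^ j"
      have pj: "(of_nat p ^ j :: 'a) \<in> Qp" using Qp_of_nat[of "p ^ j"] by simp
      have "v x \<le> 1" using w(3) by (simp add: x_def v_divide v_power v_p divide_le_eq)
      moreover have "x \<in> U" unfolding x_def divide_inverse using w pj by (intro U_ops(5,6)) (auto intro: U_ops)
      ultimately obtain k where k: "v (x - (\<Sum>i<length es. of_int (k i) * es ! i)) < 1" using approx by blast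
      define y where "y = x - (\<Sum>i<length es. of_int (k i) * es ! i)"
      have y: "y \<in> U" "v y \<le> 1 / real p" using k \<open>x \<in> U\<close> combU by (auto simp: y_def intro!: U_small U_ops(4))
      define w' where "w' = w + of_nat p ^ j * (\<Sum>i<length es. of_int (k i) * es ! i)"
      have "of_nat p ^ j * x = u - w" by (simp add: x_def)
      then have "u - w' = of_nat p ^ j * y" by (simp add: w'_def y_def right_diff_distrib)
      moreover have "v (of_nat p ^ j * y) \<le> (1 / real p) ^ Suc j"
        using mult_left_mono[OF y(2), of "(1 / real p) ^ j"] by (simp add: v_mult v_power v_p mult.commute)
      moreover have "of_nat p ^ j * y \<in> U" using y pj by (intro U_ops(5)) (auto intro: U_ops)
      moreover have "w' \<in> Qp_span es" unfolding w'_def using w pj comb by (intro Qp_span_add Qp_span_scale)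
      ultimately show ?case by (intro bexI[of _ w']) simp_all
    qed
    then obtain W where W: "\<And>j. W j \<in> Qp_span es" "\<And>j. v (u - W j) \<le> (1 / real p) ^ j" by metis
    have "conv_to v W u"
    proof (rule conv_to_bound)
      show "(\<lambda>j. (1 / real p) ^ j) \<longlonglongrightarrow> 0" by (intro LIMSEQ_realpow_zero) auto
    qed (use W in \<open>simp add: v_diff_commute[of _ u]\<close>)
    then show ?thesis using v_completeD[OF Qp_span_complete] W by blast
  qed
  fix u assume u: "u \<in> U"
  obtain N where N: "v u < real p ^ N" using real_arch_pow[of "real p" "v u"] by auto
  have pN: "(of_nat p ^ N :: 'a) \<in> Qp" using Qp_of_nat[of "p ^ N"] by simp
  have "v (of_nat p ^ N * u) \<le> 1" using N by (simp add: v_mult v_power v_p power_one_over)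
  moreover have "of_nat p ^ N * u \<in> U" using u pN by (intro U_ops(5)) (auto intro: U_ops)
  ultimately have "of_nat p ^ N * u \<in> Qp_span es" using integral by blast
  then have "inverse (of_nat p ^ N) * (of_nat p ^ N * u) \<in> Qp_span es" by (rule Qp_span_scale[OF Qp_inverse[OF pN]])
  moreover have "inverse (of_nat p ^ N) * (of_nat p ^ N * u) = u" by (simp add: field_simps)
  ultimately show "u \<in> Qp_span es" by metis
qed

text \<open>Residue degree equals degree. A maximal independent family of residues with fewer than
  \<open>n\<close> members would span \<open>U\<close>, against its dimension; a family with
  \<open>n + 1\<close> members would be linearly independent in \<open>U\<close>.\<close>

lemma residue_basis:
  obtains es where "length es = n" "set es \<subseteq> U" "\<And>e. e \<in> set es \<Longrightarrow> v e \<le> 1" "resind es"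
    "\<And>u. u \<in> U \<Longrightarrow> v u \<le> 1 \<Longrightarrow> \<exists>k :: nat \<Rightarrow> int. v (u - (\<Sum>i<n. of_int (k i) * es ! i)) < 1"
proof -
  obtain bs where bs: "length bs = n" "U = Qp_span bs"
    "\<forall>c. (\<forall>i<n. c i \<in> Qp) \<longrightarrow> (\<Sum>i<n. c i * bs ! i) = 0 \<longrightarrow> (\<forall>i<n. c i = 0)"
    using U_basis by blast
  have bsU: "bs ! i \<in> U" if "i < n" for i
  proof -
    have "bs ! i = (\<Sum>j<n. map (\<lambda>j. if j = i then 1 else 0) [0..<n] ! j * bs ! j)"
      using that by (simp add: if_distrib[of "\<lambda>c. c * _"] cong: if_cong)
    then have "bs ! i = lin_comb (map (\<lambda>j. if j = i then 1 else 0) [0..<n]) bs"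
      using bs(1) by (subst lin_comb_sum) auto
    then show ?thesis unfolding bs(2) Qp_span_lin_comb using bs(1)
      by (intro CollectI exI[of _ "map (\<lambda>j. if j = i then 1 else 0) [0..<n]"]) auto
  qed
  have "\<exists>es. length es = f \<and> set es \<subseteq> U \<and> (\<forall>e\<in>set es. v e \<le> 1) \<and> resind es" if "f \<le> n" for f
    using that
  proof (induction f)
    case 0
    show ?case by (simp add: resind_def)
  next
    case (Suc f)
    then obtain es where es: "length es = f" "set es \<subseteq> U" "\<forall>e\<in>set es. v e \<le> 1" "resind es" by auto
    have "\<exists>u. u \<in> U \<and> v u \<le> 1 \<and> resind (es @ [u])"
    proof (rule ccontr)
      assume "\<not> ?thesis"
      then have "U \<subseteq> Qp_span es" using resind_extend[OF es(4)] by (intro U_span_of_residues es) blast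
      then have "\<exists>c. (\<forall>i\<in>{..<n}. c i \<in> Qp) \<and> (\<exists>i\<in>{..<n}. c i \<noteq> 0) \<and> (\<Sum>i\<in>{..<n}. c i * bs ! i) = 0"
        using Suc.prems es(1) bsU by (intro Qp_span_dependent[of _ _ es]) auto
      then show False using bs(3) by (metis lessThan_iff)
    qed
    then obtain u where "u \<in> U" "v u \<le> 1" "resind (es @ [u])" by blast
    then show ?case using es by (intro exI[of _ "es @ [u]"]) auto
  qed
  then obtain es where es: "length es = n" "set es \<subseteq> U" "\<forall>e\<in>set es. v e \<le> 1" "resind es" by blast
  have "\<exists>k :: nat \<Rightarrow> int. v (u - (\<Sum>i<n. of_int (k i) * es ! i)) < 1" if u: "u \<in> U" "v u \<le> 1" for u
  proof -
    have "\<not> resind (es @ [u])"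
    proof
      assume r: "resind (es @ [u])"
      have "\<exists>c. (\<forall>i\<in>{..<Suc n}. c i \<in> Qp) \<and> (\<exists>i\<in>{..<Suc n}. c i \<noteq> 0) \<and> (\<Sum>i\<in>{..<Suc n}. c i * (es @ [u]) ! i) = 0"
        using es u bs(1,2) nth_mem by (intro Qp_span_dependent[of _ _ bs]) (fastforce simp: nth_append less_Suc_eq)+
      then obtain c where c: "\<forall>i\<in>{..<Suc n}. c i \<in> Qp" "\<exists>i\<in>{..<Suc n}. c i \<noteq> 0" "(\<Sum>i<Suc n. c i * (es @ [u]) ! i) = 0" by blast
      have "c i = 0" if "i < Suc n" for i
        by (rule resind_independent[OF r]) (use c es u that in auto)
      then show False using c(2) by auto
    qed
    then show ?thesis using resind_extend[OF es(4) u(2)] es(1) by simp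
  qed
  then show thesis using that es by blast
qed

text \<open>Each of the \<open>p ^ n\<close> residue classes of \<open>U\<close> contains a root of
  \<open>t ^ (p ^ n) - t\<close> in \<open>U\<close>. Distinct classes give distinct roots, and the
  polynomial has no more than \<open>p ^ n\<close> of them.\<close>

lemma roots_of_unity_mem:
  assumes z: "z ^ (p ^ n) = z" shows "z \<in> U"
proof -
  obtain es where es: "length es = n" "set es \<subseteq> U" "\<And>e. e \<in> set es \<Longrightarrow> v e \<le> 1" "resind es"
    and app: "\<And>u. u \<in> U \<Longrightarrow> v u \<le> 1 \<Longrightarrow> \<exists>k :: nat \<Rightarrow> int. v (u - (\<Sum>i<n. of_int (k i) * es ! i)) < 1"
    using residue_basis by blast
  \<comment> \<open>Digit vectors indexing the residue field, with \<open>r\<close> choosing a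
    representative in \<open>U\<close>.\<close>
  define K where "K = {ks :: nat list. set ks \<subseteq> {0..<p} \<and> length ks = n}"
  define r where "r = (\<lambda>ks. \<Sum>i<n. of_nat (ks ! i) * es ! i)"
  have K: "finite K" "card K = p ^ n"
    unfolding K_def using card_lists_length_eq[of "{0..<p}" n] finite_lists_length_eq[of "{0..<p}" n] by auto
  have eU: "es ! i \<in> U" "v (es ! i) \<le> 1" if "i < n" for i using es that by (auto simp: subset_iff)
  have rU: "r ks \<in> U" "v (r ks) \<le> 1" for ks
  proof -
    show "r ks \<in> U" unfolding r_def using eU by (intro U_sum U_ops(5)) (auto intro: U_ops(7))
    show "v (r ks) \<le> 1" unfolding r_def
    proof (rule v_sum_le)
      fix i assume "i \<in> {..<n}"
      then show "v (of_nat (ks ! i) * es ! i) \<le> 1" unfolding v_mult using eU[of i] v_of_nat_le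
        by (intro mult_le_one) auto
    qed simp
  qed
  have r_inj: "ks = ks'" if k: "ks \<in> K" "ks' \<in> K" and "v (r ks - r ks') < 1" for ks ks'
  proof -
    have "r ks - r ks' = (\<Sum>i<length es. of_int (int (ks ! i) - int (ks' ! i)) * es ! i)"
      by (simp add: r_def es(1) left_diff_distrib sum_subtractf)
    then have "\<forall>i<length es. int p dvd int (ks ! i) - int (ks' ! i)"
      using that(3) es(4) unfolding resind_def by metis
    then have d: "int p dvd int (ks ! i) - int (ks' ! i)" if "i < n" for i using that es(1) by simp
    show ?thesis
    proof (rule nth_equalityI)
      show "length ks = length ks'" using k by (simp add: K_def)
      fix i assume "i < length ks"
      then have "i < n" "ks ! i \<in> set ks" "ks' ! i \<in> set ks'" using k by (simp_all add: K_def)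
      moreover have "set ks \<subseteq> {0..<p}" "set ks' \<subseteq> {0..<p}" using k by (simp_all add: K_def)
      ultimately have i: "i < n" "ks ! i < p" "ks' ! i < p" by auto
      then have "[int (ks ! i) = int (ks' ! i)] (mod int p)" using d by (simp add: cong_iff_dvd_diff)
      then show "ks ! i = ks' ! i" using i by (simp add: cong_int_iff cong_def)
    qed
  qed
  have r_ex: "\<exists>ks\<in>K. v (u - r ks) < 1" if u: "u \<in> U" "v u \<le> 1" for u
  proof -
    obtain k where k: "v (u - (\<Sum>i<n. of_int (k i) * es ! i)) < 1" using app u by blast
    define ks where "ks = map (\<lambda>i. nat (k i mod int p)) [0..<n]"
    have ksK: "ks \<in> K" by (auto simp: ks_def K_def nat_less_iff)
    have "(\<Sum>i<n. of_int (k i) * es ! i) - r ks = (\<Sum>i<n. of_int (k i - k i mod int p) * es ! i)"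
      unfolding r_def sum_subtractf[symmetric] by (intro sum.cong refl) (simp add: ks_def algebra_simps)
    moreover have "v (\<Sum>i<n. of_int (k i - k i mod int p) * es ! i) < 1"
    proof (rule v_sum_less)
      fix i assume i: "i \<in> {..<n}"
      have "int p dvd k i - k i mod int p" by (simp add: dvd_minus_mod)
      then have "v (of_int (k i - k i mod int p)) < 1" using v_of_int_less_1_iff by blast
      moreover have "v (of_int (k i - k i mod int p)) * v (es ! i) \<le> v (of_int (k i - k i mod int p)) * 1"
        using eU i by (intro mult_left_mono) auto
      ultimately show "v (of_int (k i - k i mod int p) * es ! i) < 1" unfolding v_mult by simp
    qed simp
    ultimately have "v ((u - (\<Sum>i<n. of_int (k i) * es ! i)) + ((\<Sum>i<n. of_int (k i) * es ! i) - r ks)) < 1"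
      using k by (intro v_add_less) auto
    then show ?thesis using ksK by (intro bexI[of _ ks]) simp_all
  qed
  define z0 where "z0 = replicate n (0::nat)"
  have z0: "z0 \<in> K" "r z0 = 0" by (auto simp: z0_def K_def r_def)
  have r_unit: "v (r ks) = 1" if "ks \<in> K - {z0}" for ks
    using r_inj[of ks z0] that z0 rU(2)[of ks] by force
  text \<open>Lagrange's theorem in the multiplicative group of the residue field: multiplication by a unit permutes
    the nonzero residue classes.\<close>
  have lagrange: "v (u ^ (p ^ n) - u) < 1" if u: "u \<in> U" "v u \<le> 1" for u
  proof (cases "v u < 1")
    case True
    have "v u ^ (p ^ n) \<le> v u ^ 1" using True by (intro power_decreasing) (auto simp: Suc_le_eq)
    then show ?thesis using True by (intro v_diff_less) (auto simp: v_power)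
  next
    case False
    then have vu: "v u = 1" using u by simp
    then have u0: "u \<noteq> 0" by auto
    define N where "N = K - {z0}"
    have N: "finite N" "card N = p ^ n - 1" using K z0 by (auto simp: N_def)
    have "\<forall>ks\<in>N. \<exists>ks'\<in>K. v (u * r ks - r ks') < 1"
    proof
      fix ks assume "ks \<in> N"
      show "\<exists>ks'\<in>K. v (u * r ks - r ks') < 1" using u rU by (intro r_ex U_ops(5)) (auto simp: v_mult mult_le_one)
    qed
    then obtain g where g: "\<And>ks. ks \<in> N \<Longrightarrow> g ks \<in> K" "\<And>ks. ks \<in> N \<Longrightarrow> v (u * r ks - r (g ks)) < 1" by metis
    have gN: "g ks \<in> N" if "ks \<in> N" for ks
    proof -
      have "v (u * r ks) = 1" using vu r_unit that by (simp add: v_mult N_def)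
      then have "g ks \<noteq> z0" using g(2)[OF that] z0 by auto
      then show ?thesis using g that by (simp add: N_def)
    qed
    have "inj_on g N"
    proof (rule inj_onI)
      fix ks ks' assume k: "ks \<in> N" "ks' \<in> N" "g ks = g ks'"
      have "v ((u * r ks - r (g ks)) - (u * r ks' - r (g ks'))) < 1" using g k by (intro v_diff_less[of "u * r ks - r (g ks)"])
      then have "v (u * (r ks - r ks')) < 1" using k by (simp add: algebra_simps)
      then have "v (r ks - r ks') < 1" using vu by (simp add: v_mult)
      then show "ks = ks'" using r_inj k by (simp add: N_def)
    qed
    then have bij: "g ` N = N" using N gN by (intro endo_inj_surj) auto
    define w where "w = (\<lambda>ks. r (g ks) / (u * r ks))"
    have w: "unit1 (w ks)" if "ks \<in> N" for ks
    proof -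
      have vr: "v (u * r ks) = 1" using vu r_unit that by (simp add: v_mult N_def)
      then have "u * r ks \<noteq> 0" by auto
      then have "w ks - 1 = (r (g ks) - u * r ks) / (u * r ks)" by (simp add: w_def field_simps)
      then have "v (w ks - 1) = v (u * r ks - r (g ks))" using vr by (simp add: v_divide v_diff_commute[of "r (g ks)"])
      then show ?thesis using g(2)[OF that] by (simp add: unit1_def)
    qed
    have rn0: "r ks \<noteq> 0" if "ks \<in> N" for ks using r_unit that by (force simp: N_def)
    have "prod r N = prod r (g ` N)" using bij by simp
    also have "\<dots> = (\<Prod>ks\<in>N. r (g ks))" using \<open>inj_on g N\<close> by (simp add: prod.reindex)
    also have "\<dots> = (\<Prod>ks\<in>N. u * r ks * w ks)" using rn0 u0 by (intro prod.cong refl) (simp add: w_def)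
    also have "\<dots> = u ^ (p ^ n - 1) * prod r N * prod w N" by (simp add: prod.distrib N)
    finally have "prod r N = prod r N * (u ^ (p ^ n - 1) * prod w N)" by (simp add: mult_ac)
    moreover have "prod r N \<noteq> 0" using rn0 N by simp
    ultimately have one: "u ^ (p ^ n - 1) * prod w N = 1" by simp
    have pw: "unit1 (prod w N)" using w unit1_prod by blast
    have "u ^ (p ^ n - 1) = inverse (prod w N)" using one unit1_nonzero[OF pw] by (simp add: field_simps)
    then have "v (u ^ (p ^ n - 1) - 1) < 1" using unit1_inverse[OF pw] by (simp add: unit1_def)
    moreover have "u ^ (p ^ n) - u = u * (u ^ (p ^ n - 1) - 1)"
      by (simp add: algebra_simps flip: power_Suc)
    ultimately show ?thesis by (simp only: v_mult vu)
  qed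
  \<comment> \<open>The Teichmueller representative as the limit of iterated \<open>p ^ n\<close>-th
    powers: \<open>lagrange\<close> starts with error \<open>1 / p\<close>, and
    \<open>prime_power_pow_diff\<close> gains a factor \<open>1 / p\<close> per step.\<close>
  have teich: "\<exists>t. t \<in> U \<and> t ^ (p ^ n) = t \<and> v (t - u) < 1" if u: "u \<in> U" "v u \<le> 1" for u
  proof -
    define X where "X = (\<lambda>j. u ^ ((p ^ n) ^ j))"
    obtain n' where n': "n = Suc n'" using n_pos by (cases n) auto
    have XS: "X (Suc j) = X j ^ (p ^ n)" for j unfolding X_def power_Suc2 by (rule power_mult)
    have XU: "X j \<in> U" "v (X j) \<le> 1" for j using u by (auto simp: X_def v_power power_le_one intro: U_power)
    have step: "v (X (Suc j) - X j) \<le> (1 / real p) ^ Suc j" for j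
    proof (induction j)
      case 0
      have "v (u ^ (p ^ n) - u) \<le> 1 / real p" using lagrange[OF u] u by (intro U_small U_ops(4) U_power)
      then show ?case by (simp add: X_def)
    next
      case (Suc j)
      have le: "(1 / real p) ^ Suc j \<le> (1 / real p) ^ 1" by (intro power_decreasing) auto
      have "v (X (Suc j) ^ (p ^ n) - X j ^ (p ^ n)) \<le> v (X (Suc j) - X j) / real p"
        unfolding n' using XU Suc le by (intro prime_power_pow_diff) auto
      also have "\<dots> \<le> (1 / real p) ^ Suc j / real p" using Suc by (intro divide_right_mono) auto
      finally show ?case using XS by simp
    qed
    have lim0: "(\<lambda>j. (1 / real p) ^ Suc j) \<longlonglongrightarrow> 0" by (intro LIMSEQ_Suc LIMSEQ_realpow_zero) auto
    have "cauchy_v v X" by (rule cauchy_v_of_consecutive[OF step lim0])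
    then obtain t where t: "t \<in> U" "conv_to v X t" using U_complete XU unfolding v_complete_def by blast
    have "conv_to v (\<lambda>j. X (Suc j)) t" using t(2) unfolding conv_to_iff_LIMSEQ by (rule LIMSEQ_Suc)
    moreover have "conv_to v (\<lambda>j. X (Suc j)) (t ^ (p ^ n))" unfolding XS by (rule conv_to_power[OF t(2)])
    ultimately have "t ^ (p ^ n) = t" using conv_to_unique by blast
    moreover have "v (t - u) \<le> 1 / real p"
    proof (rule conv_to_le)
      show "conv_to v (\<lambda>j. X j - u) (t - u)" using t(2) by (intro conv_to_diff) auto
      fix j assume "j \<ge> (0::nat)"
      show "v (X j - u) \<le> 1 / real p"
      proof (induction j)
        case (Suc j)
        have "(1 / real p) ^ Suc j \<le> (1 / real p) ^ 1" by (intro power_decreasing) auto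
        then have "v ((X (Suc j) - X j) + (X j - u)) \<le> 1 / real p"
          using step[of j] Suc by (intro v_add_le) auto
        then show ?case by simp
      qed (simp add: X_def)
    qed
    moreover have "1 / real p < 1" by simp
    ultimately show ?thesis using t(1) by (intro exI[of _ t]) linarith
  qed
  then have "\<forall>ks. \<exists>t. t \<in> U \<and> t ^ (p ^ n) = t \<and> v (t - r ks) < 1" using rU by blast
  then obtain T where T: "\<And>ks. T ks \<in> U" "\<And>ks. T ks ^ (p ^ n) = T ks" "\<And>ks. v (T ks - r ks) < 1" by metis
  have "inj_on T K"
  proof (rule inj_onI)
    fix ks ks' assume k: "ks \<in> K" "ks' \<in> K" "T ks = T ks'"
    have "v ((T ks' - r ks') - (T ks - r ks)) < 1" using T by (intro v_diff_less[of "T ks' - r ks'"])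
    then show "ks = ks'" using r_inj k by simp
  qed
  then have cT: "card (T ` K) = p ^ n" using K by (simp add: card_image)
  define F :: "'a poly" where "F = Polynomial.monom 1 (p ^ n) - Polynomial.monom 1 1"
  have pn: "p ^ n > 1" using n_pos p_ge_2 by (intro one_less_power) auto
  have dF: "degree F \<le> p ^ n" unfolding F_def using pn by (intro degree_diff_le) (auto simp: degree_monom_eq)
  have "coeff F 1 = -1" using pn n_pos by (simp add: F_def)
  then have F0: "F \<noteq> 0" by auto
  have roots: "{x. poly F x = 0} = {x. x ^ (p ^ n) = x}" by (simp add: F_def poly_monom)
  have "finite {x. poly F x = 0}" "card {x. poly F x = 0} \<le> p ^ n"
    using F0 dF card_poly_roots_bound[of F] poly_roots_finite[of F] by auto
  moreover have "T ` K \<subseteq> {x. poly F x = 0}" unfolding roots using T by auto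
  ultimately have "T ` K = {x. poly F x = 0}" using cT by (intro card_seteq) auto
  then have "z \<in> T ` K" unfolding roots using z by simp
  then show ?thesis using T by auto
qed

end

end

section \<open>Embeddings\<close>

lemma subfieldD:
  assumes "is_subfield M"
  shows "0 \<in> M" "1 \<in> M" "x \<in> M \<Longrightarrow> y \<in> M \<Longrightarrow> x + y \<in> M" "x \<in> M \<Longrightarrow> y \<in> M \<Longrightarrow> x - y \<in> M"
    "x \<in> M \<Longrightarrow> y \<in> M \<Longrightarrow> x * y \<in> M" "x \<in> M \<Longrightarrow> inverse x \<in> M"
  using assms by (auto simp: is_subfield_def)

locale embedding =
  fixes E M :: "'a::field_char_0 set" and \<sigma> :: "'a \<Rightarrow> 'a"
  assumes M: "is_subfield M" and EM: "E \<subseteq> M" and emb: "emb_over E M \<sigma>"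
begin

lemmas MD = subfieldD[OF M]

lemma emb_add: "x \<in> M \<Longrightarrow> y \<in> M \<Longrightarrow> \<sigma> (x + y) = \<sigma> x + \<sigma> y"
  and emb_mult: "x \<in> M \<Longrightarrow> y \<in> M \<Longrightarrow> \<sigma> (x * y) = \<sigma> x * \<sigma> y"
  and emb_1: "\<sigma> 1 = 1" and emb_fix: "x \<in> E \<Longrightarrow> \<sigma> x = x"
  using emb by (auto simp: emb_over_def)

lemma emb_0: "\<sigma> 0 = 0"
  using emb_add[of 0 0] MD by simp

lemma emb_diff: assumes "x \<in> M" "y \<in> M" shows "\<sigma> (x - y) = \<sigma> x - \<sigma> y"
  using emb_add[of "x - y" y] assms MD by simp

lemma M_sum: "(\<And>i. i \<in> I \<Longrightarrow> f i \<in> M) \<Longrightarrow> sum f I \<in> M"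
  by (induction I rule: infinite_finite_induct) (auto intro: MD)

lemma emb_sum: "(\<And>i. i \<in> I \<Longrightarrow> f i \<in> M) \<Longrightarrow> \<sigma> (sum f I) = (\<Sum>i\<in>I. \<sigma> (f i))"
  by (induction I rule: infinite_finite_induct) (auto simp: emb_0 emb_add M_sum)

lemma M_power: "x \<in> M \<Longrightarrow> x ^ n \<in> M"
  by (induction n) (auto intro: MD)

lemma emb_power: "x \<in> M \<Longrightarrow> \<sigma> (x ^ n) = \<sigma> x ^ n"
  by (induction n) (auto simp: emb_1 emb_mult M_power)

lemma emb_inverse: assumes "x \<in> M" shows "\<sigma> (inverse x) = inverse (\<sigma> x)"
proof (cases "x = 0")
  case False
  then have "\<sigma> x * \<sigma> (inverse x) = 1" using assms emb_mult[of x "inverse x"] MD emb_1 by simp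
  then show ?thesis by (simp add: inverse_unique)
qed (simp add: emb_0)

lemma emb_inj: "inj_on \<sigma> M"
proof (rule inj_onI)
  fix x y assume xy: "x \<in> M" "y \<in> M" "\<sigma> x = \<sigma> y"
  show "x = y"
  proof (rule ccontr)
    assume "x \<noteq> y"
    then have "1 = \<sigma> ((x - y) * inverse (x - y))" using emb_1 by simp
    also have "\<dots> = \<sigma> (x - y) * \<sigma> (inverse (x - y))" using xy MD by (intro emb_mult) auto
    also have "\<dots> = 0" using xy by (simp add: emb_diff)
    finally show False by simp
  qed
qed

text \<open>An embedding permutes the finitely many roots in \<^term>\<open>M\<close> of a polynomial over the base.\<close>
lemma emb_surj:
  assumes into: "\<sigma> ` M \<subseteq> M" and alg: "\<And>x. x \<in> M \<Longrightarrow> algebraic_over E x"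
  shows "\<sigma> ` M = M"
proof (intro equalityI into subsetI)
  fix x assume x: "x \<in> M"
  obtain P where P: "P \<noteq> 0" "\<And>i. coeff P i \<in> E" "poly P x = 0" using alg[OF x] unfolding algebraic_over_def by blast
  define Z where "Z = {z \<in> M. poly P z = 0}"
  have "finite Z" unfolding Z_def using poly_roots_finite[OF P(1)] by simp
  moreover have "\<sigma> ` Z \<subseteq> Z"
  proof
    fix y assume "y \<in> \<sigma> ` Z"
    then obtain z where z: "z \<in> M" "poly P z = 0" "y = \<sigma> z" by (auto simp: Z_def)
    have "\<sigma> (poly P z) = poly P (\<sigma> z)"
      unfolding poly_altdef using z P(2) EM
      by (subst emb_sum) (auto intro!: sum.cong MD M_power simp: emb_mult M_power emb_power emb_fix subset_iff)
    then show "y \<in> Z" using z into emb_0 by (auto simp: Z_def)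
  qed
  moreover have "inj_on \<sigma> Z" using emb_inj by (rule inj_on_subset) (auto simp: Z_def)
  ultimately have "\<sigma> ` Z = Z" by (rule endo_inj_surj)
  moreover have "x \<in> Z" using x P by (simp add: Z_def)
  ultimately show "x \<in> \<sigma> ` M" by (auto simp: Z_def)
qed

definition emb_fps :: "'a fps \<Rightarrow> 'a fps" where "emb_fps P = Abs_fps (\<lambda>n. \<sigma> (P $ n))"

text \<open>\<open>emb_over\<close> says nothing about the map outside \<open>M\<close>, so
  identities for \<open>emb_fps\<close> carry this membership condition.\<close>

definition M_fps :: "'a fps set" where "M_fps = {P. \<forall>n. P $ n \<in> M}"

lemma emb_fps_nth [simp]: "emb_fps P $ n = \<sigma> (P $ n)"
  by (simp add: emb_fps_def)

lemma M_fps_mult: "P \<in> M_fps \<Longrightarrow> Q \<in> M_fps \<Longrightarrow> P * Q \<in> M_fps"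
  by (auto simp: M_fps_def fps_mult_nth intro!: M_sum MD)

lemma M_fps_1: "1 \<in> M_fps"
  using MD by (auto simp: M_fps_def)

lemma M_fps_power: "P \<in> M_fps \<Longrightarrow> P ^ n \<in> M_fps"
  by (induction n) (auto intro: M_fps_mult M_fps_1)

lemma emb_fps_mult: "P \<in> M_fps \<Longrightarrow> Q \<in> M_fps \<Longrightarrow> emb_fps (P * Q) = emb_fps P * emb_fps Q"
  by (rule fps_ext) (auto simp: fps_mult_nth M_fps_def emb_sum emb_mult MD)

lemma emb_fps_power: "P \<in> M_fps \<Longrightarrow> emb_fps (P ^ n) = emb_fps P ^ n"
proof (induction n)
  case 0
  show ?case by (rule fps_ext) (simp add: emb_0 emb_1)
qed (simp add: emb_fps_mult M_fps_power)

lemma emb_fps_add: "P \<in> M_fps \<Longrightarrow> Q \<in> M_fps \<Longrightarrow> emb_fps (P + Q) = emb_fps P + emb_fps Q"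
  by (rule fps_ext) (auto simp: M_fps_def emb_add)

lemma M_fps_cmult: "c \<in> M \<Longrightarrow> P \<in> M_fps \<Longrightarrow> fps_const c * P \<in> M_fps"
  by (auto simp: M_fps_def intro: MD)

lemma emb_fps_cmult: "c \<in> M \<Longrightarrow> P \<in> M_fps \<Longrightarrow> emb_fps (fps_const c * P) = fps_const (\<sigma> c) * emb_fps P"
  by (rule fps_ext) (auto simp: M_fps_def emb_mult)

lemma M_fps_compose: "B \<in> M_fps \<Longrightarrow> P \<in> M_fps \<Longrightarrow> (B oo P) \<in> M_fps"
  using M_fps_power[of P] by (auto simp: M_fps_def fps_compose_nth intro!: M_sum MD)

lemma emb_fps_compose:
  assumes "\<And>n. B $ n \<in> E" "P \<in> M_fps" shows "emb_fps (B oo P) = (B oo emb_fps P)"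
proof (rule fps_ext)
  fix n
  have BM: "B $ i \<in> M" for i using assms EM by blast
  have PM: "(P ^ i) $ n \<in> M" for i using M_fps_power[OF assms(2)] by (auto simp: M_fps_def)
  have "emb_fps (B oo P) $ n = (\<Sum>i=0..n. \<sigma> (B $ i * (P ^ i) $ n))"
    unfolding emb_fps_nth fps_compose_nth using BM PM MD by (intro emb_sum) auto
  also have "\<dots> = (\<Sum>i=0..n. B $ i * (emb_fps P ^ i) $ n)"
    using BM PM assms by (intro sum.cong refl) (simp add: emb_mult emb_fix flip: emb_fps_power)
  finally show "emb_fps (B oo P) $ n = (B oo emb_fps P) $ n" by (simp add: fps_compose_nth)
qed

end

locale padic_embedding = padic v p + embedding E M \<sigma>
  for v :: "'a::field_char_0 \<Rightarrow> real" and p :: nat and E M :: "'a set" and \<sigma> :: "'a \<Rightarrow> 'a" +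
  assumes QpE: "Qp_in v \<subseteq> E" and alg: "\<And>x. algebraic_over (Qp_in v) x"
begin

lemma emb_Qp: "c \<in> Qp \<Longrightarrow> \<sigma> c = c"
  using QpE emb_fix by blast

lemma Qp_M: "Qp \<subseteq> M" using QpE EM by blast

text \<open>A bounded multiplicative map does not increase absolute values.\<close>
lemma v_emb_le: assumes x: "x \<in> M" shows "v (\<sigma> x) \<le> v x"
proof (rule ccontr)
  assume less: "\<not> v (\<sigma> x) \<le> v x"
  \<comment> \<open>A finite-dimensional domain inside \<open>M\<close> containing all powers of
    \<open>x\<close>, so that one bound \<open>C\<close> serves them all.\<close>
  obtain A where A: "fin_alg A" "Qp \<subseteq> A" "x \<in> A" "A \<subseteq> M"
    using fin_alg_adjoin[OF fin_alg_Qp alg[of x]] M Qp_M x by metis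
  obtain bs where bs: "A = Qp_span bs" using A(1) fin_alg_def by blast
  have "\<exists>C. \<forall>x\<in>Qp_span bs. v (\<sigma> x) \<le> C * v x"
    using A(4) Qp_M unfolding bs
    by (intro Qp_linear_bounded) (auto simp: emb_add emb_mult emb_Qp subset_iff)
  then obtain C where C: "\<And>y. y \<in> A \<Longrightarrow> v (\<sigma> y) \<le> C * v y" unfolding bs by blast
  have xn: "x ^ n \<in> A" for n using A by (induction n) (auto intro: fin_algD)
  have bound: "v (\<sigma> x) ^ n \<le> C * v x ^ n" for n
    using C[OF xn[of n]] emb_power[OF x] by (simp add: v_power)
  have x0: "x \<noteq> 0" using less emb_0 by auto
  then have vx: "v x > 0" using v_pos by simp
  have "(v (\<sigma> x) / v x) ^ n \<le> C" for n using bound[of n] vx by (simp add: power_divide pos_divide_le_eq)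
  moreover have "v (\<sigma> x) / v x > 1" using less vx by simp
  then obtain n where "C < (v (\<sigma> x) / v x) ^ n" using real_arch_pow by blast
  ultimately show False using not_less by blast
qed

lemma emb_conv_to:
  assumes "conv_to v X a" "\<And>n. X n \<in> M" "a \<in> M" shows "conv_to v (\<lambda>n. \<sigma> (X n)) (\<sigma> a)"
proof -
  have "v (\<sigma> (X n) - \<sigma> a) \<le> v (X n - a)" for n
    using v_emb_le[of "X n - a"] assms MD by (simp add: emb_diff)
  then show ?thesis using assms(1) unfolding conv_to_iff_LIMSEQ[of X] by (rule conv_to_bound[rotated])
qed

lemma emb_ser_eval:
  assumes "ser_eval_to v f x y 0" "x \<in> M" "y \<in> M" shows "ser_eval_to v f (\<sigma> x) (\<sigma> y) 0"
proof -
  define X where "X = (\<lambda>N. \<Sum>i<N. \<Sum>j<N - i. of_rat (f (i,j)) * x ^ i * y ^ j)"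
  have rM: "of_rat r \<in> M" for r using Qp_M Qp_of_rat by blast
  have tM: "of_rat (f (i,j)) * x ^ i * y ^ j \<in> M" for i j using rM assms by (intro MD M_power)
  have "X N \<in> M" for N unfolding X_def using tM by (intro M_sum)
  then have "conv_to v (\<lambda>N. \<sigma> (X N)) (\<sigma> 0)"
    using assms(1) MD unfolding ser_eval_to_def X_def[symmetric] by (intro emb_conv_to) auto
  moreover have "\<sigma> (X N) = (\<Sum>i<N. \<Sum>j<N - i. of_rat (f (i,j)) * \<sigma> x ^ i * \<sigma> y ^ j)" for N
  proof -
    have "\<sigma> (X N) = (\<Sum>i<N. \<Sum>j<N - i. \<sigma> (of_rat (f (i,j)) * x ^ i * y ^ j))"
      unfolding X_def using tM by (simp add: emb_sum M_sum)
    also have "\<dots> = (\<Sum>i<N. \<Sum>j<N - i. of_rat (f (i,j)) * \<sigma> x ^ i * \<sigma> y ^ j)"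
      using rM assms by (intro sum.cong refl) (simp add: emb_mult emb_power M_power MD emb_Qp)
    finally show ?thesis .
  qed
  ultimately show ?thesis unfolding ser_eval_to_def by (simp add: emb_0)
qed

text \<open>The series of multiplication by \<open>p ^ n\<close> has rational coefficients, which
  the embedding fixes, and the embedding is continuous.\<close>

lemma emb_torsion:
  assumes "(x,y) \<in> LT_torsion p h1 h2 v n" "x \<in> M" "y \<in> M"
  shows "(\<sigma> x, \<sigma> y) \<in> LT_torsion p h1 h2 v n"
proof -
  have "v (\<sigma> x) < 1" "v (\<sigma> y) < 1"
    using assms v_emb_le[of x] v_emb_le[of y] by (auto simp: LT_torsion_def)
  then show ?thesis using assms emb_ser_eval by (simp add: LT_torsion_def)
qed

end

section \<open>Torsion points in terms of logarithms\<close>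

context lt_alg
begin

lemma logs_Linv: assumes "logs x y" shows "Linv1 x y \<in> SS" "Linv2 x y \<in> SS"
proof -
  obtain P Q where PQ: "P \<in> SS" "Q \<in> SS" "x = Lam1 P Q" "y = Lam2 P Q" using assms unfolding logs_def by blast
  then show "Linv1 x y \<in> SS" "Linv2 x y \<in> SS" using Linv_Lam[of P Q] SS_nth_0 by auto
qed

lemma logs_nth_0: "logs x y \<Longrightarrow> x $ 0 = 0" "logs x y \<Longrightarrow> y $ 0 = 0"
  by (auto simp: logs_def)

lemma Lam_Linv_logs: "logs x y \<Longrightarrow> Lam1 (Linv1 x y) (Linv2 x y) = x" "logs x y \<Longrightarrow> Lam2 (Linv1 x y) (Linv2 x y) = y"
  using Lam_Linv logs_nth_0 by blast+

lemma nul_iff_ev: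
  assumes "logs x y" "logs x' y'"
  shows "nul (x - x') (y - y') \<longleftrightarrow> ev (Linv1 x y) = ev (Linv1 x' y') \<and> ev (Linv2 x y) = ev (Linv2 x' y')"
  using nul_Lam_iff[OF logs_Linv[OF assms(1)] logs_Linv[OF assms(2)]] Lam_Linv_logs[OF assms(1)] Lam_Linv_logs[OF assms(2)]
  by simp

text \<open>Together with \<open>pt2\<close>, the logarithm of the standard lift
  \<open>(x t, y t)\<close> of the point \<open>(x, y)\<close>.\<close>

definition pt1 :: "'a \<Rightarrow> 'a \<Rightarrow> 'a fps" where "pt1 x y = Lam1 (lin x 1) (lin y 1)"
definition pt2 :: "'a \<Rightarrow> 'a \<Rightarrow> 'a fps" where "pt2 x y = Lam2 (lin x 1) (lin y 1)"

lemma logs_pt: "x \<in> A \<Longrightarrow> y \<in> A \<Longrightarrow> v x < 1 \<Longrightarrow> v y < 1 \<Longrightarrow> logs (pt1 x y) (pt2 x y)"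
  unfolding pt1_def pt2_def using lin_SS by (intro logs_Lam) auto

lemma Linv_pt: "Linv1 (pt1 x y) (pt2 x y) = lin x 1" "Linv2 (pt1 x y) (pt2 x y) = lin y 1"
  by (simp_all add: pt1_def pt2_def Linv_Lam lin_nth)

text \<open>Substituting \<open>x t\<close> and \<open>y t\<close> collects terms by total degree,
  which reproduces the triangular partial sums of \<open>ser_eval_to\<close>.\<close>

lemma psum_ser_ev:
  "psum (ser_ev f (lin x 1) (lin y 1)) N = (\<Sum>i<N. \<Sum>j<N - i. of_rat (f (i,j)) * x ^ i * y ^ j)"
proof -
  let ?g = "\<lambda>i j. of_rat (f (i,j)) * x ^ i * y ^ j"
  have "lin x 1 ^ i * lin y 1 ^ j = lin (x ^ i * y ^ j) (i + j)" for i j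
    by (simp add: lin_def power_mult_distrib fps_const_power power_add algebra_simps flip: fps_const_mult)
  then have nth: "(lin x 1 ^ i * lin y 1 ^ j) $ m = (if m = i + j then x ^ i * y ^ j else 0)" for i j m
    by (simp add: lin_nth)
  have z: "lin x 1 $ 0 = 0" "lin y 1 $ 0 = 0" by (simp_all add: lin_nth)
  have "ser_ev f (lin x 1) (lin y 1) $ m = (\<Sum>i\<le>m. \<Sum>j\<le>m - i. if j = m - i then ?g i j else 0)" for m
    unfolding ser_ev_nth_triangle[OF z] nth by (intro sum.cong refl) auto
  then have "psum (ser_ev f (lin x 1) (lin y 1)) N = (\<Sum>m<N. \<Sum>i\<le>m. ?g i (m - i))"
    by (simp add: psum_def)
  also have "\<dots> = (\<Sum>(i,j)\<in>{(i,j). i + j < N}. ?g i j)" by (rule sum.triangle_reindex[symmetric])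
  also have "{(i,j). i + j < N} = Sigma {..<N} (\<lambda>i. {..<N - i})" by auto
  also have "(\<Sum>(i,j)\<in>Sigma {..<N} (\<lambda>i. {..<N - i}). ?g i j) = (\<Sum>i<N. \<Sum>j<N - i. ?g i j)"
    by (rule sum.Sigma[symmetric]) auto
  finally show ?thesis .
qed

text \<open>Translates the convergence condition defining \<open>LT_torsion\<close>: the
  multiplication series at the standard lift is \<open>L^-1\<close> of the scaled logarithm, which
  is again a formal point because multiples are iterated subtractions.\<close>

lemma torsion_iff_nul:
  assumes "x \<in> A" "y \<in> A" "v x < 1" "v y < 1"
  shows "(x,y) \<in> LT_torsion p h1 h2 v n \<longleftrightarrow> nul (fp ^ n * pt1 x y) (fp ^ n * pt2 x y)"
proof -
  have fpn: "fp ^ n = of_nat (p ^ n)" by (simp add: fps_const_power fps_of_nat flip: of_nat_power)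
  have lg: "logs (fp ^ n * pt1 x y) (fp ^ n * pt2 x y)" unfolding fpn using logs_of_nat logs_pt assms by blast
  define R T where "R = Linv1 (fp ^ n * pt1 x y) (fp ^ n * pt2 x y)" and "T = Linv2 (fp ^ n * pt1 x y) (fp ^ n * pt2 x y)"
  have RT: "R \<in> SS" "T \<in> SS" unfolding R_def T_def using logs_Linv[OF lg] by auto
  have c: "fps_const (of_rat (of_nat (p ^ n))) = fp ^ n" by (simp add: fps_const_power of_rat_power)
  have z: "lin x 1 $ 0 = 0" "lin y 1 $ 0 = 0" by (simp_all add: lin_nth)
  have ser: "ser_ev (fst (LT_mult p h1 h2 (of_nat (p ^ n)))) (lin x 1) (lin y 1) = R"
    "ser_ev (snd (LT_mult p h1 h2 (of_nat (p ^ n)))) (lin x 1) (lin y 1) = T"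
    unfolding ser_ev_LT_mult[OF z] R_def T_def pt1_def pt2_def c by (rule refl)+
  have conv: "conv_to v (psum P) 0 \<longleftrightarrow> ev P = 0" if "P \<in> SS" for P
    using that ev_conv(1) ev_eqI by (force simp: SS_def)
  have "(x,y) \<in> LT_torsion p h1 h2 v n \<longleftrightarrow> conv_to v (psum R) 0 \<and> conv_to v (psum T) 0"
    unfolding LT_torsion_def mem_Collect_eq prod.case ser_eval_to_def psum_ser_ev[symmetric] ser using assms by simp
  also have "\<dots> \<longleftrightarrow> nul (fp ^ n * pt1 x y) (fp ^ n * pt2 x y)"
    using nul_Lam_iff_0[OF RT] Lam_Linv_logs[OF lg] conv RT by (simp add: R_def T_def)
  finally show ?thesis .
qed

lemma W_mem: assumes "W a a'" "is_subfield U" "Qp \<subseteq> U" "\<And>z. z ^ q = z \<Longrightarrow> z \<in> U" shows "a \<in> U \<and> a' \<in> U"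
  using assms(1)
proof (induction rule: W.induct)
  case zero
  then show ?case using subfieldD[OF assms(2)] by simp
next
  case (step z a a')
  have pU: "of_nat p \<in> U" using assms(3) Qp_of_nat by blast
  have zU: "z \<in> U" by (rule assms(4)[OF step(1)])
  have "z ^ k \<in> U" for k using zU subfieldD[OF assms(2)] by (induction k) auto
  then show ?case using step.IH zU pU by (simp add: subfieldD[OF assms(2)])
qed

end

section \<open>Commutativity of the Galois action\<close>

text \<open>If \<open>\<sigma>\<close> acts on the torsion point \<open>X\<close> as the endomorphism \<open>a\<close>, and \<open>X' = b X\<close>, then
  \<open>\<sigma> X' = b (\<sigma> X) = b a X\<close>, because \<open>\<sigma>\<close> fixes the coefficients of the endomorphism \<open>b\<close>.\<close>
lemma (in lt_alg) emb_action:
  assumes pe: "padic_embedding v p U M \<sigma>" and U: "is_subfield U" "U \<subseteq> B"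
    and B: "fin_alg B" "B \<subseteq> M" "B \<subseteq> A"
    and mu: "\<And>z. z ^ q = z \<Longrightarrow> z \<in> U"
    and mem: "x \<in> B" "y \<in> B" "x' \<in> M" "y' \<in> M" "\<sigma> x \<in> A" "\<sigma> y \<in> A" "x' \<in> A" "y' \<in> A"
    and vs: "v x < 1" "v y < 1" "v x' < 1" "v y' < 1"
    and a: "W a a'" "nul (pt1 (\<sigma> x) (\<sigma> y) - fps_const a * pt1 x y) (pt2 (\<sigma> x) (\<sigma> y) - fps_const a' * pt2 x y)"
    and c: "W c c'" "nul (pt1 x' y' - fps_const c * pt1 x y) (pt2 x' y' - fps_const c' * pt2 x y)"
  shows "\<sigma> x' = ev (Linv1 (fps_const (c * a) * pt1 x y) (fps_const (c' * a') * pt2 x y))"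
    "\<sigma> y' = ev (Linv2 (fps_const (c * a) * pt1 x y) (fps_const (c' * a') * pt2 x y))"
proof -
  interpret padic_embedding v p U M \<sigma> by (rule pe)
  \<comment> \<open>Over the smaller algebra \<open>B\<close> inside \<open>M\<close> the series
    \<open>R\<close> and \<open>T\<close> have coefficients to which the embedding applies;
    \<open>A\<close> is needed for the images.\<close>
  interpret LB: lt_alg v p h1 h2 B by unfold_locales (rule B)
  have muA: "\<And>z. z ^ q = z \<Longrightarrow> z \<in> A" "\<And>z. z ^ q = z \<Longrightarrow> z \<in> B" using mu U(2) B(3) by blast+
  have cU: "c \<in> U" "c' \<in> U" using W_mem[OF c(1) U(1) QpE mu] by auto
  have xM: "x \<in> M" "y \<in> M" using mem B by auto
  have vsig: "v (\<sigma> x) < 1" "v (\<sigma> y) < 1" using v_emb_le[OF xM(1)] v_emb_le[OF xM(2)] vs by linarith+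
  have xA: "x \<in> A" "y \<in> A" using mem B by auto
  let ?g1 = "pt1 x y" and ?g2 = "pt2 x y" and ?s1 = "pt1 (\<sigma> x) (\<sigma> y)" and ?s2 = "pt2 (\<sigma> x) (\<sigma> y)"
  have lg: "logs ?g1 ?g2" "logs ?s1 ?s2" "logs (pt1 x' y') (pt2 x' y')"
    using logs_pt mem vs vsig xA by auto
  have lcg: "logs (fps_const c * ?g1) (fps_const c' * ?g2)" using logs_W[OF muA(1) c(1) lg(1)] .
  have lBcg: "LB.logs (fps_const c * ?g1) (fps_const c' * ?g2)"
    using LB.logs_W[OF muA(2) c(1) LB.logs_pt] mem vs by simp
  define R T where "R = Linv1 (fps_const c * ?g1) (fps_const c' * ?g2)" and "T = Linv2 (fps_const c * ?g1) (fps_const c' * ?g2)"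
  have evR: "ev R = x'" "ev T = y'"
    using c(2) nul_iff_ev[OF lg(3) lcg] unfolding R_def T_def by (simp_all add: Linv_pt ev_lin)
  have "R \<in> LB.SS" "T \<in> LB.SS" unfolding R_def T_def using LB.logs_Linv[OF lBcg] by auto
  then have RM: "R \<in> M_fps" "T \<in> M_fps" using B(2) by (auto simp: LB.SS_def LB.S_def M_fps_def)
  have R0: "R $ 0 = 0" "T $ 0 = 0" by (simp_all add: R_def T_def)
  have bE: "b $ n \<in> U" for n using QpE Qp_of_rat by (auto simp: beta_fps_def)
  have bM: "b \<in> M_fps" using bE EM by (auto simp: M_fps_def)
  have pE: "1 / of_nat p \<in> U" using QpE Qp_of_rat[of "1 / of_nat p"] by (auto simp: of_rat_divide)
  have pM: "1 / of_nat p \<in> M" using pE EM by blast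
  have emb_Lam: "emb_fps (Lam1 P Q) = Lam1 (emb_fps P) (emb_fps Q)" "emb_fps (Lam2 P Q) = Lam2 (emb_fps P) (emb_fps Q)"
    if PQ: "P \<in> M_fps" "Q \<in> M_fps" for P Q
  proof -
    have m: "(b oo P) \<in> M_fps" "(b oo Q) \<in> M_fps" "(b oo P ^ q2) \<in> M_fps" "(b oo Q ^ q1) \<in> M_fps"
      using PQ bM by (auto intro: M_fps_compose M_fps_power)
    show "emb_fps (Lam1 P Q) = Lam1 (emb_fps P) (emb_fps Q)" "emb_fps (Lam2 P Q) = Lam2 (emb_fps P) (emb_fps Q)"
      unfolding Lam1_def Lam2_def using m PQ
      by (simp_all add: emb_fps_add emb_fps_cmult[OF pM] M_fps_cmult[OF pM] emb_fps_compose[OF bE] M_fps_power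
          emb_fps_power emb_fix[OF pE])
  qed
  have linM: "lin x 1 \<in> M_fps" "lin y 1 \<in> M_fps" using xM MD by (auto simp: M_fps_def lin_nth)
  have "emb_fps (lin x 1) = lin (\<sigma> x) 1" "emb_fps (lin y 1) = lin (\<sigma> y) 1"
    by (auto simp: fps_eq_iff lin_nth emb_0)
  then have emb_pt: "emb_fps ?g1 = ?s1" "emb_fps ?g2 = ?s2"
    unfolding pt1_def pt2_def using emb_Lam[OF linM] by simp_all
  have gM: "?g1 \<in> M_fps" "?g2 \<in> M_fps"
  proof -
    have add: "P + Q \<in> M_fps" if "P \<in> M_fps" "Q \<in> M_fps" for P Q
      using that by (auto simp: M_fps_def intro: MD)
    show "?g1 \<in> M_fps" "?g2 \<in> M_fps"
      unfolding pt1_def pt2_def Lam1_def Lam2_def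
      by (intro add M_fps_cmult M_fps_compose M_fps_power linM bM pM)+
  qed
  have cM: "c \<in> M" "c' \<in> M" using cU EM by auto
  have "Lam1 R T = fps_const c * ?g1" "Lam2 R T = fps_const c' * ?g2"
    unfolding R_def T_def using Lam_Linv_logs[OF lcg] by auto
  then have "Lam1 (emb_fps R) (emb_fps T) = fps_const c * ?s1" "Lam2 (emb_fps R) (emb_fps T) = fps_const c' * ?s2"
    using emb_Lam[OF RM] by (simp_all add: emb_fps_cmult[OF cM(1) gM(1)] emb_fps_cmult[OF cM(2) gM(2)] emb_pt emb_fix[OF cU(1)] emb_fix[OF cU(2)])
  moreover have "emb_fps R $ 0 = 0" "emb_fps T $ 0 = 0" using R0 emb_0 by simp_all
  ultimately have sR: "emb_fps R = Linv1 (fps_const c * ?s1) (fps_const c' * ?s2)" "emb_fps T = Linv2 (fps_const c * ?s1) (fps_const c' * ?s2)"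
    using Linv_Lam[of "emb_fps R" "emb_fps T"] by simp_all
  \<comment> \<open>Continuity of the embedding, applied to the partial sums of
    \<open>P\<close>.\<close>
  have ev_emb: "ev (emb_fps P) = \<sigma> (ev P)" if "P \<in> LB.SS" "ev P \<in> M" "P \<in> M_fps" for P
  proof (rule ev_eqI)
    from that(1) obtain r where r: "0 < r" "r < 1" "P \<in> LB.S r" by (auto simp: LB.SS_def)
    have cv: "conv_to v (psum P) (ev P)" using LB.ev_conv(1)[OF r] .
    have "psum P N \<in> M" for N using that(3) unfolding psum_def by (intro M_sum) (auto simp: M_fps_def)
    then have "conv_to v (\<lambda>N. \<sigma> (psum P N)) (\<sigma> (ev P))" by (rule emb_conv_to[OF cv _ that(2)])
    moreover have "psum (emb_fps P) = (\<lambda>N. \<sigma> (psum P N))"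
      using that(3) unfolding psum_def by (intro ext, subst emb_sum) (auto simp: M_fps_def)
    ultimately show "conv_to v (psum (emb_fps P)) (\<sigma> (ev P))" by simp
  qed
  have lcs: "logs (fps_const c * ?s1) (fps_const c' * ?s2)" using logs_W[OF muA(1) c(1) lg(2)] .
  have lca: "logs (fps_const c * (fps_const a * ?g1)) (fps_const c' * (fps_const a' * ?g2))"
    using logs_W[OF muA(1) c(1) logs_W[OF muA(1) a(1) lg(1)]] .
  have "nul (fps_const c * ?s1 - fps_const c * (fps_const a * ?g1)) (fps_const c' * ?s2 - fps_const c' * (fps_const a' * ?g2))"
    using nul_W[OF muA(1) c(1) a(2)] by (simp add: right_diff_distrib)
  then have "ev (emb_fps R) = ev (Linv1 (fps_const c * (fps_const a * ?g1)) (fps_const c' * (fps_const a' * ?g2)))"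
    "ev (emb_fps T) = ev (Linv2 (fps_const c * (fps_const a * ?g1)) (fps_const c' * (fps_const a' * ?g2)))"
    using nul_iff_ev[OF lcs lca] sR by simp_all
  moreover have "ev (emb_fps R) = \<sigma> x'" "ev (emb_fps T) = \<sigma> y'"
    using ev_emb[of R] ev_emb[of T] \<open>R \<in> LB.SS\<close> \<open>T \<in> LB.SS\<close> RM evR mem by simp_all
  ultimately show "\<sigma> x' = ev (Linv1 (fps_const (c * a) * pt1 x y) (fps_const (c' * a') * pt2 x y))"
    "\<sigma> y' = ev (Linv2 (fps_const (c * a) * pt1 x y) (fps_const (c' * a') * pt2 x y))"
    by (simp_all add: mult.assoc flip: fps_const_mult)
qed

lemma (in lubin_tate) torsion_commute:
  assumes pe: "padic_embedding v p U M \<sigma>" "padic_embedding v p U M \<tau>" and into: "\<sigma> ` M \<subseteq> M" "\<tau> ` M \<subseteq> M"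
    and U: "is_subfield U" "fin_alg U" and mu: "\<And>z. z ^ q = z \<Longrightarrow> z \<in> U"
    and closed: "alg_closed_field TYPE('a)"
    and t: "(x,y) \<in> LT_torsion p h1 h2 v n" "x \<in> M" "y \<in> M"
  shows "\<sigma> (\<tau> x) = \<tau> (\<sigma> x) \<and> \<sigma> (\<tau> y) = \<tau> (\<sigma> y)"
proof -
  interpret s: padic_embedding v p U M \<sigma> by (rule pe)
  interpret t: padic_embedding v p U M \<tau> by (rule pe)
  have adjoin: "\<exists>A'. fin_alg A' \<and> A \<subseteq> A' \<and> A' \<subseteq> M \<and> w \<in> A'" if "fin_alg A" "A \<subseteq> M" "w \<in> M" for A w
    using fin_alg_adjoin[OF that(1) s.alg[of w]] s.M that by metis
  \<comment> \<open>\<open>B\<close> will contain \<open>U\<close> and the point, \<open>A\<close>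
    also its images under both embeddings; the tower stays inside \<open>M\<close>.\<close>
  obtain B0 where B0: "fin_alg B0" "U \<subseteq> B0" "B0 \<subseteq> M" "x \<in> B0" using adjoin[OF U(2) s.EM t(2)] by blast
  obtain B where B: "fin_alg B" "B0 \<subseteq> B" "B \<subseteq> M" "y \<in> B" using adjoin[OF B0(1,3) t(3)] by blast
  have im: "\<sigma> x \<in> M" "\<sigma> y \<in> M" "\<tau> x \<in> M" "\<tau> y \<in> M" using into t by auto
  obtain A1 where A1: "fin_alg A1" "B \<subseteq> A1" "A1 \<subseteq> M" "\<sigma> x \<in> A1" using adjoin[OF B(1,3) im(1)] by blast
  obtain A2 where A2: "fin_alg A2" "A1 \<subseteq> A2" "A2 \<subseteq> M" "\<sigma> y \<in> A2" using adjoin[OF A1(1,3) im(2)] by blast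
  obtain A3 where A3: "fin_alg A3" "A2 \<subseteq> A3" "A3 \<subseteq> M" "\<tau> x \<in> A3" using adjoin[OF A2(1,3) im(3)] by blast
  obtain A where A: "fin_alg A" "A3 \<subseteq> A" "A \<subseteq> M" "\<tau> y \<in> A" using adjoin[OF A3(1,3) im(4)] by blast
  have mem: "x \<in> B" "y \<in> B" "\<sigma> x \<in> A" "\<sigma> y \<in> A" "\<tau> x \<in> A" "\<tau> y \<in> A" "x \<in> A" "y \<in> A" "U \<subseteq> B" "B \<subseteq> A"
    using B0 B A1 A2 A3 A by blast+
  interpret L: lt_alg v p h1 h2 A by unfold_locales (rule A)
  have muA: "\<And>z. z ^ q = z \<Longrightarrow> z \<in> A" using mu mem by blast
  have vx: "v x < 1" "v y < 1" using t by (auto simp: LT_torsion_def)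
  have vs: "v (\<sigma> x) < 1" "v (\<sigma> y) < 1" "v (\<tau> x) < 1" "v (\<tau> y) < 1"
    using s.v_emb_le[OF t(2)] s.v_emb_le[OF t(3)] t.v_emb_le[OF t(2)] t.v_emb_le[OF t(3)] vx by linarith+
  \<comment> \<open>The exact order is needed: only then does the point generate everything killed
    by \<open>p ^ n0\<close>, its images included.\<close>
  define n0 where "n0 = (LEAST n. (x,y) \<in> LT_torsion p h1 h2 v n)"
  have n0: "(x,y) \<in> LT_torsion p h1 h2 v n0" unfolding n0_def using t(1) by (rule LeastI)
  have n0m: "(x,y) \<notin> LT_torsion p h1 h2 v (n0 - 1)" if "n0 > 0"
    using that not_less_Least[of "n0 - 1" "\<lambda>n. (x,y) \<in> LT_torsion p h1 h2 v n"] by (simp add: n0_def)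
  have st: "(\<sigma> x, \<sigma> y) \<in> LT_torsion p h1 h2 v n0" "(\<tau> x, \<tau> y) \<in> LT_torsion p h1 h2 v n0"
    using s.emb_torsion[OF n0 t(2,3)] t.emb_torsion[OF n0 t(2,3)] by auto
  note tx = L.torsion_iff_nul[OF mem(7,8) vx] and ts = L.torsion_iff_nul[OF mem(3,4) vs(1,2)] and tt = L.torsion_iff_nul[OF mem(5,6) vs(3,4)]
  note lx = L.logs_pt[OF mem(7,8) vx] and ls = L.logs_pt[OF mem(3,4) vs(1,2)] and lt = L.logs_pt[OF mem(5,6) vs(3,4)]
  note cyc = L.torsion_cyclic[OF closed muA lx n0[unfolded tx] n0m[unfolded tx]]
  obtain a a' where a: "L.W a a'" "L.nul (L.pt1 (\<sigma> x) (\<sigma> y) - fps_const a * L.pt1 x y) (L.pt2 (\<sigma> x) (\<sigma> y) - fps_const a' * L.pt2 x y)"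
    using cyc[OF _ _ ls st(1)[unfolded ts]] by blast
  obtain c c' where c: "L.W c c'" "L.nul (L.pt1 (\<tau> x) (\<tau> y) - fps_const c * L.pt1 x y) (L.pt2 (\<tau> x) (\<tau> y) - fps_const c' * L.pt2 x y)"
    using cyc[OF _ _ lt st(2)[unfolded tt]] by blast
  have "\<sigma> (\<tau> x) = L.ev (Linv1 (fps_const (c * a) * L.pt1 x y) (fps_const (c' * a') * L.pt2 x y))"
    "\<sigma> (\<tau> y) = L.ev (Linv2 (fps_const (c * a) * L.pt1 x y) (fps_const (c' * a') * L.pt2 x y))"
    by (rule L.emb_action[OF pe(1) U(1) mem(9) B(1,3) mem(10) mu mem(1,2) im(3,4) mem(3,4,5,6) vx vs(3,4) a c]; assumption)+
  moreover have "\<tau> (\<sigma> x) = L.ev (Linv1 (fps_const (a * c) * L.pt1 x y) (fps_const (a' * c') * L.pt2 x y))"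
    "\<tau> (\<sigma> y) = L.ev (Linv2 (fps_const (a * c) * L.pt1 x y) (fps_const (a' * c') * L.pt2 x y))"
    by (rule L.emb_action[OF pe(2) U(1) mem(9) B(1,3) mem(10) mu mem(1,2) im(1,2) mem(5,6,3,4) vx vs(1,2) c a]; assumption)+
  ultimately show ?thesis by (simp add: mult.commute)
qed

lemma gen_field_props:
  shows "is_subfield (gen_field E T)" "E \<subseteq> gen_field E T" "T \<subseteq> gen_field E T"
    and gen_field_least: "is_subfield S \<Longrightarrow> E \<subseteq> S \<Longrightarrow> T \<subseteq> S \<Longrightarrow> gen_field E T \<subseteq> S"
  unfolding gen_field_def is_subfield_def by auto

theorem theorem5p2:
  fixes p h1 h2 h :: nat and v :: "'a::field_char_0 \<Rightarrow> real" and U :: "'a set"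
  assumes "prime p"
    and "h1 > 0" and "h2 > 0" and "coprime h1 h2" and "h = h1 + h2"
    and "is_alg_closure_Qp p v"
    and "is_subfield U" and "Qp_in v \<subseteq> U"
    and "has_degree (Qp_in v) U h"
    and "unramified_over v (Qp_in v) U"
  shows "abelian_ext U (gen_field U (coords (LT_Tors p h1 h2 v)))"
proof -
  have ac: "nonarch_abs v" "\<And>r. v (of_rat r) = padic_abs p r"
    "\<And>X. (\<And>n. X n \<in> Qp_in v) \<Longrightarrow> cauchy_v v X \<Longrightarrow> \<exists>l. conv_to v X l"
    and closed: "alg_closed_field TYPE('a)" and alg: "\<And>x. algebraic_over (Qp_in v) x"
    using assms(6) unfolding is_alg_closure_Qp_def by blast+
  interpret lubin_tate v p h1 h2
    by unfold_locales (use ac assms(1-3) in auto)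
  have hpos: "h1 + h2 > 0" using assms(2) by simp
  note Uh = assms(7,8) assms(9)[unfolded assms(5)] assms(10) hpos
  have mu: "z \<in> U" if "z ^ (p ^ (h1 + h2)) = z" for z using roots_of_unity_mem[OF Uh that] .
  have finU: "fin_alg U" using U_fin_alg[OF Uh] .
  define T where "T = LT_Tors p h1 h2 v"
  define M where "M = gen_field U (coords T)"
  have M: "is_subfield M" "U \<subseteq> M" "coords T \<subseteq> M"
    unfolding M_def by (rule gen_field_props)+
  have least: "M \<subseteq> S" if "is_subfield S" "U \<subseteq> S" "coords T \<subseteq> S" for S
    unfolding M_def by (rule gen_field_least[OF that])
  have coordsI: "x \<in> coords T" "y \<in> coords T" if "(x,y) \<in> LT_torsion p h1 h2 v n" "n \<ge> 1" for x y n
    using that by (force simp: coords_def T_def LT_Tors_def)+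
  have coordsE: "\<exists>x y n. n \<ge> 1 \<and> (x,y) \<in> LT_torsion p h1 h2 v n \<and> (c = x \<or> c = y)" if "c \<in> coords T" for c
    using that by (force simp: coords_def T_def LT_Tors_def)
  have pe: "padic_embedding v p U M \<sigma>" if "emb_over U M \<sigma>" for \<sigma>
    by unfold_locales (use M that assms(8) alg in auto)
  have into: "\<sigma> ` M \<subseteq> M" if e: "emb_over U M \<sigma>" for \<sigma>
  proof -
    interpret e: padic_embedding v p U M \<sigma> by (rule pe[OF e])
    \<comment> \<open>By minimality of \<open>M\<close> it is enough to treat the generators, and
      embeddings send torsion points to torsion points.\<close>
    have "is_subfield {x \<in> M. \<sigma> x \<in> M}"
      unfolding is_subfield_def using e.MD by (auto simp: e.emb_0 e.emb_1 e.emb_add e.emb_diff e.emb_mult e.emb_inverse)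
    moreover have "U \<subseteq> {x \<in> M. \<sigma> x \<in> M}" using M(2) e.emb_fix by auto
    moreover have "coords T \<subseteq> {x \<in> M. \<sigma> x \<in> M}"
    proof
      fix c assume c: "c \<in> coords T"
      then obtain x y n where xy: "n \<ge> 1" "(x,y) \<in> LT_torsion p h1 h2 v n" "c = x \<or> c = y" using coordsE by blast
      have xM: "x \<in> M" "y \<in> M" using coordsI[OF xy(2,1)] M by auto
      have "\<sigma> x \<in> M" "\<sigma> y \<in> M" using coordsI[OF e.emb_torsion[OF xy(2) xM] xy(1)] M by auto
      then show "c \<in> {x \<in> M. \<sigma> x \<in> M}" using xy xM by auto
    qed
    ultimately show ?thesis using least by blast
  qed
  have normal: "\<sigma> ` M = M" if e: "emb_over U M \<sigma>" for \<sigma>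
  proof -
    interpret e: padic_embedding v p U M \<sigma> by (rule pe[OF e])
    show ?thesis
    proof (rule e.emb_surj[OF into[OF e]])
      fix x show "algebraic_over U x" using alg[of x] assms(8) unfolding algebraic_over_def by blast
    qed
  qed
  have "\<sigma> (\<tau> x) = \<tau> (\<sigma> x)" if e: "emb_over U M \<sigma>" "emb_over U M \<tau>" and x: "x \<in> M" for \<sigma> \<tau> x
  proof -
    interpret s: padic_embedding v p U M \<sigma> by (rule pe[OF e(1)])
    interpret t: padic_embedding v p U M \<tau> by (rule pe[OF e(2)])
    have i: "\<sigma> y \<in> M" "\<tau> y \<in> M" if "y \<in> M" for y using into e that by blast+
    \<comment> \<open>Commutation holds on a subfield, so it too reduces to the coordinates of
      torsion points.\<close>
    let ?S = "{x \<in> M. \<sigma> (\<tau> x) = \<tau> (\<sigma> x)}"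
    have "is_subfield ?S"
      unfolding is_subfield_def using s.MD i
      by (auto simp: s.emb_0 s.emb_1 s.emb_add s.emb_diff s.emb_mult s.emb_inverse
          t.emb_0 t.emb_1 t.emb_add t.emb_diff t.emb_mult t.emb_inverse)
    moreover have "U \<subseteq> ?S" using M(2) s.emb_fix t.emb_fix by auto
    moreover have "coords T \<subseteq> ?S"
    proof
      fix c assume c: "c \<in> coords T"
      then obtain x y n where xy: "n \<ge> 1" "(x,y) \<in> LT_torsion p h1 h2 v n" "c = x \<or> c = y" using coordsE by blast
      have xM: "x \<in> M" "y \<in> M" using coordsI[OF xy(2,1)] M by auto
      show "c \<in> ?S"
        using torsion_commute[OF pe[OF e(1)] pe[OF e(2)] into[OF e(1)] into[OF e(2)] assms(7) finU mu closed xy(2) xM] xy xM by auto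
    qed
    ultimately show ?thesis using least x by blast
  qed
  then show ?thesis unfolding abelian_ext_def M_def[symmetric] T_def[symmetric] using normal by blast
qed

end
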